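(* Let $n=n_1+n_2$, let $1 \leq q \leq p$, and let $w\in A_{q,\mathfrak{R}}$ in $\mathbb{R}^{n}=\mathbb{R}^{n_1}\times\mathbb{R}^{n_2}$. Let $p^*$ be defined by $$\frac1p-\frac1{p^*}= \frac1{n}\,\frac1{q+\log [w]_{A_{q,\mathfrak{R}}} },$$ where it is understood that $0<p^*<\infty$. Then there exists a constant $c=c(n,p,q)>0$ such that for every Lipschitz function $f$ and every $R=I_1\times I_2\in \mathfrak{R}$, $$\left\|f-f_R\right \|_{L^{p^*}\left(R, \frac{w\,dx}{w(R)}\right)}\leq c\,[w]_{A_{p,\mathfrak{R}}}^{\frac{1}{p}} \big(a_1(R)+a_2(R)\big),$$ where $$a_1(R)= \ell(I_1) \left\|\nabla_1 f\right \|_{L^{p}\left(R, \frac{w\,dx}{w(R)}\right)}\quad\text{and}\quad a_2(R)= \ell(I_2) \left\|\nabla_2 f\right \|_{L^{p}\left(R, \frac{w\,dx}{w(R)}\right)}.$$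
   Context: $\mathfrak{R}$ is the family of rectangles $R=I_1\times I_2\subset\mathbb{R}^n$ where $I_1\subset\mathbb{R}^{n_1}$ and $I_2\subset\mathbb{R}^{n_2}$ are cubes with sides parallel to the coordinate axes, $n=n_1+n_2$; $\ell(I)$ is the sidelength of the cube $I$. Points are written $x=(x_1,x_2)$ with $x_i\in\mathbb{R}^{n_i}$; $\nabla_1f$ and $\nabla_2 f$ are the partial gradients of $f$ in the variables $x_1$ and $x_2$. $f_R=\frac1{|R|}\int_Rf\,dx$. A weight is a nonnegative locally integrable function $w$, $w(E)=\int_Ew\,dx$, and $\|g\|_{L^{r}(R,\frac{w\,dx}{w(R)})}=\big(\frac1{w(R)}\int_R|g|^r w\,dx\big)^{1/r}$. For $1<r<\infty$, $[w]_{A_{r,\mathfrak{R}}}:=\sup_{R\in\mathfrak{R}}\big(\frac1{|R|}\int_R w\big)\big(\frac1{|R|}\int_R w^{-\frac1{r-1}}\big)^{r-1}$; $[w]_{A_{1,\mathfrak{R}}}$ is the smallest $c$ with $\frac1{|R|}\int_R w\le c\,\operatorname{ess\,inf}_R w$ for all $R\in\mathfrak{R}$. $A_{r,\mathfrak{R}}$ is the class of weights for which $[w]_{A_{r,\mathfrak{R}}}<\infty$.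
   Formalization: The pair q = 1, p = n is excluded: there no c = c(n,p,q) works, since weights w with [w]_{A_1} → 1 give p* → ∞ and would force a bound of sup|f − f_R| by the L^n norm of the gradient, which is false for n ≥ 2. *)

theory Defs
  imports "HOL-Analysis.Analysis"
begin

text \<open>
  The splitting $\mathbb{R}^n = \mathbb{R}^{n_1} \times \mathbb{R}^{n_2}$ is encoded by a set
  \<open>S\<close> of coordinate indices of \<^typ>\<open>real ^ 'n\<close>: \<open>x\<^sub>1\<close> collects the coordinates in \<open>S\<close> and
  \<open>x\<^sub>2\<close> those in \<open>- S\<close>, so that \<open>n = CARD('n)\<close>, \<open>n\<^sub>1 = card S\<close> and \<open>n\<^sub>2 = card (- S)\<close>. Unlike a
  product of two types, this allows a constant depending on \<open>n\<close> to be chosen before the splitting.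
\<close>

definition rectangle :: "'n::finite set \<Rightarrow> real ^ 'n \<Rightarrow> real \<Rightarrow> real \<Rightarrow> (real ^ 'n) set" where
  "rectangle S a l1 l2 =
    {x. (\<forall>i\<in>S. a $ i \<le> x $ i \<and> x $ i \<le> a $ i + l1) \<and>
        (\<forall>i\<in>- S. a $ i \<le> x $ i \<and> x $ i \<le> a $ i + l2)}"

definition rectangles :: "'n::finite set \<Rightarrow> (real ^ 'n) set set" where
  "rectangles S = {rectangle S a l1 l2 |a l1 l2. 0 < l1 \<and> 0 < l2}"

definition weight :: "(real ^ 'n::finite \<Rightarrow> real) \<Rightarrow> bool" where
  "weight w \<longleftrightarrow> (\<forall>x. 0 \<le> w x) \<and> (\<forall>K. compact K \<longrightarrow> w absolutely_integrable_on K)"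

text \<open>
  Real powers in \<open>[0, \<infinity>]\<close>. In contrast to \<^const>\<open>powr\<close>, a negative power of \<open>0\<close> is \<open>\<infinity>\<close>;
  this matters for \<open>w\<close> to the power \<open>-1/(r-1)\<close> at the zeros of \<open>w\<close>.
\<close>

definition epowr :: "ennreal \<Rightarrow> real \<Rightarrow> ennreal" where
  "epowr x s =
    (if s = 0 then 1
     else if x = 0 then (if s < 0 then \<infinity> else 0)
     else if x = \<infinity> then (if s < 0 then 0 else \<infinity>)
     else ennreal (enn2real x powr s))"

definition mean :: "(real ^ 'n::finite) set \<Rightarrow> (real ^ 'n \<Rightarrow> real) \<Rightarrow> real" where
  "mean R f = (LINT x:R|lebesgue. f x) / measure lebesgue R"

definition emean :: "(real ^ 'n::finite) set \<Rightarrow> (real ^ 'n \<Rightarrow> ennreal) \<Rightarrow> ennreal" where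
  "emean R g = (\<integral>\<^sup>+x\<in>R. g x \<partial>lebesgue) / emeasure lebesgue R"

definition ess_inf_on :: "(real ^ 'n::finite) set \<Rightarrow> (real ^ 'n \<Rightarrow> ennreal) \<Rightarrow> ennreal" where
  "ess_inf_on R g = Sup {t. AE x in lebesgue. x \<in> R \<longrightarrow> t \<le> g x}"

text \<open>The constant of \<open>A\<^sub>r\<close> relative to the rectangles of the splitting \<open>S\<close>, for \<open>1 \<le> r < \<infinity>\<close>.\<close>

definition A_const :: "'n::finite set \<Rightarrow> real \<Rightarrow> (real ^ 'n \<Rightarrow> real) \<Rightarrow> ennreal" where
  "A_const S r w =
    (if r = 1 then
       Inf {c. \<forall>R\<in>rectangles S.
                 emean R (\<lambda>x. ennreal (w x)) \<le> c * ess_inf_on R (\<lambda>x. ennreal (w x))}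
     else
       (SUP R\<in>rectangles S.
          emean R (\<lambda>x. ennreal (w x)) *
          epowr (emean R (\<lambda>x. epowr (ennreal (w x)) (- 1 / (r - 1)))) (r - 1)))"

definition A_class :: "'n::finite set \<Rightarrow> real \<Rightarrow> (real ^ 'n \<Rightarrow> real) set" where
  "A_class S r = {w. weight w \<and> A_const S r w < \<infinity>}"

definition wnorm ::
    "(real ^ 'n::finite) set \<Rightarrow> (real ^ 'n \<Rightarrow> real) \<Rightarrow> real \<Rightarrow>
     (real ^ 'n \<Rightarrow> 'b::real_normed_vector) \<Rightarrow> ennreal" where
  "wnorm R w r g =
    epowr ((\<integral>\<^sup>+x\<in>R. ennreal (norm (g x) powr r * w x) \<partial>lebesgue) /
           (\<integral>\<^sup>+x\<in>R. ennreal (w x) \<partial>lebesgue)) (1 / r)"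

text \<open>
  The gradient in the variables with index in \<open>S\<close>, as a vector of \<^typ>\<open>real ^ 'n\<close> that vanishes
  outside \<open>S\<close>. Where a partial derivative does not exist, \<^const>\<open>deriv\<close> is an arbitrary
  number; for a Lipschitz \<open>f\<close> this happens only on a null set.
\<close>

definition partial_grad ::
    "'n::finite set \<Rightarrow> (real ^ 'n \<Rightarrow> real) \<Rightarrow> real ^ 'n \<Rightarrow> real ^ 'n" where
  "partial_grad S f x = (\<chi> i. if i \<in> S then deriv (\<lambda>t. f (x + t *\<^sub>R axis i 1)) 0 else 0)"

end

theory Submission
  imports Defs
begin

text \<open>
  Only the dyadic subrectangles of \<open>R\<close> are needed, so this is a one-parameter argument.
  Testing the \<open>A\<^sub>q\<close> condition on two-valued functions bounds from below the ratios
  \<open>\<omega>\<^sub>k\<close> of the weights of a dyadic rectangle of generation \<open>k\<close> and of \<open>R\<close>. With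
  \<open>K\<close> the \<open>A\<^sub>q\<close> constant and \<open>m = n (q + ln K)\<close>, so that \<open>1/p - 1/p\<^sup>* = 1/m\<close>, this
  gives \<open>2\<^sup>-\<^sup>k \<le> exp (1/n) \<omega>\<^sub>k\<^sup>1\<^sup>/\<^sup>m 2\<^sup>-\<^sup>k\<^sup>\<theta>\<close> with \<open>\<theta> = ln K / (q + ln K)\<close>: the weight behaves like
  a measure of dimension \<open>m\<close> with constants that do not depend on \<open>K\<close>. Telescoping the averages
  of \<open>f\<close> over the dyadic rectangles shrinking to a point and using the Poincare inequality and the
  \<open>A\<^sub>p\<close> condition on each of them yields a weak type inequality by a stopping time argument, and
  truncation turns it into the strong one.

  As \<open>K \<rightarrow> 1\<close> the gain \<open>\<theta>\<close> is lost. For \<open>q > 1\<close> it is recovered from an improved lower bound for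
  \<open>\<omega>\<^sub>k\<close>; for \<open>q = 1 < n/p\<close> Hedberg's argument applies; for \<open>q = 1 > n/p\<close> the existence of
  \<open>p\<^sup>*\<close> keeps \<open>K\<close> away from 1.
\<close>

section \<open>Lipschitz functions of one real variable\<close>

text \<open>The obstacle is uniformity in \<open>K\<close>. A lower bound for the weight that is
  compounded from one generation to the next would cost a power of \<open>K\<close> growing with the
  generation. Comparing each small rectangle directly with \<open>R\<close> costs a single factor
  \<open>K\<close>, and its power 1/m is \<open>exp (ln K / m)\<close>, at most
  \<open>exp (1 / n)\<close>. The logarithm in the definition of the target exponent is there for
  exactly this.

  The two weight conditions have separate roles. A_q measures how fast the weight can decay and
  fixes the exponent; A_p only turns unweighted averages of the gradient into weighted ones, so its
  constant appears to the power 1/p and no higher.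

  The pair q = 1, p = n is excluded because there the target exponent tends to infinity as
  \<open>K\<close> tends to 1, and the limit would be an embedding of W^{1,n} into the bounded
  functions, which fails for n at least 2.

  Truncation replaces interpolation because the weak estimate, holding for all Lipschitz functions,
  improves itself at one and the same pair of exponents.\<close>

lemma lipschitz_strict_mono_homeo:
  fixes g \<phi> :: "real \<Rightarrow> real"
  assumes g: "L-lipschitz_on UNIV g"
    and \<phi>_def: "\<phi> = (\<lambda>x. g x + (L + 1) * x)"
  shows "\<And>x y. x \<le> y \<Longrightarrow> y - x \<le> \<phi> y - \<phi> x" "(2 * L + 1)-lipschitz_on UNIV \<phi>" "bij \<phi>"
proof -
  have L: "L \<ge> 0" by (rule lipschitz_on_nonneg[OF g])
  have d: "\<bar>g x - g y\<bar> \<le> L * \<bar>x - y\<bar>" for x y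
    using lipschitz_onD[OF g, of x y] by (simp add: dist_real_def)
  show mono: "y - x \<le> \<phi> y - \<phi> x" if "x \<le> y" for x y
    using d[of y x] that unfolding \<phi>_def by (simp add: algebra_simps)
  show lip: "(2 * L + 1)-lipschitz_on UNIV \<phi>"
  proof (rule lipschitz_onI)
    fix x y
    have "\<phi> x - \<phi> y = (g x - g y) + (L+1) * (x - y)" unfolding \<phi>_def by (simp add: algebra_simps)
    then have "\<bar>\<phi> x - \<phi> y\<bar> \<le> \<bar>g x - g y\<bar> + \<bar>(L+1) * (x - y)\<bar>" by linarith
    also have "\<bar>(L+1) * (x - y)\<bar> = (L+1) * \<bar>x-y\<bar>" using L by (simp add: abs_mult)
    finally show "dist (\<phi> x) (\<phi> y) \<le> (2 * L + 1) * dist x y"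
      using d[of x y] by (simp add: dist_real_def algebra_simps)
  qed (use L in auto)
  have cont: "continuous_on S \<phi>" for S
    using lipschitz_on_continuous_on[OF lip] continuous_on_subset[OF _ subset_UNIV] by blast
  have inj: "inj \<phi>"
  proof (rule injI)
    fix x y assume "\<phi> x = \<phi> y"
    then show "x = y" using mono[of x y] mono[of y x] by linarith
  qed
  have "\<exists>x. \<phi> x = y" for y
  proof -
    \<comment> \<open>The slope of \<open>\<phi>\<close> is at least 1, so moving from 0 by the
      distance between \<open>y\<close> and \<open>\<phi> 0\<close> reaches the value
      \<open>y\<close> or passes it.\<close>
    define A where "A = \<bar>y - \<phi> 0\<bar>"
    have "\<phi> (-A) \<le> y" using mono[of "-A" 0] unfolding A_def by linarith
    moreover have "y \<le> \<phi> A" using mono[of 0 A] unfolding A_def by linarith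
    moreover have "-A \<le> A" by (simp add: A_def)
    ultimately obtain x where "\<phi> x = y"
      using IVT'[OF _ _ _ cont] by blast
    then show ?thesis by blast
  qed
  then have "surj \<phi>" unfolding surj_def by metis
  then show "bij \<phi>" using inj by (simp add: bij_def)
qed

text \<open>Adding a multiple of the identity makes \<open>g\<close> an increasing homeomorphism; since Lipschitz
  images of null sets are null, its Stieltjes measure has a density.\<close>

lemma lipschitz_indefinite_integral:
  fixes g :: "real \<Rightarrow> real"
  assumes g: "L-lipschitz_on UNIV g"
  obtains h :: "real \<Rightarrow> real" where "h \<in> borel_measurable borel"
    "\<And>a b. a \<le> b \<Longrightarrow> (h has_integral (g b - g a)) {a..b}"
    "\<And>a b. set_integrable lborel {a..b} h"
    "\<And>a b. a \<le> b \<Longrightarrow> (LINT x:{a..b}|lborel. h x) = g b - g a"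
proof -
  define \<phi> where "\<phi> = (\<lambda>x. g x + (L + 1) * x)"
  note H = lipschitz_strict_mono_homeo[OF g \<phi>_def]
  have sm: "\<phi> x \<le> \<phi> y \<longleftrightarrow> x \<le> y" for x y
    using H(1)[of x y] H(1)[of y x] by (cases "x \<le> y") auto
  define \<psi> where "\<psi> = inv \<phi>"
  have pp: "\<phi> (\<psi> y) = y" "\<psi> (\<phi> x) = x" for x y
    using H(3) unfolding \<psi>_def by (auto simp: bij_def surj_f_inv_f)
  have mono: "mono \<psi>"
    by (rule monoI) (metis sm pp(1))
  have [measurable]: "\<psi> \<in> borel_measurable borel"
    by (rule borel_measurable_mono[OF mono])
  \<comment> \<open>Transporting Lebesgue measure by the inverse gives every Borel set the measure
    of its image under \<open>\<phi>\<close>, in particular \<open>{a..b}\<close> the increment of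
    \<open>\<phi>\<close>. This is the Stieltjes measure, obtained without an extension
    theorem.\<close>
  define M where "M = distr lborel borel \<psi>"
  have setsM: "sets M = sets lborel" by (simp add: M_def)
  have vim: "\<psi> -` A = \<phi> ` A" for A :: "real set" using pp by (auto simp: image_iff) metis
  have emM: "emeasure M A = emeasure lborel (\<phi> ` A)" if "A \<in> sets borel" for A :: "real set"
    using that unfolding M_def by (subst emeasure_distr) (auto simp: vim)
  have ac: "absolutely_continuous lborel M"
    unfolding absolutely_continuous_def
  proof
    fix A :: "real set" assume A: "A \<in> null_sets lborel"
    then have Ab: "A \<in> sets borel" by auto
    have "negligible A" using A by (metis null_sets_completionI negligible_iff_null_sets)
    then have "negligible (\<phi> ` A)"
    proof (rule negligible_locally_Lipschitz_image[rotated])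
      show "\<exists>T B. open T \<and> x \<in> T \<and> (\<forall>y\<in>A \<inter> T. norm (\<phi> y - \<phi> x) \<le> B * norm (y - x))" for x
        using lipschitz_onD[OF H(2)] by (intro exI[of _ UNIV] exI[of _ "2*L+1"]) (auto simp: dist_norm)
    qed auto
    then have "\<phi> ` A \<in> null_sets lebesgue" by (simp add: negligible_iff_null_sets)
    moreover have "\<phi> ` A \<in> sets borel"
      using measurable_sets[of \<psi> borel borel A] Ab vim[of A] by auto
    ultimately have "emeasure lborel (\<phi> ` A) = 0" by (simp add: null_sets_def)
    then show "A \<in> null_sets M" using emM[OF Ab] Ab by (auto simp: null_sets_def setsM)
  qed
  obtain h0 where h0[measurable]: "h0 \<in> borel_measurable lborel" and dens: "density lborel h0 = M"
    using sigma_finite_measure.Radon_Nikodym[OF lborel.sigma_finite_measure_axioms ac setsM] by auto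
  have Iab: "emeasure M {a..b} = ennreal (\<phi> b - \<phi> a)" if "a \<le> b" for a b
  proof -
    have "\<phi> ` {a..b} = {\<phi> a..\<phi> b}"
    proof -
      have "a \<le> \<psi> y \<longleftrightarrow> \<phi> a \<le> y" "\<psi> y \<le> b \<longleftrightarrow> y \<le> \<phi> b" for y
        using sm[of a "\<psi> y"] sm[of "\<psi> y" b] pp(1)[of y] by auto
      then have "\<psi> -` {a..b} = {\<phi> a..\<phi> b}" by auto
      then show ?thesis using vim by metis
    qed
    then show ?thesis using emM[of "{a..b}"] sm[of a b] that by simp
  qed
  have nnI: "(\<integral>\<^sup>+x\<in>{a..b}. h0 x \<partial>lborel) = ennreal (\<phi> b - \<phi> a)" if "a \<le> b" for a b
    using emeasure_density[of h0 lborel "{a..b}"] Iab[OF that] dens by (auto)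
  have fin: "AE x in lborel. h0 x \<noteq> \<infinity>"
  proof -
    have "AE x in lborel. h0 x * indicator {-real n..real n} x \<noteq> \<infinity>" for n
      by (rule nn_integral_noteq_infinite) (use nnI[of "-real n" "real n"] in auto)
    then have "AE x in lborel. \<forall>n. h0 x * indicator {-real n..real n} x \<noteq> \<infinity>"
      by (simp add: AE_all_countable)
    then show ?thesis
    proof eventually_elim
      case (elim x)
      obtain n where "\<bar>x\<bar> \<le> real n" using real_arch_simple by blast
      then have "x \<in> {-real n..real n}" by auto
      with elim[rule_format, of n] show ?case by simp
    qed
  qed
  define k where "k = (\<lambda>x. enn2real (h0 x))"
  have k[measurable]: "k \<in> borel_measurable borel" unfolding k_def by measurable
  have nnk: "(\<integral>\<^sup>+x\<in>{a..b}. ennreal (k x) \<partial>lborel) = ennreal (\<phi> b - \<phi> a)" if "a \<le> b" for a b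
    unfolding nnI[OF that, symmetric]
    by (rule nn_integral_cong_AE) (use fin in \<open>auto simp: k_def less_top\<close>)
  have hb: "has_bochner_integral lborel (\<lambda>x. indicator {a..b} x *\<^sub>R k x) (\<phi> b - \<phi> a)" if "a \<le> b" for a b
  proof (rule has_bochner_integral_nn_integral)
    show "(\<integral>\<^sup>+x. ennreal (indicator {a..b} x *\<^sub>R k x) \<partial>lborel) = ennreal (\<phi> b - \<phi> a)"
      unfolding nnk[OF that, symmetric] by (intro nn_integral_cong) (auto split: split_indicator)
  qed (use sm that in \<open>auto simp: k_def\<close>)
  have ki: "set_integrable lborel {a..b} k" for a b
    using hb[of a b] unfolding set_integrable_def has_bochner_integral_iff by (cases "a \<le> b") auto
  have kI: "(LINT x:{a..b}|lborel. k x) = \<phi> b - \<phi> a" if "a \<le> b" for a b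
    using hb[OF that] unfolding set_lebesgue_integral_def has_bochner_integral_iff by auto
  define h where "h = (\<lambda>x. k x - (L + 1))"
  have hi: "set_integrable lborel {a..b} h" for a b
    unfolding h_def by (intro set_integral_diff ki borel_integrable_atLeastAtMost') simp
  have hI: "(LINT x:{a..b}|lborel. h x) = g b - g a" if "a \<le> b" for a b
  proof -
    have c: "set_integrable lborel {a..b} (\<lambda>x. L + 1)"
      by (rule borel_integrable_atLeastAtMost') simp
    have "(LINT x:{a..b}|lborel. h x) = (\<phi> b - \<phi> a) - (LINT x:{a..b}|lborel. L + 1)"
      unfolding h_def kI[OF that, symmetric] by (intro set_integral_diff ki c)
    also have "(LINT x:{a..b}|lborel. L + 1) = (L+1) * (b - a)"
      using that by (simp add: set_lebesgue_integral_def)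
    finally show ?thesis by (simp add: \<phi>_def algebra_simps)
  qed
  show ?thesis
  proof
    show "h \<in> borel_measurable borel" unfolding h_def by measurable
    show "(h has_integral (g b - g a)) {a..b}" if "a \<le> b" for a b
      using set_borel_integral_eq_integral[OF hi[of a b]] hI[OF that] by (simp add: has_integral_integral)
  qed (use hi hI in auto)
qed

text \<open>The differentiation theorem invoked here concerns averages over
  \<open>[x, x + t]\<close> with \<open>t > 0\<close>, hence only right derivatives. The left ones
  come from the same theorem for the reflected function \<open>h (- x)\<close>, so the exceptional
  set is the union of a null set and the reflection of another.\<close>

lemma lipschitz_AE_deriv:
  fixes g :: "real \<Rightarrow> real"
  assumes g: "L-lipschitz_on UNIV g"
  obtains h where "AE x in lborel. (g has_field_derivative h x) (at x)"
    "h \<in> borel_measurable borel"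
    "\<And>a b. set_integrable lborel {a..b} h"
    "\<And>a b. a \<le> b \<Longrightarrow> (LINT x:{a..b}|lborel. h x) = g b - g a"
proof -
  obtain h where h: "h \<in> borel_measurable borel"
    "\<And>a b. a \<le> b \<Longrightarrow> (h has_integral (g b - g a)) {a..b}"
    "\<And>a b. set_integrable lborel {a..b} h"
    "\<And>a b. a \<le> b \<Longrightarrow> (LINT x:{a..b}|lborel. h x) = g b - g a"
    by (rule lipschitz_indefinite_integral[OF g]) (rule that)
  have i1: "h integrable_on cbox a b" for a b
    using h(2)[of a b] by (cases "a \<le> b") (auto simp: has_integral_integrable)
  have r: "((\<lambda>x. h (- x)) has_integral (g (-a) - g (-b))) {a..b}" if "a \<le> b" for a b
    using has_integral_reflect_lemma_real[OF h(2)[of "-b" "-a"]] that by simp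
  have i2: "(\<lambda>x. h (- x)) integrable_on cbox a b" for a b
    using r[of a b] by (cases "a \<le> b") (auto simp: has_integral_integrable)
  obtain N1 where N1: "negligible N1" "\<And>x e. \<lbrakk>x \<notin> N1; 0 < e\<rbrakk> \<Longrightarrow>
     \<exists>d>0. \<forall>t. 0 < t \<and> t < d \<longrightarrow> norm (integral (cbox x (x + t *\<^sub>R One)) h /\<^sub>R t ^ DIM(real) - h x) < e"
    using integrable_ccontinuous_explicit[OF i1] by blast
  obtain N2 where N2: "negligible N2" "\<And>x e. \<lbrakk>x \<notin> N2; 0 < e\<rbrakk> \<Longrightarrow>
     \<exists>d>0. \<forall>t. 0 < t \<and> t < d \<longrightarrow> norm (integral (cbox x (x + t *\<^sub>R One)) (\<lambda>x. h (-x)) /\<^sub>R t ^ DIM(real) - h (-x)) < e"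
    using integrable_ccontinuous_explicit[OF i2] by blast
  have "negligible (uminus ` N2)"
    by (rule negligible_locally_Lipschitz_image[OF _ N2(1)])
      (auto intro!: exI[of _ "UNIV::real set"] exI[of _ "1::real"] simp: abs_minus_commute)
  then have "negligible (N1 \<union> uminus ` N2)" using N1 by (simp add: negligible_Un)
  then have N: "AE x in lborel. x \<notin> N1 \<union> uminus ` N2"
    by (metis AE_completion_iff AE_not_in negligible_iff_null_sets)
  have "(g has_field_derivative h x) (at x)" if x: "x \<notin> N1 \<union> uminus ` N2" for x
    unfolding DERIV_def LIM_eq
  proof (intro allI impI)
    fix e :: real assume e: "e > 0"
    have x1: "x \<notin> N1" and x2: "-x \<notin> N2" using x by (auto, metis add.inverse_inverse imageI)
    obtain d1 where d1: "d1 > 0" "\<And>t::real. 0 < t \<Longrightarrow> t < d1 \<Longrightarrow> \<bar>(g (x+t) - g x) / t - h x\<bar> < e"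
    proof -
      obtain d where "d > 0" "\<forall>t. 0 < t \<and> t < d \<longrightarrow> norm (integral (cbox x (x + t *\<^sub>R One)) h /\<^sub>R t ^ DIM(real) - h x) < e"
        using N1(2)[OF x1 e] by blast
      moreover have "integral (cbox x (x + t *\<^sub>R One)) h = g (x+t) - g x" if "t > 0" for t :: real
        using h(2)[of x "x+t"] that by (auto intro: integral_unique)
      ultimately show ?thesis by (intro that[of d]) (auto simp: divide_inverse mult.commute)
    qed
    obtain d2 where d2: "d2 > 0" "\<And>t::real. 0 < t \<Longrightarrow> t < d2 \<Longrightarrow> \<bar>(g x - g (x-t)) / t - h x\<bar> < e"
    proof -
      obtain d where "d > 0" "\<forall>t. 0 < t \<and> t < d \<longrightarrow> norm (integral (cbox (-x) (-x + t *\<^sub>R One)) (\<lambda>x. h (-x)) /\<^sub>R t ^ DIM(real) - h (-(-x))) < e"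
        using N2(2)[OF x2 e] by blast
      moreover have "integral (cbox (-x) (-x + t *\<^sub>R One)) (\<lambda>x. h (-x)) = g x - g (x-t)" if "t > 0" for t :: real
        using r[of "-x" "-x+t"] that by (auto intro: integral_unique)
      ultimately show ?thesis by (intro that[of d]) (auto simp: divide_inverse mult.commute)
    qed
    show "\<exists>s>0. \<forall>t. t \<noteq> 0 \<and> norm (t - 0) < s \<longrightarrow> norm ((g (x + t) - g x) / t - h x) < e"
    proof (intro exI[of _ "min d1 d2"] conjI allI impI)
      fix t :: real assume t: "t \<noteq> 0 \<and> norm (t - 0) < min d1 d2"
      show "norm ((g (x + t) - g x) / t - h x) < e"
      proof (cases "t > 0")
        case True then show ?thesis using d1(2)[of t] t by auto
      next
        case False
        then have "(g (x + t) - g x) / t = (g x - g (x - (-t))) / (-t)" using t by (auto simp: field_simps)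
        then show ?thesis using d2(2)[of "-t"] t False by auto
      qed
    qed (use d1 d2 in auto)
  qed
  then have "AE x in lborel. (g has_field_derivative h x) (at x)"
    using N by (auto elim: eventually_mono)
  then show ?thesis using that h by blast
qed

lemma lipschitz_diff_le_nn_integral_deriv:
  fixes g :: "real \<Rightarrow> real"
  assumes g: "L-lipschitz_on UNIV g" and ab: "a \<le> b"
  shows "ennreal \<bar>g b - g a\<bar> \<le> (\<integral>\<^sup>+x\<in>{a..b}. ennreal \<bar>deriv g x\<bar> \<partial>lborel)"
proof -
  obtain h where h: "AE x in lborel. (g has_field_derivative h x) (at x)"
    "h \<in> borel_measurable borel"
    "\<And>a b. set_integrable lborel {a..b} h"
    "\<And>a b. a \<le> b \<Longrightarrow> (LINT x:{a..b}|lborel. h x) = g b - g a"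
    by (rule lipschitz_AE_deriv[OF g]) (rule that)
  have "ennreal \<bar>g b - g a\<bar> = ennreal (norm (LINT x:{a..b}|lborel. h x))" using h(4)[OF ab] by simp
  also have "\<dots> \<le> (\<integral>\<^sup>+x. norm (indicator {a..b} x *\<^sub>R h x) \<partial>lborel)"
    unfolding set_lebesgue_integral_def
    by (rule integral_norm_bound_ennreal) (use h(3) in \<open>simp add: set_integrable_def\<close>)
  also have "\<dots> = (\<integral>\<^sup>+x\<in>{a..b}. ennreal \<bar>deriv g x\<bar> \<partial>lborel)"
  proof (rule nn_integral_cong_AE)
    show "AE x in lborel. ennreal (norm (indicator {a..b} x *\<^sub>R h x)) =
      ennreal \<bar>deriv g x\<bar> * indicator {a..b} x"
      using h(1) by eventually_elim (auto simp: DERIV_imp_deriv split: split_indicator)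
  qed
  finally show ?thesis .
qed

section \<open>Directional derivatives and the Poincare inequality\<close>

text \<open>The same expression as in a component of \<open>partial_grad\<close>, so the two agree
  at every point, also where the derivative does not exist.\<close>

definition ddir :: "('a::euclidean_space \<Rightarrow> real) \<Rightarrow> 'a \<Rightarrow> 'a \<Rightarrow> real" where
  "ddir f e x = deriv (\<lambda>t. f (x + t *\<^sub>R e)) 0"

text \<open>The Cauchy criterion eliminates the unknown derivative and quantifies over
  \<open>n\<close> and \<open>m\<close> in a countable way. The last inequality is not strict so
  that, when \<open>g\<close> depends continuously on a parameter, the condition for fixed
  \<open>s\<close> and \<open>t\<close> defines a closed set of parameters.\<close>

lemma has_real_derivative_at_0_iff_Cauchy:
  fixes g :: "real \<Rightarrow> real"
  defines "q \<equiv> \<lambda>s. (g s - g 0) / s"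
  shows "(\<exists>D. (g has_real_derivative D) (at 0)) \<longleftrightarrow>
    (\<forall>n. \<exists>m. \<forall>s t. s \<noteq> 0 \<and> \<bar>s\<bar> < 1 / real (Suc m) \<and> t \<noteq> 0 \<and> \<bar>t\<bar> < 1 / real (Suc m) \<longrightarrow>
      \<bar>q s - q t\<bar> \<le> 1 / real (Suc n))" (is "_ \<longleftrightarrow> ?R")
proof
  assume "\<exists>D. (g has_real_derivative D) (at 0)"
  then obtain D where "(g has_real_derivative D) (at 0)" by blast
  then have lim: "(q \<longlongrightarrow> D) (at 0)" by (simp add: DERIV_def q_def)
  show ?R
  proof
    fix n
    define \<epsilon> where "\<epsilon> = 1 / real (Suc n)"
    have "0 < \<epsilon> / 2" by (simp add: \<epsilon>_def)
    from LIM_D[OF lim this] obtain d where d: "d > 0"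
      "\<And>s. s \<noteq> 0 \<Longrightarrow> \<bar>s\<bar> < d \<Longrightarrow> \<bar>q s - D\<bar> < \<epsilon> / 2" by auto
    obtain m where m: "1 / real (Suc m) < d" using nat_approx_posE[OF d(1)] by blast
    show "\<exists>m. \<forall>s t. s \<noteq> 0 \<and> \<bar>s\<bar> < 1 / real (Suc m) \<and> t \<noteq> 0 \<and> \<bar>t\<bar> < 1 / real (Suc m) \<longrightarrow>
      \<bar>q s - q t\<bar> \<le> 1 / real (Suc n)"
    proof (intro exI[of _ m] allI impI)
      fix s t assume st: "s \<noteq> 0 \<and> \<bar>s\<bar> < 1 / real (Suc m) \<and> t \<noteq> 0 \<and> \<bar>t\<bar> < 1 / real (Suc m)"
      have "\<bar>q s - D\<bar> < \<epsilon> / 2" "\<bar>q t - D\<bar> < \<epsilon> / 2"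
        using d(2)[of s] d(2)[of t] st m by linarith+
      then have "\<bar>q s - q t\<bar> \<le> \<epsilon>" by linarith
      then show "\<bar>q s - q t\<bar> \<le> 1 / real (Suc n)" by (simp add: \<epsilon>_def)
    qed
  qed
next
  assume R: ?R
  have ev: "\<exists>m. \<forall>s t. s \<noteq> 0 \<and> \<bar>s\<bar> < 1 / real (Suc m) \<and> t \<noteq> 0 \<and> \<bar>t\<bar> < 1 / real (Suc m) \<longrightarrow>
      \<bar>q s - q t\<bar> < e" if "e > 0" for e
  proof -
    obtain n where n: "1 / real (Suc n) < e" using nat_approx_posE[OF \<open>e > 0\<close>] by blast
    with R[rule_format, of n] show ?thesis by (meson le_less_trans)
  qed
  have less: "1 / real (Suc k) < 1 / real (Suc m)" if "k > m" for k m
    using that by (simp add: field_simps)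
  have "Cauchy (\<lambda>k. q (1 / real (Suc k)))"
  proof (rule metric_CauchyI)
    fix e :: real assume "e > 0"
    from ev[OF this] obtain m where m: "\<And>s t. s \<noteq> 0 \<and> \<bar>s\<bar> < 1 / real (Suc m) \<and> t \<noteq> 0 \<and> \<bar>t\<bar> < 1 / real (Suc m) \<Longrightarrow>
      \<bar>q s - q t\<bar> < e" by blast
    show "\<exists>M. \<forall>j\<ge>M. \<forall>k\<ge>M. dist (q (1 / real (Suc j))) (q (1 / real (Suc k))) < e"
    proof (intro exI[of _ "Suc m"] allI impI)
      fix j k assume "j \<ge> Suc m" "k \<ge> Suc m"
      then show "dist (q (1 / real (Suc j))) (q (1 / real (Suc k))) < e"
        unfolding dist_real_def by (intro m) (use less[of m j] less[of m k] in auto)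
    qed
  qed
  then obtain D where D: "(\<lambda>k. q (1 / real (Suc k))) \<longlonglongrightarrow> D"
    using Cauchy_convergent convergent_def by blast
  have "(q \<longlongrightarrow> D) (at 0)"
  proof (rule LIM_I)
    fix e :: real assume e: "e > 0"
    then have "e / 2 > 0" by simp
    from ev[OF this] obtain m where m: "\<And>s t. s \<noteq> 0 \<and> \<bar>s\<bar> < 1 / real (Suc m) \<and> t \<noteq> 0 \<and> \<bar>t\<bar> < 1 / real (Suc m) \<Longrightarrow>
      \<bar>q s - q t\<bar> < e / 2" by blast
    show "\<exists>s>0. \<forall>x. x \<noteq> 0 \<and> norm (x - 0) < s \<longrightarrow> norm (q x - D) < e"
    proof (intro exI[of _ "1 / real (Suc m)"] conjI allI impI)
      fix x :: real assume x: "x \<noteq> 0 \<and> norm (x - 0) < 1 / real (Suc m)"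
      have "\<forall>\<^sub>F k in sequentially. \<bar>q x - q (1 / real (Suc k))\<bar> \<le> e / 2"
        using eventually_gt_at_top[of m]
      proof eventually_elim
        case (elim k)
        then show ?case using m[of x "1 / real (Suc k)"] x less[of m k] by auto
      qed
      moreover have "(\<lambda>k. \<bar>q x - q (1 / real (Suc k))\<bar>) \<longlonglongrightarrow> \<bar>q x - D\<bar>"
        by (intro tendsto_intros D)
      ultimately have "\<bar>q x - D\<bar> \<le> e / 2"
        by (intro tendsto_upperbound[of _ _ sequentially]) auto
      then show "norm (q x - D) < e" using e by simp
    qed simp
  qed
  then show "\<exists>D. (g has_real_derivative D) (at 0)" by (auto simp: DERIV_def q_def)
qed

text \<open>The intersection over uncountably many pairs \<open>s\<close>, \<open>t\<close> is
  harmless because it is one of closed sets; outside it only countable operations remain. On the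
  resulting set the derivative is a limit of continuous difference quotients.\<close>

lemma
  fixes f :: "'a::euclidean_space \<Rightarrow> real"
  assumes f: "continuous_on UNIV f"
  shows sets_ddir_exists: "{x. \<exists>D. ((\<lambda>t. f (x + t *\<^sub>R e)) has_real_derivative D) (at 0)} \<in> sets borel" (is "?D \<in> _")
    and borel_measurable_ddir: "ddir f e \<in> borel_measurable borel"
proof -
  define q where "q = (\<lambda>s x. (f (x + s *\<^sub>R e) - f x) / s)"
  define C where "C = (\<lambda>m n. \<Inter>p\<in>{p. fst p \<noteq> 0 \<and> \<bar>fst p\<bar> < 1 / real (Suc m) \<and> snd p \<noteq> 0 \<and> \<bar>snd p\<bar> < 1 / real (Suc m)}.
    {x. \<bar>q (fst p) x - q (snd p) x\<bar> \<le> 1 / real (Suc n)})"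
  have cf: "continuous_on S (\<lambda>x. f (x + s *\<^sub>R e))" for s S
    by (rule continuous_on_compose2[OF f]) (auto intro!: continuous_intros)
  have cf0: "continuous_on S f" for S using f continuous_on_subset by blast
  have cq: "continuous_on S (q s)" if "s \<noteq> 0" for s S
    unfolding q_def using that by (intro continuous_intros cf cf0) auto
  have cl: "closed (C m n)" for m n
    unfolding C_def by (intro closed_INT ballI closed_Collect_le continuous_intros cq) auto
  have "?D = (\<Inter>n. \<Union>m. C m n)"
    by (subst has_real_derivative_at_0_iff_Cauchy) (auto simp: C_def q_def)
  then show 1: "?D \<in> sets borel" using cl by (auto intro!: sets.countable_INT'' borel_closed)
  \<comment> \<open>\<open>deriv\<close> chooses a number with the derivative property. Where there
    is none the property is identically false, so the chosen number is the same at all such points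
    and measurability survives.\<close>
  have "ddir f e = (\<lambda>x. if x \<in> ?D then lim (\<lambda>k. q (1 / real (Suc k)) x) else (SOME D. False))"
  proof
    fix x
    show "ddir f e x = (if x \<in> ?D then lim (\<lambda>k. q (1 / real (Suc k)) x) else (SOME D. False))"
    proof (cases "x \<in> ?D")
      case True
      then obtain D where D: "((\<lambda>t. f (x + t *\<^sub>R e)) has_real_derivative D) (at 0)" by blast
      then have "((\<lambda>s. q s x) \<longlongrightarrow> D) (at 0)" by (simp add: DERIV_def q_def)
      moreover have "filterlim (\<lambda>k. 1 / real (Suc k)) (at 0) sequentially"
        using LIMSEQ_Suc[OF lim_1_over_n] by (auto simp: filterlim_at)
      ultimately have "(\<lambda>k. q (1 / real (Suc k)) x) \<longlonglongrightarrow> D"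
        by (rule filterlim_compose)
      then show ?thesis using True D by (auto simp: ddir_def limI DERIV_imp_deriv)
    next
      case False
      then have "(\<lambda>D. ((\<lambda>t. f (x + t *\<^sub>R e)) has_real_derivative D) (at 0)) = (\<lambda>D. False)" by auto
      then show ?thesis using False by (simp add: ddir_def deriv_def)
    qed
  qed
  moreover have "(\<lambda>x. if x \<in> ?D then lim (\<lambda>k. q (1 / real (Suc k)) x) else (SOME D. False)) \<in> borel_measurable borel"
  proof (rule measurable_If_set)
    show "(\<lambda>x. lim (\<lambda>k. q (1 / real (Suc k)) x)) \<in> borel_measurable borel"
      by (intro borel_measurable_lim_metric borel_measurable_continuous_onI cq) simp
  qed (use 1 in auto)
  ultimately show "ddir f e \<in> borel_measurable borel" by simp
qed

lemma lipschitz_on_line: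
  fixes f :: "'a::euclidean_space \<Rightarrow> real"
  assumes "L-lipschitz_on UNIV f"
  shows "(L * norm e)-lipschitz_on UNIV (\<lambda>t. f (x + t *\<^sub>R e))"
proof (rule lipschitz_onI)
  fix s t :: real
  have "dist (f (x + s *\<^sub>R e)) (f (x + t *\<^sub>R e)) \<le> L * dist (x + s *\<^sub>R e) (x + t *\<^sub>R e)"
    by (rule lipschitz_onD[OF assms]) auto
  also have "dist (x + s *\<^sub>R e) (x + t *\<^sub>R e) = norm e * dist s t"
    by (simp add: dist_norm flip: scaleR_diff_left)
  finally show "dist (f (x + s *\<^sub>R e)) (f (x + t *\<^sub>R e)) \<le> L * norm e * dist s t" by (simp add: mult_ac)
qed (use lipschitz_on_nonneg[OF assms] in auto)

text \<open>The bound holds at every point and not merely almost everywhere, since the arbitrary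
  value of \<open>deriv\<close> is one fixed number. Integrals over compact sets are then finite by
  comparison.\<close>

lemma bounded_ddir:
  fixes f :: "'a::euclidean_space \<Rightarrow> real"
  assumes f: "L-lipschitz_on UNIV f"
  shows "\<exists>B. \<forall>x. \<bar>ddir f e x\<bar> \<le> B"
proof (intro exI allI)
  fix x
  show "\<bar>ddir f e x\<bar> \<le> max (L * norm e) \<bar>SOME D. False\<bar>"
  proof (cases "\<exists>D. ((\<lambda>t. f (x + t *\<^sub>R e)) has_real_derivative D) (at 0)")
    case True
    then obtain D where D: "((\<lambda>t. f (x + t *\<^sub>R e)) has_real_derivative D) (at 0)" by blast
    have "\<bar>D\<bar> \<le> L * norm e"
    proof (rule tendsto_upperbound)
      show "((\<lambda>t. \<bar>(f (x + t *\<^sub>R e) - f x) / t\<bar>) \<longlongrightarrow> \<bar>D\<bar>) (at 0)"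
        using D by (intro tendsto_intros) (simp add: DERIV_def)
      have "\<bar>(f (x + t *\<^sub>R e) - f x) / t\<bar> \<le> L * norm e" if "t \<noteq> 0" for t
        using lipschitz_onD[OF lipschitz_on_line[OF f, of e x], of t 0] that
        by (simp add: dist_real_def field_simps)
      then show "\<forall>\<^sub>F t in at 0. \<bar>(f (x + t *\<^sub>R e) - f x) / t\<bar> \<le> L * norm e"
        by (auto simp: eventually_at_filter)
    qed simp
    then show ?thesis using D by (simp add: ddir_def DERIV_imp_deriv)
  next
    case False
    then have "(\<lambda>D. ((\<lambda>t. f (x + t *\<^sub>R e)) has_real_derivative D) (at 0)) = (\<lambda>D. False)" by auto
    then show ?thesis by (simp add: ddir_def deriv_def)
  qed
qed

section \<open>Translations, exchange of integrals and differentiability almost everywhere\<close>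

lemma nn_integral_lborel_translation:
  fixes h :: "'a::euclidean_space \<Rightarrow> ennreal"
  assumes [measurable]: "h \<in> borel_measurable borel"
  shows "(\<integral>\<^sup>+x. h (x + c) \<partial>lborel) = (\<integral>\<^sup>+x. h x \<partial>lborel)"
proof -
  have "(\<integral>\<^sup>+x. h x \<partial>lborel) = (\<integral>\<^sup>+x. h x \<partial>distr lborel borel ((+) c))"
    by (simp add: lborel_distr_plus)
  also have "\<dots> = (\<integral>\<^sup>+x. h (c + x) \<partial>lborel)" by (rule nn_integral_distr) auto
  finally show ?thesis by (simp add: add.commute)
qed

lemma nn_integral_lborel_swap:
  fixes F :: "'a::euclidean_space \<Rightarrow> 'b::euclidean_space \<Rightarrow> ennreal"
  assumes "case_prod F \<in> borel_measurable (borel \<Otimes>\<^sub>M borel)"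
  shows "(\<integral>\<^sup>+x. (\<integral>\<^sup>+y. F x y \<partial>lborel) \<partial>lborel) = (\<integral>\<^sup>+y. (\<integral>\<^sup>+x. F x y \<partial>lborel) \<partial>lborel)"
proof -
  have "case_prod F \<in> borel_measurable ((lborel :: 'a measure) \<Otimes>\<^sub>M (lborel :: 'b measure))"
    using assms by (simp add: lborel_prod borel_prod)
  from lborel_pair.Fubini'[OF this] show ?thesis by simp
qed

text \<open>The exceptional set \<open>N\<close> is null along each line of direction
  \<open>e\<close>. Its measure is the average, over \<open>t\<close> in [0,1], of the measures of
  its translates by \<open>- t *\<^sub>R e\<close>; exchanging the integrals produces for each
  \<open>x\<close> the measure of the times at which its line meets \<open>N\<close>. This avoids
  coordinates adapted to \<open>e\<close>.\<close>

lemma AE_ddir_exists: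
  fixes f :: "'a::euclidean_space \<Rightarrow> real"
  assumes f: "L-lipschitz_on UNIV f"
  shows "AE x in lborel. ((\<lambda>t. f (x + t *\<^sub>R e)) has_real_derivative ddir f e x) (at 0)"
proof -
  define N where "N = - {x. \<exists>D. ((\<lambda>t. f (x + t *\<^sub>R e)) has_real_derivative D) (at 0)}"
  have [measurable]: "N \<in> sets borel" unfolding N_def
    using sets_ddir_exists[OF lipschitz_on_continuous_on[OF f], of e] by (intro borel_comp)
  have z: "AE t in lborel. x + t *\<^sub>R e \<notin> N" for x
  proof -
    obtain h where h: "AE t in lborel. ((\<lambda>t. f (x + t *\<^sub>R e)) has_field_derivative h t) (at t)"
      by (rule lipschitz_AE_deriv[OF lipschitz_on_line[OF f, of e x]]) (rule that)
    then show ?thesis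
    proof eventually_elim
      case (elim t)
      then have "((\<lambda>s. f (x + (t + s) *\<^sub>R e)) has_field_derivative h t) (at 0)"
        using DERIV_shift[of "\<lambda>t. f (x + t *\<^sub>R e)" "h t" 0 t] by (simp add: add.commute)
      then show ?case by (auto simp: N_def algebra_simps)
    qed
  qed
  have "emeasure lborel N = (\<integral>\<^sup>+t. indicator {0..1::real} t * emeasure lborel N \<partial>lborel)"
    by (simp add: nn_integral_multc)
  also have "\<dots> = (\<integral>\<^sup>+t. (\<integral>\<^sup>+x. indicator {0..1::real} t * indicator N (x + t *\<^sub>R e) \<partial>lborel) \<partial>lborel)"
    by (intro nn_integral_cong, subst nn_integral_cmult, simp)
       (subst nn_integral_lborel_translation, simp_all)
  also have "\<dots> = (\<integral>\<^sup>+x. (\<integral>\<^sup>+t. indicator {0..1::real} t * indicator N (x + t *\<^sub>R e) \<partial>lborel) \<partial>lborel)"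
    by (rule nn_integral_lborel_swap) measurable
  also have "\<dots> = (\<integral>\<^sup>+x. 0 \<partial>(lborel :: 'a measure))"
  proof (rule nn_integral_cong)
    fix x :: 'a
    have "(\<integral>\<^sup>+t. indicator {0..1::real} t * indicator N (x + t *\<^sub>R e) \<partial>lborel) = (\<integral>\<^sup>+t. 0 \<partial>(lborel::real measure))"
      by (rule nn_integral_cong_AE) (use z[of x] in \<open>auto elim: eventually_mono\<close>)
    then show "(\<integral>\<^sup>+t. indicator {0..1::real} t * indicator N (x + t *\<^sub>R e) \<partial>lborel) = 0" by simp
  qed
  finally have "emeasure lborel N = 0" by simp
  then have "AE x in lborel. x \<notin> N" by (intro AE_not_in) (simp add: null_sets_def)
  then show ?thesis
    by eventually_elim (auto simp: N_def ddir_def DERIV_deriv_iff_real_differentiable real_differentiable_def)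
qed

text \<open>The integral runs over all of \<open>{a..b}\<close> and not only between
  \<open>s\<close> and \<open>t\<close>, so that the bound does not depend on where on the segment
  the two points lie.\<close>

lemma lipschitz_line_le_nn_integral:
  fixes f :: "'a::euclidean_space \<Rightarrow> real"
  assumes f: "L-lipschitz_on UNIV f" and st: "s \<in> {a..b}" "t \<in> {a..b}"
  shows "ennreal \<bar>f (x + t *\<^sub>R e) - f (x + s *\<^sub>R e)\<bar> \<le> (\<integral>\<^sup>+r\<in>{a..b}. ennreal \<bar>ddir f e (x + r *\<^sub>R e)\<bar> \<partial>lborel)"
proof -
  define g where "g = (\<lambda>t. f (x + t *\<^sub>R e))"
  have d: "deriv g r = ddir f e (x + r *\<^sub>R e)" for r
    unfolding ddir_def g_def by (subst deriv_shift_0) (simp add: o_def algebra_simps)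
  have *: "ennreal \<bar>g t - g s\<bar> \<le> (\<integral>\<^sup>+r\<in>{a..b}. ennreal \<bar>deriv g r\<bar> \<partial>lborel)"
    if "s \<le> t" "s \<in> {a..b}" "t \<in> {a..b}" for s t
  proof -
    have "ennreal \<bar>g t - g s\<bar> \<le> (\<integral>\<^sup>+r\<in>{s..t}. ennreal \<bar>deriv g r\<bar> \<partial>lborel)"
      unfolding g_def by (rule lipschitz_diff_le_nn_integral_deriv[OF lipschitz_on_line[OF f] that(1)])
    also have "\<dots> \<le> (\<integral>\<^sup>+r\<in>{a..b}. ennreal \<bar>deriv g r\<bar> \<partial>lborel)"
      using that by (intro nn_integral_mono) (auto split: split_indicator)
    finally show ?thesis .
  qed
  show ?thesis
    using *[of s t] *[of t s] st unfolding d unfolding g_def by (cases "s \<le> t") (auto simp: abs_minus_commute)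
qed


text \<open>For fixed \<open>z\<close> this is a translation in \<open>x\<close>, so the map taking
  \<open>(x, z)\<close> to \<open>(x + P z, z)\<close> preserves measure for any measurable
  \<open>P\<close>. The factor \<open>k\<close> will be an indicator recording which points lie in
  the box.\<close>

lemma nn_integral_shear:
  fixes h :: "'a::euclidean_space \<Rightarrow> ennreal" and P :: "'b::euclidean_space \<Rightarrow> 'a"
  assumes [measurable]: "h \<in> borel_measurable borel" "P \<in> borel_measurable borel"
    "case_prod k \<in> borel_measurable (borel \<Otimes>\<^sub>M borel)"
  shows "(\<integral>\<^sup>+x. (\<integral>\<^sup>+z. k x z * h (x + P z) \<partial>lborel) \<partial>lborel) = (\<integral>\<^sup>+x. (\<integral>\<^sup>+z. k (x - P z) z \<partial>lborel) * h x \<partial>lborel)"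
proof -
  have "(\<integral>\<^sup>+x. (\<integral>\<^sup>+z. k x z * h (x + P z) \<partial>lborel) \<partial>lborel) = (\<integral>\<^sup>+z. (\<integral>\<^sup>+x. k x z * h (x + P z) \<partial>lborel) \<partial>lborel)"
    by (rule nn_integral_lborel_swap) measurable
  also have "\<dots> = (\<integral>\<^sup>+z. (\<integral>\<^sup>+x. k (x - P z) z * h x \<partial>lborel) \<partial>lborel)"
  proof (rule nn_integral_cong)
    fix z
    show "(\<integral>\<^sup>+x. k x z * h (x + P z) \<partial>lborel) = (\<integral>\<^sup>+x. k (x - P z) z * h x \<partial>lborel)"
      using nn_integral_lborel_translation[of "\<lambda>x. k (x - P z) z * h x" "P z"] by simp
  qed
  also have "\<dots> = (\<integral>\<^sup>+x. (\<integral>\<^sup>+z. k (x - P z) z * h x \<partial>lborel) \<partial>lborel)"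
    by (rule nn_integral_lborel_swap) measurable
  finally show ?thesis by (simp add: nn_integral_multc)
qed

text \<open>In probabilistic terms, replacing the coordinate along \<open>i\<close> of a uniform
  point of the box by an independent uniform value gives a uniform point again. Integrals of a
  derivative along segments thereby become integrals over the box.\<close>

lemma cbox_resample_line:
  fixes h :: "'a::euclidean_space \<Rightarrow> ennreal"
  assumes [measurable]: "h \<in> borel_measurable borel" and i: "i \<in> Basis"
    and ab: "\<And>i. i \<in> Basis \<Longrightarrow> a \<bullet> i \<le> b \<bullet> i"
  shows "(\<integral>\<^sup>+x\<in>cbox a b. (\<integral>\<^sup>+t\<in>{a \<bullet> i..b \<bullet> i}. h (x + (t - x \<bullet> i) *\<^sub>R i) \<partial>lborel) \<partial>lborel)
    = ennreal (b \<bullet> i - a \<bullet> i) * (\<integral>\<^sup>+x\<in>cbox a b. h x \<partial>lborel)"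
proof -
  let ?B = "cbox a b"
  have mem: "x + s *\<^sub>R i \<in> ?B \<longleftrightarrow> x \<bullet> i + s \<in> {a \<bullet> i..b \<bullet> i}" if "x \<in> ?B" for x s
  proof -
    have "x + s *\<^sub>R i \<in> ?B \<longleftrightarrow> (\<forall>j\<in>Basis. a \<bullet> j \<le> x \<bullet> j + (if j = i then s else 0) \<and> x \<bullet> j + (if j = i then s else 0) \<le> b \<bullet> j)"
      using i by (auto simp: mem_box inner_add_left inner_Basis split: if_splits)
    also have "\<dots> \<longleftrightarrow> x \<bullet> i + s \<in> {a \<bullet> i..b \<bullet> i}"
      using that i by (auto simp: mem_box)
    finally show ?thesis .
  qed
  have 1: "(\<integral>\<^sup>+t\<in>{a \<bullet> i..b \<bullet> i}. h (x + (t - x \<bullet> i) *\<^sub>R i) \<partial>lborel) * indicator ?B x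
     = (\<integral>\<^sup>+s. indicator ?B x * indicator ?B (x + s *\<^sub>R i) * h (x + s *\<^sub>R i) \<partial>lborel)" for x
  proof -
    have "(\<integral>\<^sup>+t\<in>{a \<bullet> i..b \<bullet> i}. h (x + (t - x \<bullet> i) *\<^sub>R i) \<partial>lborel) = (\<integral>\<^sup>+s. h (x + ((s + x \<bullet> i) - x \<bullet> i) *\<^sub>R i) * indicator {a \<bullet> i..b \<bullet> i} (s + x \<bullet> i) \<partial>lborel)"
      by (rule nn_integral_lborel_translation[symmetric]) measurable
    also have "\<dots> = (\<integral>\<^sup>+s. h (x + s *\<^sub>R i) * indicator {a \<bullet> i..b \<bullet> i} (s + x \<bullet> i) \<partial>lborel)" by simp
    finally have *: "(\<integral>\<^sup>+t\<in>{a \<bullet> i..b \<bullet> i}. h (x + (t - x \<bullet> i) *\<^sub>R i) \<partial>lborel)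
      = (\<integral>\<^sup>+s. h (x + s *\<^sub>R i) * indicator {a \<bullet> i..b \<bullet> i} (s + x \<bullet> i) \<partial>lborel)" .
    show ?thesis
    proof (cases "x \<in> ?B")
      case True
      then show ?thesis unfolding *
        by simp (intro nn_integral_cong, use mem[OF True] in \<open>auto split: split_indicator simp: add.commute\<close>)
    qed simp
  qed
  have "(\<integral>\<^sup>+x\<in>?B. (\<integral>\<^sup>+t\<in>{a \<bullet> i..b \<bullet> i}. h (x + (t - x \<bullet> i) *\<^sub>R i) \<partial>lborel) \<partial>lborel)
     = (\<integral>\<^sup>+x. (\<integral>\<^sup>+s. indicator ?B x * indicator ?B (x + s *\<^sub>R i) * h (x + s *\<^sub>R i) \<partial>lborel) \<partial>lborel)"
    unfolding 1 ..
  also have "\<dots> = (\<integral>\<^sup>+x. (\<integral>\<^sup>+s. indicator ?B (x - s *\<^sub>R i) * indicator ?B (x - s *\<^sub>R i + s *\<^sub>R i) \<partial>lborel) * h x \<partial>lborel)"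
    by (rule nn_integral_shear) measurable
  also have "\<dots> = (\<integral>\<^sup>+x. ennreal (b \<bullet> i - a \<bullet> i) * (h x * indicator ?B x) \<partial>lborel)"
  proof (rule nn_integral_cong)
    fix x :: 'a
    have "(\<integral>\<^sup>+s. indicator ?B (x - s *\<^sub>R i) * indicator ?B (x - s *\<^sub>R i + s *\<^sub>R i) \<partial>lborel)
      = (\<integral>\<^sup>+s. indicator {x \<bullet> i - b \<bullet> i..x \<bullet> i - a \<bullet> i} s * indicator ?B x \<partial>lborel)"
    proof (cases "x \<in> ?B")
      case True
      then show ?thesis using mem[OF True, of "- s" for s] by (intro nn_integral_cong) (auto split: split_indicator)
    qed simp
    also have "\<dots> = ennreal (b \<bullet> i - a \<bullet> i) * indicator ?B x"
      using ab[OF i] by (subst nn_integral_multc) auto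
    finally show "(\<integral>\<^sup>+s. indicator ?B (x - s *\<^sub>R i) * indicator ?B (x - s *\<^sub>R i + s *\<^sub>R i) \<partial>lborel) * h x
      = ennreal (b \<bullet> i - a \<bullet> i) * (h x * indicator ?B x)" by (simp add: mult_ac)
  qed
  also have "\<dots> = ennreal (b \<bullet> i - a \<bullet> i) * (\<integral>\<^sup>+x\<in>?B. h x \<partial>lborel)"
    by (rule nn_integral_cmult) measurable
  finally show ?thesis .
qed

text \<open>Written as a correction of \<open>x\<close> rather than by cases on the coordinates:
  with \<open>y = z + x\<close> it becomes \<open>x\<close> plus a function of \<open>z\<close>
  alone, the form to which the shear applies.\<close>

definition coord_mix :: "'a::euclidean_space set \<Rightarrow> 'a \<Rightarrow> 'a \<Rightarrow> 'a" where
  "coord_mix J x y = x + (\<Sum>i\<in>J. ((y - x) \<bullet> i) *\<^sub>R i)"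

lemma inner_coord_mix:
  assumes "J \<subseteq> Basis" "i \<in> Basis"
  shows "coord_mix J x y \<bullet> i = (if i \<in> J then y \<bullet> i else x \<bullet> i)"
proof -
  have fin: "finite J" using assms(1) finite_Basis finite_subset by blast
  have "(\<Sum>j\<in>J. ((y - x) \<bullet> j) *\<^sub>R j) \<bullet> i = (\<Sum>j\<in>J. if j = i then (y - x) \<bullet> i else 0)"
    unfolding inner_sum_left using assms by (intro sum.cong) (auto simp: inner_Basis)
  also have "\<dots> = (if i \<in> J then (y - x) \<bullet> i else 0)" using fin by simp
  finally show ?thesis by (simp add: coord_mix_def inner_add_left inner_diff_left)
qed

text \<open>If \<open>x\<close> and \<open>y\<close> are independent and uniform in the box, so is
  the point mixed from their coordinates.\<close>

lemma cbox_resample_mix: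
  fixes h :: "'a::euclidean_space \<Rightarrow> ennreal"
  assumes [measurable]: "h \<in> borel_measurable borel" and J: "J \<subseteq> Basis"
    and ab: "\<And>i. i \<in> Basis \<Longrightarrow> a \<bullet> i \<le> b \<bullet> i"
  shows "(\<integral>\<^sup>+x\<in>cbox a b. (\<integral>\<^sup>+y\<in>cbox a b. h (coord_mix J x y) \<partial>lborel) \<partial>lborel)
    = emeasure lborel (cbox a b) * (\<integral>\<^sup>+x\<in>cbox a b. h x \<partial>lborel)"
proof -
  let ?B = "cbox a b"
  define P where "P = (\<lambda>z::'a. \<Sum>i\<in>J. (z \<bullet> i) *\<^sub>R i)"
  have P[measurable]: "P \<in> borel_measurable borel" unfolding P_def by measurable
  have Pi: "P z \<bullet> i = (if i \<in> J then z \<bullet> i else 0)" if "i \<in> Basis" for z i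
    using inner_coord_mix[OF J that, of 0 z] by (simp add: coord_mix_def P_def)
  have mixP: "coord_mix J x (z + x) = x + P z" for x z by (simp add: coord_mix_def P_def)
  have "(\<integral>\<^sup>+x\<in>?B. (\<integral>\<^sup>+y\<in>?B. h (coord_mix J x y) \<partial>lborel) \<partial>lborel)
    = (\<integral>\<^sup>+x. (\<integral>\<^sup>+z. indicator ?B x * indicator ?B (z + x) * h (x + P z) \<partial>lborel) \<partial>lborel)"
  proof (rule nn_integral_cong)
    fix x :: 'a
    have [measurable]: "coord_mix J x \<in> borel_measurable borel" unfolding coord_mix_def by measurable
    have "(\<integral>\<^sup>+y\<in>?B. h (coord_mix J x y) \<partial>lborel) = (\<integral>\<^sup>+z. h (coord_mix J x (z + x)) * indicator ?B (z + x) \<partial>lborel)"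
      by (rule nn_integral_lborel_translation[symmetric]) measurable
    also have "\<dots> = (\<integral>\<^sup>+z. h (x + P z) * indicator ?B (z + x) \<partial>lborel)" by (simp add: mixP)
    finally show "(\<integral>\<^sup>+y\<in>?B. h (coord_mix J x y) \<partial>lborel) * indicator ?B x = (\<integral>\<^sup>+z. indicator ?B x * indicator ?B (z + x) * h (x + P z) \<partial>lborel)"
      by (cases "x \<in> ?B") (auto simp: mult.commute)
  qed
  also have "\<dots> = (\<integral>\<^sup>+x. (\<integral>\<^sup>+z. indicator ?B (x - P z) * indicator ?B (z + (x - P z)) \<partial>lborel) * h x \<partial>lborel)"
    by (rule nn_integral_shear) measurable
  also have "\<dots> = (\<integral>\<^sup>+x. emeasure lborel ?B * (h x * indicator ?B x) \<partial>lborel)"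
  proof (rule nn_integral_cong)
    fix x :: 'a
    \<comment> \<open>For fixed \<open>x\<close> in the box the admissible \<open>z\<close> form a
      box. Along \<open>J\<close> the constraint is that the old point \<open>x - P z\<close> lies
      in \<open>cbox a b\<close>, along the other coordinates that \<open>z + x\<close> does. Its
      sides have the lengths of those of \<open>cbox a b\<close>, so its volume does not depend on
      \<open>x\<close>.\<close>
    define c where "c = (\<Sum>i\<in>Basis. (if i \<in> J then x \<bullet> i - b \<bullet> i else a \<bullet> i - x \<bullet> i) *\<^sub>R i)"
    define d where "d = (\<Sum>i\<in>Basis. (if i \<in> J then x \<bullet> i - a \<bullet> i else b \<bullet> i - x \<bullet> i) *\<^sub>R i)"
    have ci: "c \<bullet> i = (if i \<in> J then x \<bullet> i - b \<bullet> i else a \<bullet> i - x \<bullet> i)" if "i \<in> Basis" for i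
      unfolding c_def using that by (rule inner_sum_left_Basis)
    have di: "d \<bullet> i = (if i \<in> J then x \<bullet> i - a \<bullet> i else b \<bullet> i - x \<bullet> i)" if "i \<in> Basis" for i
      unfolding d_def using that by (rule inner_sum_left_Basis)
    have eq: "x - P z \<in> ?B \<and> z + x - P z \<in> ?B \<longleftrightarrow> x \<in> ?B \<and> z \<in> cbox c d" for z
    proof -
      have "x - P z \<in> ?B \<and> z + x - P z \<in> ?B \<longleftrightarrow>
        (\<forall>i\<in>Basis. a \<bullet> i \<le> (x - P z) \<bullet> i \<and> (x - P z) \<bullet> i \<le> b \<bullet> i \<and> a \<bullet> i \<le> (z + x - P z) \<bullet> i \<and> (z + x - P z) \<bullet> i \<le> b \<bullet> i)"
        by (auto simp: mem_box)
      also have "\<dots> \<longleftrightarrow> (\<forall>i\<in>Basis. a \<bullet> i \<le> x \<bullet> i \<and> x \<bullet> i \<le> b \<bullet> i \<and> c \<bullet> i \<le> z \<bullet> i \<and> z \<bullet> i \<le> d \<bullet> i)"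
        by (rule ball_cong) (auto simp: inner_diff_left inner_add_left Pi ci di)
      also have "\<dots> \<longleftrightarrow> x \<in> ?B \<and> z \<in> cbox c d" by (auto simp: mem_box)
      finally show ?thesis .
    qed
    have em: "emeasure lborel (cbox c d) = emeasure lborel ?B" 
      using ab by (subst (1 2) emeasure_lborel_cbox)
        (auto simp: ci di inner_diff_left intro!: arg_cong[of _ _ ennreal] prod.cong)
    have "(\<integral>\<^sup>+z. indicator ?B (x - P z) * indicator ?B (z + (x - P z)) \<partial>lborel)
      = (\<integral>\<^sup>+z. indicator (cbox c d) z * indicator ?B x \<partial>lborel)"
      using eq by (intro nn_integral_cong) (auto simp: add_diff_eq split: split_indicator)
    also have "\<dots> = emeasure lborel ?B * indicator ?B x"
      by (subst nn_integral_multc) (auto simp: em)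
    finally show "(\<integral>\<^sup>+z. indicator ?B (x - P z) * indicator ?B (z + (x - P z)) \<partial>lborel) * h x = emeasure lborel ?B * (h x * indicator ?B x)"
      by (simp add: mult_ac)
  qed
  also have "\<dots> = emeasure lborel ?B * (\<integral>\<^sup>+x\<in>?B. h x \<partial>lborel)"
    by (rule nn_integral_cmult) measurable
  finally show ?thesis .
qed

section \<open>The Poincare inequality in L1 on a box\<close>

lemma indicator_mult_mono:
  fixes a b :: ennreal
  shows "(x \<in> A \<Longrightarrow> a \<le> b) \<Longrightarrow> a * indicator A x \<le> b * indicator A x"
  by (auto split: split_indicator)

text \<open>Coordinates are exchanged one at a time. The step in direction \<open>i\<close> is
  bounded by an integral along a segment through a mixed point, and mixed points are uniform in the
  box, so on average the step costs one side length times the average of one derivative.\<close>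

lemma poincare_cbox_double:
  fixes f :: "'a::euclidean_space \<Rightarrow> real"
  assumes f: "L-lipschitz_on UNIV f" and ab: "\<And>i. i \<in> Basis \<Longrightarrow> a \<bullet> i \<le> b \<bullet> i"
    and J: "J \<subseteq> Basis"
  shows "(\<integral>\<^sup>+x\<in>cbox a b. (\<integral>\<^sup>+y\<in>cbox a b. ennreal \<bar>f (coord_mix J x y) - f x\<bar> \<partial>lborel) \<partial>lborel)
    \<le> emeasure lborel (cbox a b) *
      (\<Sum>i\<in>J. ennreal (b \<bullet> i - a \<bullet> i) * (\<integral>\<^sup>+x\<in>cbox a b. ennreal \<bar>ddir f i x\<bar> \<partial>lborel))"
proof -
  have "finite J" using J finite_Basis finite_subset by blast
  have cf: "continuous_on UNIV f" by (rule lipschitz_on_continuous_on[OF f])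
  have [measurable]: "f \<in> borel_measurable borel" by (rule borel_measurable_continuous_onI[OF cf])
  have [measurable]: "ddir f i \<in> borel_measurable borel" for i by (rule borel_measurable_ddir[OF cf])
  let ?B = "cbox a b"
  from \<open>finite J\<close> J show ?thesis
  proof induction
    case empty
    then show ?case by (simp add: coord_mix_def)
  next
    case (insert i J)
    then have i: "i \<in> Basis" and J: "J \<subseteq> Basis" by auto
    \<comment> \<open>\<open>H z\<close> integrates over the whole segment of the box through
      \<open>z\<close> in direction \<open>i\<close> and does not see the coordinate of
      \<open>z\<close> along \<open>i\<close>. It can therefore be evaluated at the point before the
      step.\<close>
    define H where "H = (\<lambda>z. \<integral>\<^sup>+t\<in>{a \<bullet> i..b \<bullet> i}. ennreal \<bar>ddir f i (z + (t - z \<bullet> i) *\<^sub>R i)\<bar> \<partial>lborel)"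
    have [measurable]: "H \<in> borel_measurable borel"
      unfolding H_def by measurable
    have [measurable]: "(\<lambda>p. coord_mix J (fst p) (snd p)) \<in> borel_measurable (borel \<Otimes>\<^sub>M borel)"
      "coord_mix J x \<in> borel_measurable borel" for x
      unfolding coord_mix_def by (measurable, measurable)
    have pt: "ennreal \<bar>f (coord_mix (insert i J) x y) - f x\<bar> \<le> ennreal \<bar>f (coord_mix J x y) - f x\<bar> + H (coord_mix J x y)"
      if xy: "x \<in> ?B" "y \<in> ?B" for x y
    proof -
      define z where "z = coord_mix J x y"
      have zi: "z \<bullet> i = x \<bullet> i" using inner_coord_mix[OF J i] insert.hyps by (simp add: z_def)
      have e1: "coord_mix (insert i J) x y = (z - (z \<bullet> i) *\<^sub>R i) + (y \<bullet> i) *\<^sub>R i"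
      proof -
        have "coord_mix (insert i J) x y = z + ((y - x) \<bullet> i) *\<^sub>R i"
          using insert.hyps by (simp add: coord_mix_def z_def algebra_simps)
        then show ?thesis by (simp add: zi algebra_simps)
      qed
      have "x \<bullet> i \<in> {a \<bullet> i..b \<bullet> i}" "y \<bullet> i \<in> {a \<bullet> i..b \<bullet> i}" using xy i by (auto simp: mem_box)
      from lipschitz_line_le_nn_integral[OF f this, of "z - (z \<bullet> i) *\<^sub>R i" i]
      have "ennreal \<bar>f (coord_mix (insert i J) x y) - f z\<bar> \<le> H z"
        unfolding e1 H_def by (simp add: zi algebra_simps)
      moreover have "ennreal \<bar>f (coord_mix (insert i J) x y) - f x\<bar> \<le> ennreal \<bar>f z - f x\<bar> + ennreal \<bar>f (coord_mix (insert i J) x y) - f z\<bar>"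
        unfolding ennreal_plus[OF abs_ge_zero abs_ge_zero, symmetric] by (rule ennreal_leI) linarith
      ultimately show ?thesis unfolding z_def[symmetric] by (meson add_left_mono order_trans)
    qed
    have "(\<integral>\<^sup>+x\<in>?B. (\<integral>\<^sup>+y\<in>?B. ennreal \<bar>f (coord_mix (insert i J) x y) - f x\<bar> \<partial>lborel) \<partial>lborel)
      \<le> (\<integral>\<^sup>+x\<in>?B. ((\<integral>\<^sup>+y\<in>?B. ennreal \<bar>f (coord_mix J x y) - f x\<bar> \<partial>lborel) + (\<integral>\<^sup>+y\<in>?B. H (coord_mix J x y) \<partial>lborel)) \<partial>lborel)"
    proof (rule nn_integral_mono, rule indicator_mult_mono)
      fix x assume x: "x \<in> ?B"
      have "(\<integral>\<^sup>+y\<in>?B. ennreal \<bar>f (coord_mix (insert i J) x y) - f x\<bar> \<partial>lborel)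
        \<le> (\<integral>\<^sup>+y. ennreal \<bar>f (coord_mix J x y) - f x\<bar> * indicator ?B y + H (coord_mix J x y) * indicator ?B y \<partial>lborel)"
        using pt[OF x] by (intro nn_integral_mono) (auto split: split_indicator)
      also have "\<dots> = (\<integral>\<^sup>+y\<in>?B. ennreal \<bar>f (coord_mix J x y) - f x\<bar> \<partial>lborel) + (\<integral>\<^sup>+y\<in>?B. H (coord_mix J x y) \<partial>lborel)"
        by (rule nn_integral_add) measurable
      finally show "(\<integral>\<^sup>+y\<in>?B. ennreal \<bar>f (coord_mix (insert i J) x y) - f x\<bar> \<partial>lborel)
        \<le> (\<integral>\<^sup>+y\<in>?B. ennreal \<bar>f (coord_mix J x y) - f x\<bar> \<partial>lborel) + (\<integral>\<^sup>+y\<in>?B. H (coord_mix J x y) \<partial>lborel)" .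
    qed
    also have "\<dots> = (\<integral>\<^sup>+x\<in>?B. (\<integral>\<^sup>+y\<in>?B. ennreal \<bar>f (coord_mix J x y) - f x\<bar> \<partial>lborel) \<partial>lborel)
       + (\<integral>\<^sup>+x\<in>?B. (\<integral>\<^sup>+y\<in>?B. H (coord_mix J x y) \<partial>lborel) \<partial>lborel)"
      unfolding distrib_right by (rule nn_integral_add) measurable
    also have "(\<integral>\<^sup>+x\<in>?B. (\<integral>\<^sup>+y\<in>?B. H (coord_mix J x y) \<partial>lborel) \<partial>lborel) = emeasure lborel ?B * (\<integral>\<^sup>+x\<in>?B. H x \<partial>lborel)"
      by (rule cbox_resample_mix[OF _ J ab]) auto
    also have "(\<integral>\<^sup>+x\<in>?B. H x \<partial>lborel) = ennreal (b \<bullet> i - a \<bullet> i) * (\<integral>\<^sup>+x\<in>?B. ennreal \<bar>ddir f i x\<bar> \<partial>lborel)"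
      unfolding H_def by (rule cbox_resample_line[OF _ i ab]) auto
    also have "(\<integral>\<^sup>+x\<in>?B. (\<integral>\<^sup>+y\<in>?B. ennreal \<bar>f (coord_mix J x y) - f x\<bar> \<partial>lborel) \<partial>lborel)
      \<le> emeasure lborel ?B * (\<Sum>i\<in>J. ennreal (b \<bullet> i - a \<bullet> i) * (\<integral>\<^sup>+x\<in>?B. ennreal \<bar>ddir f i x\<bar> \<partial>lborel))"
      by (rule insert.IH[OF J])
    finally show ?case using insert.hyps by (simp add: distrib_left add.commute)
  qed
qed

text \<open>Used with \<open>c\<close> a value of the function, which bounds its deviation from the
  mean by an average of differences, and with \<open>c\<close> the mean over a larger box, which
  compares two means.\<close>

lemma mean_oscillation_le:
  fixes f :: "'a::euclidean_space \<Rightarrow> real"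
  assumes cf: "continuous_on UNIV f" and pos: "measure lborel (cbox a b) > 0"
  defines "m \<equiv> (LINT x:cbox a b|lborel. f x) / measure lborel (cbox a b)"
  shows "emeasure lborel (cbox a b) * ennreal \<bar>c - m\<bar> \<le> (\<integral>\<^sup>+y\<in>cbox a b. ennreal \<bar>f y - c\<bar> \<partial>lborel)"
proof -
  let ?B = "cbox a b"
  have i1: "set_integrable lborel ?B f" and i2: "set_integrable lborel ?B (\<lambda>y. f y - c)"
    and i3: "set_integrable lborel ?B (\<lambda>y. c)"
    unfolding set_integrable_def
    by (intro borel_integrable_compact continuous_intros continuous_on_subset[OF cf]; simp)+
  have "(LINT y:?B|lborel. f y - c) = (LINT y:?B|lborel. f y) - (LINT y:?B|lborel. c)"
    by (rule set_integral_diff[OF i1 i3])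
  also have "\<dots> = measure lborel ?B * (m - c)"
    using pos by (simp add: m_def set_lebesgue_integral_def algebra_simps)
  finally have e: "(LINT y:?B|lborel. f y - c) = measure lborel ?B * (m - c)" .
  have "emeasure lborel ?B * ennreal \<bar>c - m\<bar> = ennreal (measure lborel ?B * \<bar>c - m\<bar>)"
    using emeasure_eq_ennreal_measure[of lborel ?B] emeasure_lborel_cbox_finite[of a b]
    by (simp add: ennreal_mult)
  also have "\<dots> = ennreal (norm (LINT y:?B|lborel. f y - c))"
    unfolding e using pos by (simp add: abs_mult abs_minus_commute)
  also have "\<dots> \<le> (\<integral>\<^sup>+y. norm (indicator ?B y *\<^sub>R (f y - c)) \<partial>lborel)"
    unfolding set_lebesgue_integral_def
    by (rule integral_norm_bound_ennreal) (use i2 in \<open>simp add: set_integrable_def\<close>)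
  also have "\<dots> = (\<integral>\<^sup>+y\<in>?B. ennreal \<bar>f y - c\<bar> \<partial>lborel)"
    by (intro nn_integral_cong) (auto split: split_indicator)
  finally show ?thesis .
qed

text \<open>The two-point inequality is averaged over the second point. Every derivative is
  multiplied by the side length in its own direction, with constant 1, so the eccentricity of the
  box never enters.\<close>

theorem poincare_cbox:
  fixes f :: "'a::euclidean_space \<Rightarrow> real"
  assumes f: "L-lipschitz_on UNIV f" and ab: "\<And>i. i \<in> Basis \<Longrightarrow> a \<bullet> i < b \<bullet> i"
  defines "m \<equiv> (LINT x:cbox a b|lborel. f x) / measure lborel (cbox a b)"
  shows "(\<integral>\<^sup>+x\<in>cbox a b. ennreal \<bar>f x - m\<bar> \<partial>lborel)
    \<le> (\<Sum>i\<in>Basis. ennreal (b \<bullet> i - a \<bullet> i) * (\<integral>\<^sup>+x\<in>cbox a b. ennreal \<bar>ddir f i x\<bar> \<partial>lborel))"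
    (is "?l \<le> ?r")
proof -
  let ?B = "cbox a b"
  have cf: "continuous_on UNIV f" by (rule lipschitz_on_continuous_on[OF f])
  have [measurable]: "f \<in> borel_measurable borel" by (rule borel_measurable_continuous_onI[OF cf])
  have pos: "measure lborel ?B > 0"
    using ab by (subst measure_lborel_cbox_eq) (auto simp: less_imp_le intro!: prod_pos simp: inner_diff_left)
  have mixB: "coord_mix Basis x y = y" for x y :: 'a
    by (rule euclidean_eqI) (simp add: inner_coord_mix)
  have "emeasure lborel ?B * ?l = (\<integral>\<^sup>+x. emeasure lborel ?B * (ennreal \<bar>f x - m\<bar> * indicator ?B x) \<partial>lborel)"
    by (rule nn_integral_cmult[symmetric]) measurable
  also have "\<dots> \<le> (\<integral>\<^sup>+x\<in>?B. (\<integral>\<^sup>+y\<in>?B. ennreal \<bar>f y - f x\<bar> \<partial>lborel) \<partial>lborel)"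
    using mean_oscillation_le[OF cf pos, folded m_def]
    by (intro nn_integral_mono) (auto split: split_indicator)
  also have "\<dots> \<le> emeasure lborel ?B * ?r"
    using poincare_cbox_double[OF f, of a b Basis] ab by (simp add: mixB less_imp_le)
  finally show ?thesis using pos
    by (subst (asm) ennreal_mult_le_mult_iff)
      (use emeasure_lborel_cbox_finite[of a b] in \<open>auto simp: measure_def\<close>)
qed

section \<open>The weight classes\<close>

lemma rectangle_eq_cbox:
  "rectangle S a l1 l2 = cbox a (\<chi> i. a $ i + (if i \<in> S then l1 else l2))"
  by (auto simp: rectangle_def mem_box_cart split: if_splits)

lemma measure_rectangle:
  assumes "0 < l1" "0 < l2"
  shows "measure lborel (rectangle S (a :: real^'n::finite) l1 l2) = (\<Prod>i\<in>UNIV. if i \<in> S then l1 else l2)"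
proof -
  have "cbox a (\<chi> i. a $ i + (if i \<in> S then l1 else l2)) \<noteq> {}"
    using assms by (auto simp: interval_eq_empty_cart not_less)
  then show ?thesis
    unfolding rectangle_eq_cbox by (subst content_cbox_cart) (auto intro!: prod.cong)
qed

lemma measure_rectangle_pos:
  assumes "R \<in> rectangles S" shows "0 < measure lborel R"
  using assms by (auto simp: rectangles_def measure_rectangle intro!: prod_pos)

lemma rectangles_sets [measurable]: "R \<in> rectangles S \<Longrightarrow> R \<in> sets borel"
  by (auto simp: rectangles_def rectangle_eq_cbox)

lemma emeasure_rectangles: "R \<in> rectangles S \<Longrightarrow> emeasure lborel R = ennreal (measure lborel R)"
  by (rule emeasure_eq_ennreal_measure)
    (auto simp: rectangles_def rectangle_eq_cbox emeasure_lborel_cbox_eq)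

section \<open>Measurability and local integrability of weights\<close>

lemma weight_measurable:
  fixes w :: "real ^ 'n::finite \<Rightarrow> real"
  assumes "weight w" shows "w \<in> borel_measurable lebesgue"
proof (rule borel_measurable_LIMSEQ_real)
  fix x :: "real ^ 'n"
  obtain n where n: "norm x \<le> real n" using real_arch_simple by blast
  have "\<forall>\<^sub>F k in sequentially. indicat_real (cball 0 (real k)) x * w x = w x"
    using eventually_ge_at_top[of n] by eventually_elim (use n in \<open>auto simp: indicator_def\<close>)
  then show "(\<lambda>k. indicat_real (cball 0 (real k)) x * w x) \<longlonglongrightarrow> w x"
    by (rule tendsto_eventually)
next
  fix k :: nat
  have "w absolutely_integrable_on cball 0 (real k)" using assms by (simp add: weight_def)
  then show "(\<lambda>x. indicat_real (cball 0 (real k)) x * w x) \<in> borel_measurable lebesgue"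
    by (auto simp: set_integrable_def)
qed

lemma weight_finite:
  assumes "weight w" "compact Q"
  shows "(\<integral>\<^sup>+x\<in>Q. ennreal (w x) \<partial>lebesgue) < \<infinity>"
proof -
  have "w absolutely_integrable_on Q" using assms by (simp add: weight_def)
  then have "(\<integral>\<^sup>+x. ennreal (norm (indicator Q x *\<^sub>R w x)) \<partial>lebesgue) < \<infinity>"
    unfolding set_integrable_def integrable_iff_bounded by auto
  also have "(\<integral>\<^sup>+x. ennreal (norm (indicator Q x *\<^sub>R w x)) \<partial>lebesgue) = (\<integral>\<^sup>+x\<in>Q. ennreal (w x) \<partial>lebesgue)"
    using assms by (intro nn_integral_cong) (auto simp: weight_def split: split_indicator)
  finally show ?thesis .
qed

lemma epowr_ennreal: "s > 0 \<Longrightarrow> x \<ge> 0 \<Longrightarrow> epowr (ennreal x) s = ennreal (x powr s)"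
  by (simp add: epowr_def)

lemma epowr_neg: "s < 0 \<Longrightarrow> x \<ge> 0 \<Longrightarrow> epowr (ennreal x) s = (if x = 0 then \<infinity> else ennreal (x powr s))"
  by (simp add: epowr_def)

section \<open>Hoelder's inequality and the A_r condition\<close>

lemma nn_integral_Holder:
  fixes u v :: "'a \<Rightarrow> real"
  assumes [measurable]: "u \<in> borel_measurable M" "v \<in> borel_measurable M"
    and nn: "\<And>x. 0 \<le> u x" "\<And>x. 0 \<le> v x"
    and r: "1 < r" "1 < s" "1 / r + 1 / s = 1"
    and A: "(\<integral>\<^sup>+x. ennreal (u x powr r) \<partial>M) = ennreal A" "0 \<le> A"
    and B: "(\<integral>\<^sup>+x. ennreal (v x powr s) \<partial>M) = ennreal B" "0 \<le> B"
  shows "(\<integral>\<^sup>+x. ennreal (u x * v x) \<partial>M) \<le> ennreal (A powr (1 / r) * B powr (1 / s))"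
proof (cases "A = 0 \<or> B = 0")
  case True
  then have "AE x in M. u x = 0 \<or> v x = 0"
  proof
    assume "A = 0"
    then have "AE x in M. ennreal (u x powr r) = 0" using A by (subst nn_integral_0_iff_AE[symmetric]) auto
    then show ?thesis by eventually_elim auto
  next
    assume "B = 0"
    then have "AE x in M. ennreal (v x powr s) = 0" using B by (subst nn_integral_0_iff_AE[symmetric]) auto
    then show ?thesis by eventually_elim auto
  qed
  then have "(\<integral>\<^sup>+x. ennreal (u x * v x) \<partial>M) = (\<integral>\<^sup>+x. 0 \<partial>M)"
    by (intro nn_integral_cong_AE) (auto elim!: eventually_mono)
  then show ?thesis by simp
next
  case False
  then have pos: "A > 0" "B > 0" using A B by auto
  define a where "a = A powr (1 / r)"
  define b where "b = B powr (1 / s)"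
  have ab: "a > 0" "b > 0" "a powr r = A" "b powr s = B"
    using pos r by (auto simp: a_def b_def powr_powr)
  have pt: "ennreal (u x * v x) \<le> ennreal (a * b / r / A) * ennreal (u x powr r) + ennreal (a * b / s / B) * ennreal (v x powr s)" for x
  proof -
    have "(u x / a) * (v x / b) \<le> (u x / a) powr r / r + (v x / b) powr s / s"
      using nn[of x] ab r by (intro Youngs_inequality) auto
    also have "\<dots> = u x powr r / A / r + v x powr s / B / s"
      using nn[of x] ab by (simp add: powr_divide)
    finally have "u x * v x \<le> a * b * (u x powr r / A / r + v x powr s / B / s)"
      using ab(1,2) by (simp add: field_simps)
    also have "\<dots> = a * b / r / A * u x powr r + a * b / s / B * v x powr s"
      by (simp add: field_simps)
    finally show ?thesis
      using ab r pos by (subst (1 2) ennreal_mult[symmetric]) (auto simp flip: ennreal_plus intro!: ennreal_leI)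
  qed
  have "(\<integral>\<^sup>+x. ennreal (u x * v x) \<partial>M) \<le> (\<integral>\<^sup>+x. ennreal (a * b / r / A) * ennreal (u x powr r) + ennreal (a * b / s / B) * ennreal (v x powr s) \<partial>M)"
    by (intro nn_integral_mono pt)
  also have "\<dots> = ennreal (a * b / r / A) * ennreal A + ennreal (a * b / s / B) * ennreal B"
    by (simp add: nn_integral_add nn_integral_cmult A B)
  also have "\<dots> = ennreal (a * b / r / A * A + a * b / s / B * B)"
    using ab r pos by (simp flip: ennreal_mult ennreal_plus)
  also have "a * b / r / A * A + a * b / s / B * B = a * b * (1 / r + 1 / s)"
    using pos by (simp add: field_simps)
  also have "\<dots> = a * b" by (simp add: r)
  finally show ?thesis by (simp add: a_def b_def)
qed

text \<open>The only form in which the definition of the A_r constant is used: weighted averages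
  control unweighted ones. For \<open>r > 1\<close> it is Hoelder's inequality for the product of
  \<open>g w^(1/r)\<close> and \<open>w^(-1/r)\<close>; for \<open>r = 1\<close> the weight is
  bounded below by its essential infimum.\<close>

lemma A_const_Holder:
  fixes w :: "real ^ 'n::finite \<Rightarrow> real"
  assumes w: "weight w" and Q: "Q \<in> rectangles S" and r: "1 \<le> r"
    and K: "A_const S r w = ennreal K" "0 \<le> K"
    and W: "(\<integral>\<^sup>+x\<in>Q. ennreal (w x) \<partial>lborel) = ennreal W" "0 < W"
    and g: "g \<in> borel_measurable borel" "\<And>x. 0 \<le> g x"
    and G: "(\<integral>\<^sup>+x\<in>Q. ennreal (g x) \<partial>lborel) = ennreal G" "0 \<le> G"
    and N: "(\<integral>\<^sup>+x\<in>Q. ennreal (g x powr r * w x) \<partial>lborel) = ennreal N" "0 \<le> N"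
  shows "(G / measure lborel Q) powr r \<le> K * N / W"
proof -
  note wm[measurable] = weight_measurable[OF w]
  have [measurable]: "Q \<in> sets lebesgue" using rectangles_sets[OF Q] by simp
  have [measurable]: "g \<in> borel_measurable lebesgue" using g by (simp add: measurable_completion)
  have wn: "\<And>x. 0 \<le> w x" using w by (simp add: weight_def)
  define V where "V = measure lborel Q"
  have V: "V > 0" and emV: "emeasure lborel Q = ennreal V" "emeasure lebesgue Q = ennreal V"
    using measure_rectangle_pos[OF Q] emeasure_rectangles[OF Q] rectangles_sets[OF Q] by (auto simp: V_def)
  have emw: "emean Q (\<lambda>x. ennreal (w x)) = ennreal (W / V)"
    unfolding emean_def nn_integral_completion emV W using V W by (simp add: divide_ennreal)
  show ?thesis
  proof (cases "r = 1")
    case True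
    define e where "e = ess_inf_on Q (\<lambda>x. ennreal (w x))"
    have *: "ennreal (W / V) \<le> c * e" if "\<forall>R\<in>rectangles S. emean R (\<lambda>x. ennreal (w x)) \<le> c * ess_inf_on R (\<lambda>x. ennreal (w x))" for c
      using that Q unfolding e_def emw[symmetric] by blast
    have Kdef: "ennreal K = Inf {c. \<forall>R\<in>rectangles S. emean R (\<lambda>x. ennreal (w x)) \<le> c * ess_inf_on R (\<lambda>x. ennreal (w x))}"
      using K(1) True by (simp add: A_const_def)
    have ess: "e * (\<integral>\<^sup>+x\<in>Q. ennreal (h x) \<partial>lborel) \<le> (\<integral>\<^sup>+x\<in>Q. ennreal (h x * w x) \<partial>lborel)"
      if h: "h \<in> borel_measurable borel" "\<And>x. 0 \<le> h x" for h
    proof -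
      have [measurable]: "h \<in> borel_measurable lebesgue" using h by (simp add: measurable_completion)
      have "t * (\<integral>\<^sup>+x\<in>Q. ennreal (h x) \<partial>lborel) \<le> (\<integral>\<^sup>+x\<in>Q. ennreal (h x * w x) \<partial>lborel)"
        if "AE x in lebesgue. x \<in> Q \<longrightarrow> t \<le> ennreal (w x)" for t
      proof -
        have "t * (\<integral>\<^sup>+x\<in>Q. ennreal (h x) \<partial>lborel) = (\<integral>\<^sup>+x. t * (ennreal (h x) * indicator Q x) \<partial>lebesgue)"
          by (subst nn_integral_cmult) (auto simp: nn_integral_completion)
        also have "\<dots> \<le> (\<integral>\<^sup>+x\<in>Q. ennreal (h x * w x) \<partial>lebesgue)"
          using that
        proof (intro nn_integral_mono_AE, eventually_elim)
          case (elim x)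
          then show ?case using h(2)[of x] wn[of x] mult_left_mono[of t "ennreal (w x)" "ennreal (h x)"]
            by (auto simp: ennreal_mult mult.commute[of t] split: split_indicator)
        qed
        finally show ?thesis by (simp add: nn_integral_completion)
      qed
      then show ?thesis unfolding e_def ess_inf_on_def
        using SUP_mult_right_ennreal[of "\<lambda>x. x" "{t. AE x in lebesgue. x \<in> Q \<longrightarrow> t \<le> ennreal (w x)}"]
        by (auto intro!: SUP_least)
    qed
    have eg: "e * ennreal G \<le> ennreal N"
      using ess[OF g] True g(2) by (simp add: G(1) N(1)[symmetric])
    have "e * ennreal V \<le> ennreal W"
      using ess[of "\<lambda>_. 1"] rectangles_sets[OF Q] by (simp add: emV W)
    then have etop: "e \<noteq> \<infinity>" using V by (auto simp: ennreal_top_mult top_unique)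
    \<comment> \<open>The infimum is finite, so an admissible \<open>c\<close> exists. Even
      \<open>c = \<infinity>\<close> leads to the contradiction, because
      \<open>\<infinity> * 0 = 0\<close>.\<close>
    have e0: "e \<noteq> 0"
    proof
      assume e: "e = 0"
      have "{c. \<forall>R\<in>rectangles S. emean R (\<lambda>x. ennreal (w x)) \<le> c * ess_inf_on R (\<lambda>x. ennreal (w x))} \<noteq> {}"
        using Kdef by (metis Inf_empty ennreal_neq_top infinity_ennreal_def top_ennreal_def)
      then obtain c where "ennreal (W / V) \<le> c * e" using * by blast
      then show False using e V W(2) by (simp add: ennreal_eq_0_iff divide_le_0_iff)
    qed
    \<comment> \<open>Dividing by \<open>e\<close>, which is neither zero nor infinite, gives one
      number below every admissible \<open>c\<close>, so the bound passes to the infimum whether or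
      not it is attained.\<close>
    have eK: "ennreal (W / V) \<le> ennreal K * e"
    proof -
      have "ennreal (W / V) / e \<le> ennreal K"
        unfolding Kdef
      proof (rule Inf_greatest, clarify)
        fix c assume "\<forall>R\<in>rectangles S. emean R (\<lambda>x. ennreal (w x)) \<le> c * ess_inf_on R (\<lambda>x. ennreal (w x))"
        from divide_right_mono_ennreal[OF *[OF this], of e] show "ennreal (W / V) / e \<le> c"
          using e0 etop by (simp add: ennreal_mult_divide_eq)
      qed
      then have "ennreal (W / V) / e * e \<le> ennreal K * e" by (rule mult_right_mono) simp
      then show ?thesis using e0 etop by (simp add: ennreal_divide_times ennreal_mult_divide_eq less_top)
    qed
    have "ennreal (W / V * G) = ennreal (W / V) * ennreal G" by (rule ennreal_mult) (use V W(2) G in auto)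
    also have "\<dots> \<le> (ennreal K * e) * ennreal G" by (intro mult_right_mono eK) simp
    also have "\<dots> \<le> ennreal K * ennreal N" using eg by (simp add: mult.assoc mult_left_mono)
    also have "\<dots> = ennreal (K * N)" using K N by (simp add: ennreal_mult)
    finally have "W / V * G \<le> K * N" using K N by (simp add: ennreal_le_iff)
    then show ?thesis using True W V G by (simp add: V_def[symmetric] field_simps)
  next
    case False
    then have r1: "r > 1" using r by simp
    define \<sigma> where "\<sigma> = (\<lambda>x. epowr (ennreal (w x)) (- 1 / (r - 1)))"
    have \<sigma>_eq: "\<sigma> = (\<lambda>x. if w x = 0 then \<infinity> else ennreal (w x powr (- 1 / (r - 1))))"
      unfolding \<sigma>_def using r1 wn by (intro ext, subst epowr_neg) auto
    have [measurable]: "\<sigma> \<in> borel_measurable lebesgue" unfolding \<sigma>_eq by measurable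
    have "ennreal (W / V) * epowr (emean Q \<sigma>) (r - 1) \<le> ennreal K"
      unfolding K(1)[symmetric] A_const_def emw[symmetric] \<sigma>_def using False Q by (auto intro: SUP_upper)
    note le = this
    have "emean Q \<sigma> \<noteq> \<infinity>"
    proof
      assume "emean Q \<sigma> = \<infinity>"
      then have "epowr (emean Q \<sigma>) (r - 1) = \<infinity>" using r1 by (simp add: epowr_def)
      then have "ennreal (W / V) * epowr (emean Q \<sigma>) (r - 1) = \<infinity>" using V W(2) by (auto simp: ennreal_mult_eq_top_iff ennreal_eq_0_iff divide_le_0_iff)
      then show False using le by (simp add: top_unique)
    qed
    then have "(\<integral>\<^sup>+x\<in>Q. \<sigma> x \<partial>lebesgue) \<noteq> \<infinity>"
      unfolding emean_def using emV by (auto simp: ennreal_divide_eq_top_iff ennreal_top_divide)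
    then obtain T where T: "(\<integral>\<^sup>+x\<in>Q. \<sigma> x \<partial>lebesgue) = ennreal T" "0 \<le> T"
      by (metis ennreal_cases infinity_ennreal_def)
    have "emean Q \<sigma> = ennreal (T / V)" unfolding emean_def T emV using V T by (simp add: divide_ennreal)
    then have "ennreal (W / V) * ennreal ((T / V) powr (r - 1)) \<le> ennreal K"
      using le r1 V T by (simp add: epowr_ennreal)
    then have Ar: "W / V * (T / V) powr (r - 1) \<le> K"
      using V W K(2) by (simp flip: ennreal_mult)
    \<comment> \<open>\<open>epowr\<close> sends 0 to \<open>\<infinity>\<close> for a negative
      exponent, so the finite integral of \<open>\<sigma>\<close> excludes zeros of the weight on
      \<open>Q\<close> up to a null set. At such zeros \<open>g\<close> would not be the product of
      \<open>u\<close> and \<open>v\<close>.\<close>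
    have AEpos: "AE x in lebesgue. x \<in> Q \<longrightarrow> w x > 0"
    proof -
      have "AE x in lebesgue. \<sigma> x * indicator Q x \<noteq> \<infinity>"
        by (rule nn_integral_noteq_infinite) (use T in auto)
      then show ?thesis
        by eventually_elim (use wn in \<open>auto simp: \<sigma>_eq less_le split: if_splits\<close>)
    qed
    define s where "s = r / (r - 1)"
    have s: "1 < s" "1 / r + 1 / s = 1" using r1 by (auto simp: s_def field_simps)
    define u where "u = (\<lambda>x. g x * w x powr (1 / r) * indicator Q x)"
    define v where "v = (\<lambda>x. w x powr (- (1 / r)) * indicator Q x)"
    have "ennreal G = (\<integral>\<^sup>+x. ennreal (u x * v x) \<partial>lebesgue)"
      unfolding G(1)[symmetric] nn_integral_completion[of lborel, symmetric]
      using AEpos by (intro nn_integral_cong_AE, eventually_elim)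
        (auto simp: u_def v_def mult.assoc split: split_indicator simp flip: powr_add)
    also have "\<dots> \<le> ennreal (N powr (1 / r) * T powr (1 / s))"
    proof (rule nn_integral_Holder[OF _ _ _ _ r1 s])
      show "u \<in> borel_measurable lebesgue" "v \<in> borel_measurable lebesgue"
        unfolding u_def v_def by measurable
      show "0 \<le> u x" "0 \<le> v x" for x using g(2) by (auto simp: u_def v_def)
      show "(\<integral>\<^sup>+x. ennreal (u x powr r) \<partial>lebesgue) = ennreal N"
        unfolding N(1)[symmetric] nn_integral_completion[of lborel, symmetric]
        using r1 wn g(2)
        by (intro nn_integral_cong) (auto simp: u_def powr_mult powr_powr split: split_indicator)
      have e: "- (1 / r) * s = - 1 / (r - 1)" using r1 by (simp add: s_def)
      show "(\<integral>\<^sup>+x. ennreal (v x powr s) \<partial>lebesgue) = ennreal T"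
        unfolding T(1)[symmetric] using AEpos
      proof (intro nn_integral_cong_AE, eventually_elim)
        case (elim x)
        have "(w x powr (- (1 / r))) powr s = w x powr (- 1 / (r - 1))"
          by (subst powr_powr) (simp only: e)
        then show ?case using elim s(1) by (auto simp: v_def \<sigma>_eq split: split_indicator)
      qed
    qed (use N T in auto)
    finally have "G \<le> N powr (1 / r) * T powr (1 / s)" using N T by (simp add: ennreal_le_iff)
    then have "G powr r \<le> (N powr (1 / r) * T powr (1 / s)) powr r"
      using G r1 by (intro powr_mono2) auto
    also have "\<dots> = N * T powr (r - 1)"
      using N T r1 by (simp add: powr_mult powr_powr s_def)
    finally have "(G / V) powr r \<le> N * (T powr (r - 1) / V powr r)"
      using V G by (simp add: powr_divide divide_right_mono)
    also have "T powr (r - 1) / V powr r = (T / V) powr (r - 1) / V"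
      using V T by (simp add: powr_divide powr_diff)
    also have "N * ((T / V) powr (r - 1) / V) \<le> N * (K / W)"
      using Ar V W(2) N(2) by (intro mult_left_mono) (simp_all add: field_simps)
    finally show ?thesis by (simp add: V_def mult.commute)
  qed
qed

section \<open>Dyadic sums\<close>

lemma sum_geometric_le:
  fixes \<rho> :: real
  assumes "0 \<le> \<rho>" "\<rho> < 1"
  shows "(\<Sum>k<M. \<rho> ^ k) \<le> 1 / (1 - \<rho>)"
  using assms sum_le_suminf[of "\<lambda>k. \<rho> ^ k" "{..<M}"] suminf_geometric[of \<rho>] summable_geometric[of \<rho>] by auto

text \<open>Since \<open>y\<close> decreases geometrically it crosses 1 at most once. Before the
  crossing the inverses grow geometrically, after it \<open>y\<close> decays, and each side sums to
  at most \<open>1 / (1 - r)\<close> wherever the crossing is.\<close>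

lemma sum_min_inverse_le:
  fixes y :: "nat \<Rightarrow> real"
  assumes y: "\<And>k. 0 < y k" and step: "\<And>k. y (Suc k) \<le> r * y k" and r: "0 < r" "r < 1"
  shows "(\<Sum>k<M. min (y k) (1 / y k)) \<le> 2 / (1 - r)"
proof -
  \<comment> \<open>The second summand bounds the part of the series still to come and makes the
    induction close.\<close>
  have 1: "(\<Sum>k<M. if y k \<le> 1 then y k else 0) + min 1 (y M) / (1 - r) \<le> 1 / (1 - r)" for M
  proof (induction M)
    case 0
    then show ?case using r by (simp add: divide_right_mono)
  next
    case (Suc M)
    have "y (Suc M) / (1 - r) \<le> r * y M / (1 - r)" using step r by (simp add: divide_right_mono)
    also have "\<dots> = y M / (1 - r) - y M" using r by (simp add: field_simps)
    finally have a: "y M + y (Suc M) / (1 - r) \<le> y M / (1 - r)" by simp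
    show ?case
    proof (cases "y M \<le> 1")
      case True
      have "min 1 (y (Suc M)) / (1 - r) \<le> y (Suc M) / (1 - r)" using r by (simp add: divide_right_mono)
      then show ?thesis using Suc a True by simp
    next
      case False
      have "min 1 (y (Suc M)) / (1 - r) \<le> 1 / (1 - r)" using r by (simp add: divide_right_mono)
      then show ?thesis using Suc False by simp
    qed
  qed
  \<comment> \<open>The largest term so far is the last one, at most \<open>r / y M\<close> and at
    most 1; backwards from it the terms decay geometrically.\<close>
  have 2: "(\<Sum>k<M. if y k \<le> 1 then 0 else 1 / y k) \<le> min 1 (r / y M) / (1 - r)" for M
  proof (induction M)
    case 0
    then show ?case using r y[of 0] by simp
  next
    case (Suc M)
    have s: "1 / y M \<le> r / y (Suc M)" using step[of M] y[of M] y[of "Suc M"] by (simp add: field_simps)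
    have "r / y M \<le> 1 / y M" using r y[of M] by (simp add: divide_right_mono less_imp_le)
    with s have s': "r / y M \<le> r / y (Suc M)" by linarith
    show ?case
    proof (cases "y M \<le> 1")
      case True
      have "min 1 (r / y M) / (1 - r) \<le> min 1 (r / y (Suc M)) / (1 - r)"
        using s' r by (intro divide_right_mono) auto
      then show ?thesis using True Suc by simp
    next
      case False
      have "min 1 (r / y M) / (1 - r) + 1 / y M \<le> (r / y M) / (1 - r) + 1 / y M"
        using r by (intro add_right_mono divide_right_mono) auto
      also have "\<dots> = (1 / y M) / (1 - r)" using r y[of M] by (simp add: field_simps)
      also have "\<dots> \<le> min 1 (r / y (Suc M)) / (1 - r)"
        using s False r by (intro divide_right_mono) auto
      finally show ?thesis using False Suc by simp
    qed
  qed
  have "(\<Sum>k<M. min (y k) (1 / y k)) = (\<Sum>k<M. if y k \<le> 1 then y k else 0) + (\<Sum>k<M. if y k \<le> 1 then 0 else 1 / y k)"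
    unfolding sum.distrib[symmetric]
  proof (rule sum.cong)
    fix k
    show "min (y k) (1 / y k) = (if y k \<le> 1 then y k else 0) + (if y k \<le> 1 then 0 else 1 / y k)"
    proof (cases "y k \<le> 1")
      case True
      then have "1 \<le> 1 / y k" using y[of k] by simp
      then show ?thesis using True by simp
    next
      case False
      then have "1 / y k \<le> 1" by simp
      then have "1 / y k \<le> y k" using False by linarith
      then show ?thesis using False by (simp add: min_absorb2)
    qed
  qed simp
  also have "\<dots> \<le> 1 / (1 - r) + 1 / (1 - r)"
  proof (rule add_mono)
    have "0 \<le> min 1 (y M) / (1 - r)" using r y[of M] by simp
    then show "(\<Sum>k<M. if y k \<le> 1 then y k else 0) \<le> 1 / (1 - r)" using 1[of M] by linarith
    have "min 1 (r / y M) / (1 - r) \<le> 1 / (1 - r)" using r by (simp add: divide_right_mono)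
    then show "(\<Sum>k<M. if y k \<le> 1 then 0 else 1 / y k) \<le> 1 / (1 - r)" using 2[of M] by linarith
  qed
  finally show ?thesis by simp
qed

text \<open>Replaces two exponents that vary with \<open>K\<close> by one that does not.\<close>

lemma min_powr_le:
  fixes z :: real
  assumes "0 < z" "0 < \<gamma>" "\<gamma> \<le> s" "\<gamma> \<le> t"
  shows "min (z powr s) (z powr (- t)) \<le> min (z powr \<gamma>) (1 / z powr \<gamma>)"
proof (cases "z \<le> 1")
  case True
  have "z powr s \<le> z powr \<gamma>" using assms True by (intro powr_mono') auto
  moreover have "z powr \<gamma> \<le> 1 / z powr \<gamma>"
    using assms True powr_le1[of \<gamma> z] by (simp add: field_simps mult_le_one)
  ultimately show ?thesis by linarith
next
  case False
  have "z powr (- t) \<le> z powr (- \<gamma>)" using assms False by (intro powr_mono) auto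
  moreover have "1 \<le> z powr \<gamma>" using assms False by (simp add: ge_one_powr_ge_zero)
  moreover have "1 / z powr \<gamma> \<le> z powr \<gamma>" using calculation(2)
    by (smt (verit) divide_le_eq_1)
  ultimately show ?thesis by (simp add: powr_minus_divide)
qed

text \<open>Interpolates between the stopping level \<open>b\<close> and the bound
  \<open>N / \<omega>\<close> that monotonicity of the energy provides. The exponents leave
  \<open>\<omega>\<close> with the power \<open>- (1 / m)\<close>, which the decay of the side
  lengths can absorb.\<close>

lemma powr_interpolate:
  fixes x b N \<omega> p m :: real
  assumes "0 \<le> x" "x \<le> b" "x \<le> N / \<omega>" "0 < b" "0 < N" "0 < \<omega>" "0 < p" "p \<le> m"
  shows "x powr (1 / p) \<le> b powr (1 / p - 1 / m) * N powr (1 / m) * \<omega> powr (- (1 / m))"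
proof (cases "x = 0")
  case False
  then have x: "x > 0" using assms by simp
  have pm: "1 / m \<le> 1 / p" "0 < 1 / m" using assms by (auto simp: field_simps)
  have "x powr (1 / p) = x powr (1 / p - 1 / m) * x powr (1 / m)" using x by (simp flip: powr_add)
  also have "\<dots> \<le> b powr (1 / p - 1 / m) * (N / \<omega>) powr (1 / m)"
    using assms x pm by (intro mult_mono powr_mono2) auto
  also have "(N / \<omega>) powr (1 / m) = N powr (1 / m) * \<omega> powr (- (1 / m))"
    using assms by (simp add: powr_divide powr_minus_divide)
  finally show ?thesis by (simp add: mult_ac)
qed simp

section \<open>Growth of the weight along nested dyadic rectangles\<close>

lemma half_power_powr: "((1 / 2 :: real) ^ j) powr s = 2 powr (- (real j * s))"
proof -
  have "(1 / 2 :: real) ^ j = 2 powr (- real j)"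
    by (simp add: powr_minus powr_realpow power_one_over inverse_eq_divide)
  then show ?thesis by (simp add: powr_powr)
qed

text \<open>\<open>\<omega> k\<close> stands for the fraction of the weight of \<open>R\<close> in a
  dyadic rectangle of generation \<open>k\<close>. The clause on \<open>powr q\<close> alone tests
  A_q on \<open>R\<close> itself, so \<open>K\<close> enters once for every \<open>k\<close>. The
  last clause tests it with the value \<open>s\<close> on a child and \<open>t\<close> on the rest
  of its parent, and leaves both free because the different regimes use different values.\<close>

definition dyadic_growth :: "nat \<Rightarrow> real \<Rightarrow> real \<Rightarrow> (nat \<Rightarrow> real) \<Rightarrow> bool" where
  "dyadic_growth d q K \<omega> \<longleftrightarrow> \<omega> 0 = 1 \<and> (\<forall>k. 0 < \<omega> k \<and> \<omega> (Suc k) \<le> \<omega> k) \<and>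
    (\<forall>k. ((1 / 2) ^ (k * d)) powr q \<le> K * \<omega> k) \<and>
    (\<forall>k s t. 0 \<le> s \<longrightarrow> 0 \<le> t \<longrightarrow>
      (s * (1 / 2) ^ d + t * (1 - (1 / 2) ^ d)) powr q * \<omega> k
        \<le> K * (s powr q * \<omega> (Suc k) + t powr q * (\<omega> k - \<omega> (Suc k))))"

text \<open>The bound obtained by testing on \<open>R\<close> is raised to the power
  \<open>- (1 / m)\<close>. The factor from \<open>K\<close> is controlled by
  \<open>ln K \<le> q + ln K\<close>, and the volumes contribute 2 to the power
  \<open>k * q / (q + ln K)\<close>, which falls short of \<open>2 ^ k\<close> by the gain.\<close>

lemma dyadic_growth_lower:
  assumes g: "dyadic_growth d q K \<omega>" and d: "0 < d" and q: "1 \<le> q" and K: "1 \<le> K"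
    and m: "m = real d * (q + ln K)"
  shows "(1 / 2) ^ k * \<omega> k powr (- (1 / m)) \<le> exp (1 / d) * (2 powr (- (ln K / (q + ln K)))) ^ k"
proof -
  have L: "0 \<le> ln K" "0 < q + ln K" using q K by (auto intro: add_pos_nonneg)
  have mp: "m > 0" using L d by (simp add: m)
  have w: "\<omega> k > 0" "((1 / 2) ^ (k * d)) powr q \<le> K * \<omega> k" using g by (auto simp: dyadic_growth_def)
  have "((1 / 2) ^ (k * d)) powr q / K \<le> \<omega> k" using w K by (simp add: field_simps)
  then have "\<omega> k powr (- (1 / m)) \<le> (((1 / 2) ^ (k * d)) powr q / K) powr (- (1 / m))"
    using K mp w by (intro powr_mono2') auto
  also have "\<dots> = ((1 / 2) ^ (k * d)) powr (- (q / m)) * K powr (1 / m)"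
    using K by (simp add: powr_divide powr_powr powr_minus_divide)
  also have "K powr (1 / m) = exp (ln K / m)" using K by (simp add: powr_def)
  also have "\<dots> \<le> exp (1 / d)"
  proof -
    have "ln K / m = ln K / (q + ln K) * (1 / d)" using d by (simp add: m)
    also have "\<dots> \<le> 1 * (1 / d)" using L q by (intro mult_right_mono) auto
    finally show ?thesis by simp
  qed
  finally have a: "\<omega> k powr (- (1 / m)) \<le> ((1 / 2) ^ (k * d)) powr (- (q / m)) * exp (1 / d)"
    by (simp add: mult_left_mono)
  have "((1 / 2 :: real) ^ (k * d)) powr (- (q / m)) = 2 powr (real k * (real d * q / m))"
    unfolding half_power_powr by (simp add: mult.assoc)
  also have "real d * q / m = q / (q + ln K)" using d by (simp add: m)
  also have "q / (q + ln K) = 1 - ln K / (q + ln K)" using L by (simp add: field_simps)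
  finally have *: "((1 / 2 :: real) ^ (k * d)) powr (- (q / m)) = 2 powr (real k * (1 - ln K / (q + ln K)))" .
  have b: "(1 / 2) ^ k * ((1 / 2 :: real) ^ (k * d)) powr (- (q / m)) = (2 powr (- (ln K / (q + ln K)))) ^ k"
  proof -
    define \<theta> where "\<theta> = ln K / (q + ln K)"
    have "(1 / 2 :: real) ^ k = 2 powr (- real k)"
      using half_power_powr[of k 1] by simp
    then show ?thesis using *
      by (simp add: powr_powr algebra_simps flip: \<theta>_def powr_realpow powr_add)
  qed
  have "(1 / 2) ^ k * \<omega> k powr (- (1 / m)) \<le> (1 / 2) ^ k * (((1 / 2) ^ (k * d)) powr (- (q / m)) * exp (1 / d))"
    by (intro mult_left_mono a) simp
  also have "\<dots> = exp (1 / d) * (2 powr (- (ln K / (q + ln K)))) ^ k" unfolding b[symmetric] by simp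
  finally show ?thesis .
qed

lemma dyadic_sum_le_of_geometric:
  fixes N m b p c :: real and \<omega> x :: "nat \<Rightarrow> real"
  assumes geo: "\<And>k. (1 / 2) ^ k * \<omega> k powr (- (1 / m)) \<le> c * \<rho> ^ k" and \<rho>: "0 \<le> \<rho>" "\<rho> < 1" and c: "0 \<le> c"
    and x: "\<And>k. 0 \<le> x k" "\<And>k. x k \<le> b" "\<And>k. x k \<le> N / \<omega> k"
    and pos: "0 < b" "0 < N" "\<And>k. 0 < \<omega> k" "0 < p" "p \<le> m"
  shows "(\<Sum>k<M. (1 / 2) ^ k * x k powr (1 / p)) \<le> c / (1 - \<rho>) * (N powr (1 / m) * b powr (1 / p - 1 / m))"
proof -
  define A where "A = N powr (1 / m) * b powr (1 / p - 1 / m)"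
  have A: "A \<ge> 0" unfolding A_def by (intro mult_nonneg_nonneg) simp_all
  have "(\<Sum>k<M. (1 / 2) ^ k * x k powr (1 / p)) \<le> (\<Sum>k<M. A * c * \<rho> ^ k)"
  proof (rule sum_mono)
    fix k
    have "(1 / 2) ^ k * x k powr (1 / p) \<le> (1 / 2) ^ k * (b powr (1 / p - 1 / m) * N powr (1 / m) * \<omega> k powr (- (1 / m)))"
      using x pos by (intro mult_left_mono powr_interpolate) auto
    also have "\<dots> = A * ((1 / 2) ^ k * \<omega> k powr (- (1 / m)))" by (simp add: A_def)
    also have "\<dots> \<le> A * (c * \<rho> ^ k)" by (intro mult_left_mono geo A)
    finally show "(1 / 2) ^ k * x k powr (1 / p) \<le> A * c * \<rho> ^ k" by (simp add: mult.assoc)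
  qed
  also have "\<dots> = A * c * (\<Sum>k<M. \<rho> ^ k)" by (simp add: sum_distrib_left)
  also have "\<dots> \<le> A * c * (1 / (1 - \<rho>))" using A c \<rho> by (intro mult_left_mono sum_geometric_le) auto
  finally show ?thesis by (simp add: A_def mult_ac)
qed

text \<open>The plain bound lets \<open>\<omega>\<close> lose a factor
  \<open>\<alpha> powr q\<close> per generation, with \<open>\<alpha> = (1 / 2) ^ d\<close>. A test
  function with value 1 on the child and a small \<open>t\<close> elsewhere does better: its mean
  gains a multiple of \<open>t\<close>, while the cost \<open>t powr q\<close> is of higher order
  because \<open>q > 1\<close>. The gain is strict and survives a factor \<open>K\<close> slightly
  above 1.\<close>

lemma dyadic_growth_improved:
  assumes d: "0 < d" and q: "1 < q"
  obtains K1 \<beta> where "1 < K1" "((1 / 2) ^ d) powr q < \<beta>" "\<beta> \<le> 1"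
    "\<And>K \<omega> k. dyadic_growth d q K \<omega> \<Longrightarrow> 1 \<le> K \<Longrightarrow> K \<le> K1 \<Longrightarrow> \<beta> ^ k \<le> \<omega> k"
proof -
  define \<alpha> :: real where "\<alpha> = (1 / 2) ^ d"
  have \<alpha>: "0 < \<alpha>" "\<alpha> < 1" using d by (auto simp: \<alpha>_def intro: power_Suc_less_one power_less_one_iff[THEN iffD2])
  \<comment> \<open>A lower bound for the gain per unit of \<open>t\<close>:
    \<open>\<alpha> powr q + \<gamma> * t\<close> is at most
    \<open>(\<alpha> + t * (1 - \<alpha>)) powr q\<close>.\<close>
  define \<gamma> where "\<gamma> = \<alpha> powr (q - 1) * (1 - \<alpha>)"
  have \<gamma>: "0 < \<gamma>" "\<gamma> < 1"
  proof -
    show "0 < \<gamma>" using \<alpha> by (simp add: \<gamma>_def)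
    have "\<alpha> powr (q - 1) * (1 - \<alpha>) \<le> 1 * (1 - \<alpha>)" using \<alpha> q by (intro mult_right_mono powr_le1) auto
    also have "1 * (1 - \<alpha>) < 1" using \<alpha> by simp
    finally show "\<gamma> < 1" by (simp only: \<gamma>_def)
  qed
  \<comment> \<open>Solves \<open>t powr (q - 1) = \<gamma> / 2\<close>, so that the cost is half of
    the gain.\<close>
  define t where "t = (\<gamma> / 2) powr (1 / (q - 1))"
  have t: "0 < t" "t \<le> 1" using \<gamma> q by (auto simp: t_def intro!: powr_le1)
  have tq: "t powr q < \<gamma> * t"
  proof -
    have "t powr q = t powr (q - 1) * t" using t by (simp add: powr_diff)
    also have "t powr (q - 1) = \<gamma> / 2" using \<gamma> q by (simp add: t_def powr_powr)
    also have "\<gamma> / 2 * t < \<gamma> * t" using \<gamma> t by (intro mult_strict_right_mono) auto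
    finally show ?thesis .
  qed
  define y where "y = \<alpha> + t * (1 - \<alpha>)"
  have "t * (1 - \<alpha>) \<le> 1 * (1 - \<alpha>)" using \<alpha> t by (intro mult_right_mono) auto
  then have "y \<le> 1" by (simp add: y_def algebra_simps)
  moreover have "\<alpha> \<le> y" using \<alpha> t by (simp add: y_def)
  ultimately have y: "\<alpha> \<le> y" "y \<le> 1" by auto
  define X where "X = y powr q"
  have X1: "X \<le> 1" using y \<alpha> q by (auto simp: X_def intro!: powr_le1)
  have "\<alpha> powr q + \<gamma> * t = \<alpha> powr (q - 1) * y"
    using \<alpha> by (simp add: \<gamma>_def y_def powr_diff field_simps)
  also have "\<dots> \<le> y powr (q - 1) * y" using y \<alpha> q by (intro mult_right_mono powr_mono2) auto
  also have "\<dots> = X" using y \<alpha> by (simp add: X_def powr_diff)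
  finally have X: "\<alpha> powr q + t powr q < X" using tq by simp
  \<comment> \<open>The midpoint between \<open>\<alpha> powr q\<close> and
    \<open>X - t powr q\<close>. \<open>K1\<close> is then the value of \<open>K\<close> at which
    the tested inequality yields exactly the factor \<open>\<beta>\<close>.\<close>
  define \<beta> where "\<beta> = (\<alpha> powr q + X - t powr q) / 2"
  define K1 where "K1 = X / (t powr q + \<beta>)"
  have \<beta>1: "\<alpha> powr q < \<beta>" and \<beta>2: "\<beta> < X - t powr q" unfolding \<beta>_def using X by auto
  have \<beta>0: "0 < \<beta>" using \<beta>1 \<alpha> by (smt (verit) powr_gt_zero)
  have tq0: "0 < t powr q" using t by simp
  show ?thesis
  proof (rule that[of K1 \<beta>])
    show "1 < K1" unfolding K1_def using \<beta>0 \<beta>2 tq0 by (subst less_divide_eq_1_pos) linarith+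
    show "((1 / 2) ^ d) powr q < \<beta>" using \<beta>1 by (simp add: \<alpha>_def)
    show "\<beta> \<le> 1" using \<beta>2 X1 tq0 by linarith
    show "\<beta> ^ k \<le> \<omega> k" if g: "dyadic_growth d q K \<omega>" and K: "1 \<le> K" "K \<le> K1" for K \<omega> k
    proof (induction k)
      case 0
      then show ?case using g by (simp add: dyadic_growth_def)
    next
      case (Suc k)
      have w: "0 < \<omega> k" "0 < \<omega> (Suc k)" using g by (auto simp: dyadic_growth_def)
      have "(1 * \<alpha> + t * (1 - \<alpha>)) powr q * \<omega> k \<le> K * (1 powr q * \<omega> (Suc k) + t powr q * (\<omega> k - \<omega> (Suc k)))"
        using g t unfolding dyadic_growth_def \<alpha>_def by (metis less_imp_le zero_le_one)
      also have "\<dots> \<le> K1 * (1 powr q * \<omega> (Suc k) + t powr q * \<omega> k)"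
      proof (rule mult_mono[OF K(2)])
        have "\<omega> (Suc k) \<le> \<omega> k" using g by (simp add: dyadic_growth_def)
        then show "0 \<le> 1 powr q * \<omega> (Suc k) + t powr q * (\<omega> k - \<omega> (Suc k))"
          using w tq0 by (intro add_nonneg_nonneg mult_nonneg_nonneg) auto
        show "1 powr q * \<omega> (Suc k) + t powr q * (\<omega> k - \<omega> (Suc k)) \<le> 1 powr q * \<omega> (Suc k) + t powr q * \<omega> k"
          using w tq0 by (intro add_left_mono mult_left_mono) auto
      qed (use K in auto)
      finally have "X * \<omega> k \<le> K1 * (\<omega> (Suc k) + t powr q * \<omega> k)"
        by (simp add: X_def y_def)
      moreover have "X = K1 * (t powr q + \<beta>)"
      proof -
        have "t powr q + \<beta> \<noteq> 0" using \<beta>0 tq0 by linarith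
        then show ?thesis by (simp add: K1_def)
      qed
      ultimately have "K1 * ((t powr q + \<beta>) * \<omega> k) \<le> K1 * (\<omega> (Suc k) + t powr q * \<omega> k)" by (simp add: mult.assoc)
      then have "(t powr q + \<beta>) * \<omega> k \<le> \<omega> (Suc k) + t powr q * \<omega> k"
        using K by (subst (asm) mult_le_cancel_left_pos) auto
      then have "\<beta> * \<omega> k \<le> \<omega> (Suc k)" by (simp add: algebra_simps)
      moreover have "\<beta> * \<beta> ^ k \<le> \<beta> * \<omega> k" using Suc \<beta>0 by (intro mult_left_mono) auto
      ultimately show ?case by simp
    qed
  qed
qed

text \<open>\<open>x k\<close> will be the ratio of energy to weight on the cell of generation
  \<open>k\<close>, \<open>N\<close> the same ratio on \<open>R\<close>, and \<open>b\<close> the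
  stopping level; the exponent of \<open>b\<close> is the inverse of the target exponent.
  \<open>C\<close> stands outside all quantifiers, which makes the final constant independent of the
  weight.\<close>

definition dyadic_sum_bound :: "nat \<Rightarrow> real \<Rightarrow> real \<Rightarrow> real \<Rightarrow> real \<Rightarrow> bool" where
  "dyadic_sum_bound d q p K C \<longleftrightarrow>
    (\<forall>m \<omega> x b N M. m = real d * (q + ln K) \<longrightarrow> p < m \<longrightarrow> dyadic_growth d q K \<omega> \<longrightarrow> 0 < b \<longrightarrow> 0 < N \<longrightarrow>
      (\<forall>k. 0 \<le> x k \<and> x k \<le> b \<and> x k \<le> N / \<omega> k) \<longrightarrow>
      (\<Sum>k<M. (1 / 2) ^ k * x k powr (1 / p)) \<le> C * (N powr (1 / m) * b powr (1 / p - 1 / m)))"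

lemma dyadic_sum_boundD:
  assumes "dyadic_sum_bound d q p K C" "m = real d * (q + ln K)" "p < m" "dyadic_growth d q K \<omega>" "0 < b" "0 < N"
    and "\<And>k. 0 \<le> x k" "\<And>k. x k \<le> b" "\<And>k. x k \<le> N / \<omega> k"
  shows "(\<Sum>k<M. (1 / 2) ^ k * x k powr (1 / p)) \<le> C * (N powr (1 / m) * b powr (1 / p - 1 / m))"
  using assms(1)[unfolded dyadic_sum_bound_def, rule_format, OF assms(2-6), of x M] assms(7-9) by simp

lemma dyadic_sum_bound_mono: "dyadic_sum_bound d q p K C \<Longrightarrow> C \<le> C' \<Longrightarrow> dyadic_sum_bound d q p K C'"
  unfolding dyadic_sum_bound_def
  by (smt (verit) mult_right_mono mult_nonneg_nonneg powr_ge_zero)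

text \<open>\<open>ln K / (q + ln K)\<close> increases with \<open>K\<close>, so the gain at
  \<open>K1\<close> serves all larger \<open>K\<close> and the ratio of the series stays away from
  1.\<close>

lemma dyadic_sum_bound_large:
  fixes p :: real
  assumes d: "0 < d" and q: "1 \<le> q" and p: "0 < p" and K1: "1 < K1"
  shows "\<exists>C>0. \<forall>K\<ge>K1. dyadic_sum_bound d q p K C"
proof -
  define \<theta> where "\<theta> = ln K1 / (q + ln K1)"
  have \<theta>: "0 < \<theta>" using q K1 by (auto simp: \<theta>_def intro!: divide_pos_pos add_pos_pos)
  define \<rho> where "\<rho> = 2 powr (- \<theta>)"
  have \<rho>: "0 < \<rho>" "\<rho> < 1" using \<theta> by (auto simp: \<rho>_def powr_less_one)
  have "dyadic_sum_bound d q p K (exp (1 / d) / (1 - \<rho>))" if K: "K \<ge> K1" for K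
    unfolding dyadic_sum_bound_def
  proof (intro allI impI)
    fix m \<omega> x b N M
    assume H: "m = real d * (q + ln K)" "p < m" and g: "dyadic_growth d q K \<omega>" and bN: "0 < b" "0 < N"
      and x: "\<forall>k. 0 \<le> x k \<and> x k \<le> b \<and> x k \<le> N / \<omega> k"
    have L: "ln K1 \<le> ln K" "0 < ln K1" using K K1 by auto
    have "\<theta> \<le> ln K / (q + ln K)" using L q by (simp add: \<theta>_def field_simps)
    then have *: "(2 powr (- (ln K / (q + ln K)))) ^ k \<le> \<rho> ^ k" for k
      unfolding \<rho>_def by (intro power_mono powr_mono) auto
    have geo: "(1 / 2) ^ k * \<omega> k powr (- (1 / m)) \<le> exp (1 / d) * \<rho> ^ k" for k
      by (rule order_trans[OF dyadic_growth_lower[OF g d q _ H(1)] mult_left_mono[OF *]]) (use K K1 in auto)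
    show "(\<Sum>k<M. (1 / 2) ^ k * x k powr (1 / p)) \<le> exp (1 / d) / (1 - \<rho>) * (N powr (1 / m) * b powr (1 / p - 1 / m))"
      by (rule dyadic_sum_le_of_geometric[where \<omega> = \<omega>, OF geo]) (use \<rho> x bN p H g in \<open>auto simp: dyadic_growth_def\<close>)
  qed
  moreover have "exp (1 / d) / (1 - \<rho>) > 0" using \<rho> by simp
  ultimately show ?thesis by blast
qed

text \<open>Here \<open>m\<close> is at least \<open>d * q\<close>, and \<open>\<beta>\<close>
  exceeds 2 to the power \<open>- (d * q)\<close>. That is exactly the condition for
  \<open>\<beta> powr (- (1 / (d * q)))\<close> to be less than 2, hence for a convergent geometric
  series whose ratio does not involve \<open>K\<close>.\<close>

lemma dyadic_sum_bound_small:
  assumes d: "0 < d" and q: "1 < q" and p: "0 < p"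
  shows "\<exists>K1>1. \<exists>C>0. \<forall>K. 1 \<le> K \<longrightarrow> K \<le> K1 \<longrightarrow> dyadic_sum_bound d q p K C"
proof -
  obtain K1 \<beta> where K1: "1 < K1" and \<beta>: "((1 / 2) ^ d) powr q < \<beta>" "\<beta> \<le> 1" and
    low: "\<And>K \<omega> k. dyadic_growth d q K \<omega> \<Longrightarrow> 1 \<le> K \<Longrightarrow> K \<le> K1 \<Longrightarrow> \<beta> ^ k \<le> \<omega> k"
    using dyadic_growth_improved[OF d q] by metis
  have \<beta>0: "0 < \<beta>" using \<beta>(1) by (smt (verit) powr_ge_zero)
  define \<rho> where "\<rho> = 1 / 2 * \<beta> powr (- (1 / (d * q)))"
  have \<rho>0: "0 < \<rho>" using \<beta>0 by (simp add: \<rho>_def)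
  have "\<beta> powr (- (1 / (d * q))) < (((1 / 2) ^ d) powr q) powr (- (1 / (d * q)))"
    using \<beta> \<beta>0 d q by (intro powr_less_mono2_neg) auto
  also have "\<dots> = 2" using d q by (simp add: half_power_powr powr_powr)
  finally have \<rho>1: "\<rho> < 1" by (simp add: \<rho>_def)
  have "dyadic_sum_bound d q p K (1 / (1 - \<rho>))" if K: "1 \<le> K" "K \<le> K1" for K
    unfolding dyadic_sum_bound_def
  proof (intro allI impI)
    fix m \<omega> x b N M
    assume H: "m = real d * (q + ln K)" "p < m" and g: "dyadic_growth d q K \<omega>" and bN: "0 < b" "0 < N"
      and x: "\<forall>k. 0 \<le> x k \<and> x k \<le> b \<and> x k \<le> N / \<omega> k"
    have m: "d * q \<le> m" "0 < d * q" unfolding H(1) using K d q by (auto intro: mult_left_mono)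
    have geo: "(1 / 2) ^ k * \<omega> k powr (- (1 / m)) \<le> 1 * \<rho> ^ k" for k
    proof -
      have "\<omega> k powr (- (1 / m)) \<le> (\<beta> ^ k) powr (- (1 / m))"
        using low[OF g K, of k] \<beta>0 m by (intro powr_mono2') auto
      also have "\<dots> \<le> (\<beta> ^ k) powr (- (1 / (d * q)))"
      proof (intro powr_mono')
        show "- (1 / (d * q)) \<le> - (1 / m)" using m by (auto intro!: divide_left_mono mult_pos_pos)
      qed (use \<beta>0 \<beta>(2) in \<open>auto simp: power_le_one\<close>)
      also have "\<dots> = (\<beta> powr (- (1 / (d * q)))) ^ k"
        using \<beta>0 by (simp add: powr_powr mult.commute flip: powr_realpow)
      finally show ?thesis by (simp add: \<rho>_def power_mult_distrib power_one_over power_divide divide_right_mono)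
    qed
    show "(\<Sum>k<M. (1 / 2) ^ k * x k powr (1 / p)) \<le> 1 / (1 - \<rho>) * (N powr (1 / m) * b powr (1 / p - 1 / m))"
      by (rule dyadic_sum_le_of_geometric[where \<omega> = \<omega>, OF geo]) (use \<rho>0 \<rho>1 x bN p H g in \<open>auto simp: dyadic_growth_def\<close>)
  qed
  moreover have "1 / (1 - \<rho>) > 0" using \<rho>1 by simp
  ultimately show ?thesis using K1 by blast
qed

text \<open>Hedberg's argument: for \<open>K\<close> close to 1 and \<open>q = 1\<close> the sum in \<open>k\<close> is controlled from both
  ends by the geometric decay of \<open>\<omega>\<close>.\<close>

lemma dyadic_sum_bound_A1:
  fixes p :: real
  assumes d: "0 < d" and p: "0 < p" "p < d"
  shows "\<exists>C>0. \<forall>K. 1 \<le> K \<longrightarrow> K \<le> 2 \<longrightarrow> dyadic_sum_bound d 1 p K C"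
proof -
  \<comment> \<open>For \<open>q = 1\<close> and \<open>K \<le> 2\<close> one has
    \<open>d \<le> m \<le> 2 * d\<close>, because \<open>ln K \<le> 1\<close>. The two entries bound
    \<open>1 / m\<close> and \<open>1 / p - 1 / m\<close> from below; the second is positive because
    \<open>p < d\<close>.\<close>
  define \<gamma> where "\<gamma> = min (1 / (2 * real d)) (1 / p - 1 / d)"
  have \<gamma>: "0 < \<gamma>" using d p by (auto simp: \<gamma>_def field_simps)
  define r where "r = (3 / 4 :: real) powr \<gamma>"
  have r: "0 < r" "r < 1" using \<gamma> powr_less_mono2[of \<gamma> "3/4" 1] by (auto simp: r_def)
  have "dyadic_sum_bound d 1 p K (exp (1 / d) * (2 / (1 - r)))" if K: "1 \<le> K" "K \<le> 2" for K
    unfolding dyadic_sum_bound_def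
  proof (intro allI impI)
    fix m \<omega> x b N M
    assume H: "m = real d * (1 + ln K)" "p < m" and g: "dyadic_growth d 1 K \<omega>" and bN: "0 < b" "0 < N"
      and x: "\<forall>k. 0 \<le> x k \<and> x k \<le> b \<and> x k \<le> N / \<omega> k"
    have lnK: "0 \<le> ln K" "ln K \<le> 1" using K ln_le_minus_one[of K] by auto
    have m: "d \<le> m" "m \<le> 2 * d" "0 < m" unfolding H(1)
      using lnK d mult_left_mono[of "ln K" 1 "real d"] by (auto simp: algebra_simps add_pos_nonneg)
    have im: "\<gamma> \<le> 1 / m" "\<gamma> \<le> 1 / p - 1 / m"
    proof -
      have "1 / (2 * real d) \<le> 1 / m" using m d by (intro divide_left_mono) auto
      then show "\<gamma> \<le> 1 / m" by (simp add: \<gamma>_def)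
      have "1 / m \<le> 1 / real d" using m d by (intro divide_left_mono) auto
      then show "\<gamma> \<le> 1 / p - 1 / m" by (simp add: \<gamma>_def)
    qed
    have w: "0 < \<omega> k" for k using g by (simp add: dyadic_growth_def)
    \<comment> \<open>The test function is 0 on the child and 1 on the rest of the parent. With
      \<open>K \<le> 2\<close> and a child of at most half the volume, at least a quarter of the
      weight lies outside the child.\<close>
    have dec: "\<omega> (Suc k) \<le> 3 / 4 * \<omega> k" for k
    proof -
      have "(0 * (1 / 2) ^ d + 1 * (1 - (1 / 2) ^ d)) powr 1 * \<omega> k
        \<le> K * (0 powr 1 * \<omega> (Suc k) + 1 powr 1 * (\<omega> k - \<omega> (Suc k)))"
        using g unfolding dyadic_growth_def by (metis order_refl zero_le_one)
      moreover have "(1 / 2 :: real) ^ d \<le> 1 / 2" using d power_decreasing[of 1 d "1/2::real"] by simp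
      ultimately have "(1 - (1 / 2) ^ d) * \<omega> k \<le> K * (\<omega> k - \<omega> (Suc k))"
        by (simp split: if_splits)
      moreover have "1 / 2 * \<omega> k \<le> (1 - (1 / 2) ^ d) * \<omega> k"
        using w[of k] \<open>(1 / 2 :: real) ^ d \<le> 1 / 2\<close> by (intro mult_right_mono) auto
      moreover have "K * (\<omega> k - \<omega> (Suc k)) \<le> 2 * (\<omega> k - \<omega> (Suc k))"
        using K g by (intro mult_right_mono) (auto simp: dyadic_growth_def)
      ultimately show ?thesis by simp
    qed
    define A where "A = N powr (1 / m) * b powr (1 / p - 1 / m)"
    have A: "A \<ge> 0" unfolding A_def by (intro mult_nonneg_nonneg) simp_all
    \<comment> \<open>\<open>\<omega> k * b / N\<close> compares the two available bounds
      \<open>b\<close> and \<open>N / \<omega> k\<close>; they agree where it equals 1.\<close>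
    define y where "y = (\<lambda>k. (\<omega> k * b / N) powr \<gamma>)"
    have z: "0 < \<omega> k * b / N" for k using w bN by simp
    have trm: "(1 / 2) ^ k * x k powr (1 / p) \<le> exp (1 / d) * A * min (y k) (1 / y k)" for k
    proof -
      have "(1 / 2) ^ k * \<omega> k powr (- (1 / m)) \<le> exp (1 / d) * (2 powr (- (ln K / (1 + ln K)))) ^ k"
        by (rule dyadic_growth_lower[OF g d _ _ H(1)]) (use K in auto)
      also have "\<dots> \<le> exp (1 / d) * 1"
      proof (intro mult_left_mono power_le_one)
        show "2 powr (- (ln K / (1 + ln K))) \<le> 1"
          using powr_mono[of "- (ln K / (1 + ln K))" 0 "2::real"] lnK by simp
      qed simp_all
      finally have "(1 / 2) ^ k \<le> exp (1 / d) * \<omega> k powr (1 / m)"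
        using w[of k] by (simp add: powr_minus_divide field_simps)
      then have "(1 / 2) ^ k * x k powr (1 / p) \<le> exp (1 / d) * (\<omega> k powr (1 / m) * x k powr (1 / p))"
        unfolding mult.assoc[symmetric] by (intro mult_right_mono) auto
      also have "\<omega> k powr (1 / m) * x k powr (1 / p) \<le> A * min ((\<omega> k * b / N) powr (1 / m)) ((\<omega> k * b / N) powr (- (1 / p - 1 / m)))"
      proof -
        have "\<omega> k powr (1 / m) * x k powr (1 / p) \<le> \<omega> k powr (1 / m) * b powr (1 / p)"
          using x p by (intro mult_left_mono powr_mono2) auto
        also have "\<dots> = A * (\<omega> k * b / N) powr (1 / m)"
          using bN w[of k] by (simp add: A_def powr_divide powr_mult powr_diff)
        finally have 1: "\<omega> k powr (1 / m) * x k powr (1 / p) \<le> A * (\<omega> k * b / N) powr (1 / m)" .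
        have "\<omega> k powr (1 / m) * x k powr (1 / p) \<le> \<omega> k powr (1 / m) * (N / \<omega> k) powr (1 / p)"
          using x p by (intro mult_left_mono powr_mono2) auto
        also have "\<dots> = A * (\<omega> k * b / N) powr (- (1 / p - 1 / m))"
          using bN w[of k] by (simp add: A_def powr_divide powr_mult powr_diff powr_minus_divide)
        finally show ?thesis using 1 A by (simp add: min_def)
      qed
      also have "A * min ((\<omega> k * b / N) powr (1 / m)) ((\<omega> k * b / N) powr (- (1 / p - 1 / m))) \<le> A * min (y k) (1 / y k)"
        unfolding y_def by (intro mult_left_mono min_powr_le z \<gamma> im A)
      finally show ?thesis by (simp add: mult.assoc mult_left_mono)
    qed
    have "(\<Sum>k<M. (1 / 2) ^ k * x k powr (1 / p)) \<le> (\<Sum>k<M. exp (1 / d) * A * min (y k) (1 / y k))"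
      by (intro sum_mono trm)
    also have "\<dots> = exp (1 / d) * A * (\<Sum>k<M. min (y k) (1 / y k))" by (simp add: sum_distrib_left)
    also have "\<dots> \<le> exp (1 / d) * A * (2 / (1 - r))"
    proof (intro mult_left_mono sum_min_inverse_le)
      fix k
      show "0 < y k" using w[of k] bN by (simp add: y_def)
      have "\<omega> (Suc k) * b / N \<le> 3 / 4 * (\<omega> k * b / N)"
        using mult_right_mono[OF dec[of k], of "b / N"] bN by simp
      then have "y (Suc k) \<le> (3 / 4 * (\<omega> k * b / N)) powr \<gamma>"
        unfolding y_def using z[of "Suc k"] \<gamma> by (intro powr_mono2) auto
      also have "\<dots> = r * y k" unfolding y_def r_def by (rule powr_mult)
      finally show "y (Suc k) \<le> r * y k" .
    qed (use r A in auto)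
    finally show "(\<Sum>k<M. (1 / 2) ^ k * x k powr (1 / p)) \<le> exp (1 / d) * (2 / (1 - r)) * (N powr (1 / m) * b powr (1 / p - 1 / m))"
      by (simp add: A_def mult_ac)
  qed
  moreover have "exp (1 / d) * (2 / (1 - r)) > 0" using r by simp
  ultimately show ?thesis by blast
qed

text \<open>With \<open>q = 1\<close> and \<open>p = d\<close> no device for small \<open>K\<close>
  has a margin: \<open>1 / p - 1 / m\<close> tends to 0 as \<open>K\<close> tends to 1, and
  \<open>p < m\<close> holds for every \<open>K > 1\<close>.\<close>

theorem dyadic_sum_bound_uniform:
  fixes p :: real
  assumes d: "0 < d" and q: "1 \<le> q" "q \<le> p" and ex: "\<not> (q = 1 \<and> p = real d)"
  shows "\<exists>C>0. \<forall>K\<ge>1. dyadic_sum_bound d q p K C"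
proof -
  have p: "0 < p" using q by simp
  obtain K1 C1 where K1: "1 < K1" "0 < C1" "\<And>K. 1 \<le> K \<Longrightarrow> K \<le> K1 \<Longrightarrow> dyadic_sum_bound d q p K C1"
  proof (cases "q = 1")
    case False
    then show ?thesis using dyadic_sum_bound_small[OF d _ p] q that by (metis order_le_imp_less_or_eq)
  next
    case True
    show ?thesis
    proof (cases "p < d")
      case True
      then show ?thesis using dyadic_sum_bound_A1[OF d p True] \<open>q = 1\<close> that[of 2] by auto
    next
      case False
      with ex True have pd: "d < p" by linarith
      \<comment> \<open>The value of \<open>K\<close> with \<open>m = p\<close>. Up to it the
        condition \<open>p < m\<close> fails and the bound holds vacuously.\<close>
      define K1 where "K1 = exp (p / d - 1)"
      have "1 < K1" using pd d by (simp add: K1_def)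
      moreover have "dyadic_sum_bound d q p K 1" if "1 \<le> K" "K \<le> K1" for K
      proof -
        have "ln K \<le> p / d - 1" using that by (metis K1_def ln_exp ln_mono exp_gt_zero less_le_trans zero_less_one)
        then have "real d * (q + ln K) \<le> p" using True d by (simp add: field_simps)
        then show ?thesis by (simp add: dyadic_sum_bound_def)
      qed
      ultimately show ?thesis using that[of K1 1] by auto
    qed
  qed
  obtain C2 where C2: "0 < C2" "\<And>K. K1 \<le> K \<Longrightarrow> dyadic_sum_bound d q p K C2"
    using dyadic_sum_bound_large[OF d q(1) p K1(1)] by auto
  show ?thesis
  proof (intro exI[of _ "max C1 C2"] conjI allI impI)
    fix K :: real assume "1 \<le> K"
    then show "dyadic_sum_bound d q p K (max C1 C2)"
      using K1(3)[of K] C2(2)[of K] by (cases "K \<le> K1") (auto elim!: dyadic_sum_bound_mono)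
  qed (use K1 in auto)
qed

section \<open>Dyadic cells\<close>

lemma floor_half:
  fixes u :: real
  shows "\<lfloor>u\<rfloor> = \<lfloor>2 * u\<rfloor> div 2"
proof -
  have "\<lfloor>(2 * u) / of_int 2\<rfloor> = \<lfloor>2 * u\<rfloor> div 2" by (rule floor_divide_real_eq_div) simp
  then show ?thesis by simp
qed

locale dyadic_rectangle =
  fixes S :: "'n::finite set" and a :: "real ^ 'n" and l1 l2 :: real
  assumes l1: "0 < l1" and l2: "0 < l2"
begin

definition L :: "'n \<Rightarrow> real" where "L i = (if i \<in> S then l1 else l2)"

definition idx :: "nat \<Rightarrow> real ^ 'n \<Rightarrow> 'n \<Rightarrow> int" where
  "idx k x i = \<lfloor>2 ^ k * ((x $ i - a $ i) / L i)\<rfloor>"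

text \<open>Cells are named by a point they contain, which spares an index set. They are half-open,
  so that those of one generation partition the space and any two cells are nested or disjoint. The
  closed version \<open>ccell\<close> is needed because the weight constants are defined by closed
  rectangles.\<close>

definition cell :: "nat \<Rightarrow> real ^ 'n \<Rightarrow> (real ^ 'n) set" where
  "cell k x = {y. \<forall>i. idx k y i = idx k x i}"

definition corner :: "nat \<Rightarrow> real ^ 'n \<Rightarrow> real ^ 'n" where
  "corner k x = (\<chi> i. a $ i + L i / 2 ^ k * idx k x i)"

definition ccell :: "nat \<Rightarrow> real ^ 'n \<Rightarrow> (real ^ 'n) set" where
  "ccell k x = rectangle S (corner k x) (l1 / 2 ^ k) (l2 / 2 ^ k)"

text \<open>The rectangle without its upper faces, that is, the cell of generation 0 containing
  \<open>a\<close>.\<close>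

definition root :: "(real ^ 'n) set" where
  "root = {x. \<forall>i. idx 0 x i = 0}"

lemma L_pos: "0 < L i" using l1 l2 by (simp add: L_def)

lemma L_nonneg: "0 \<le> L i" using L_pos[of i] by simp

lemma mem_cell_self: "x \<in> cell k x" by (simp add: cell_def)

lemma cell_eq: "y \<in> cell k x \<Longrightarrow> cell k y = cell k x" by (auto simp: cell_def)

lemma idx_Suc: "idx k x i = idx (Suc k) x i div 2"
  unfolding idx_def using floor_half[of "2 ^ k * ((x $ i - a $ i) / L i)"] by (simp add: mult.assoc)

lemma cell_Suc_subset: "cell (Suc k) x \<subseteq> cell k x"
  unfolding cell_def idx_Suc[of k] by auto

lemma cell_antimono: "j \<le> k \<Longrightarrow> cell k x \<subseteq> cell j x"
  proof (induction k)
  case (Suc k)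
  then show ?case using cell_Suc_subset[of k x] by (cases "j = Suc k") auto
qed simp

lemma idx_eq_iff: "idx k y i = j \<longleftrightarrow> a $ i + L i / 2 ^ k * j \<le> y $ i \<and> y $ i < a $ i + L i / 2 ^ k * j + L i / 2 ^ k"
proof -
  have "idx k y i = j \<longleftrightarrow> of_int j \<le> 2 ^ k * ((y $ i - a $ i) / L i) \<and> 2 ^ k * ((y $ i - a $ i) / L i) < of_int j + 1"
    unfolding idx_def by (rule floor_eq_iff)
  also have "\<dots> \<longleftrightarrow> a $ i + L i / 2 ^ k * j \<le> y $ i \<and> y $ i < a $ i + L i / 2 ^ k * j + L i / 2 ^ k"
  proof -
    define c where "c = L i / 2 ^ k"
    have c: "0 < c" using L_pos[of i] by (simp add: c_def)
    have "2 ^ k * ((y $ i - a $ i) / L i) = (y $ i - a $ i) / c" by (simp add: c_def)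
    then show ?thesis unfolding c_def[symmetric]
      using pos_le_divide_eq[OF c, of j "y $ i - a $ i"] pos_divide_less_eq[OF c, of "y $ i - a $ i" "j + 1"]
      by (auto simp: algebra_simps)
  qed
  finally show ?thesis .
qed

lemma ccell_eq_cbox: "ccell k x = cbox (corner k x) (\<chi> i. corner k x $ i + L i / 2 ^ k)"
  by (auto simp: ccell_def rectangle_def mem_box_cart L_def split: if_splits)

lemma mem_cell: "y \<in> cell k x \<longleftrightarrow> (\<forall>i. corner k x $ i \<le> y $ i \<and> y $ i < corner k x $ i + L i / 2 ^ k)"
  unfolding cell_def mem_Collect_eq idx_eq_iff corner_def by simp

lemma mem_ccell: "y \<in> ccell k x \<longleftrightarrow> (\<forall>i. corner k x $ i \<le> y $ i \<and> y $ i \<le> corner k x $ i + L i / 2 ^ k)"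
  by (auto simp: ccell_eq_cbox mem_box_cart)

lemma cell_subset_ccell: "cell k x \<subseteq> ccell k x"
proof
  fix y assume "y \<in> cell k x"
  then show "y \<in> ccell k x" unfolding mem_cell mem_ccell by (meson less_imp_le)
qed

lemma sets_cell [measurable]: "cell k x \<in> sets borel"
proof -
  have "cell k x = (\<Inter>i\<in>UNIV. {y. corner k x $ i \<le> y $ i} \<inter> {y. y $ i < corner k x $ i + L i / 2 ^ k})"
    by (auto simp: mem_cell)
  also have "\<dots> \<in> sets borel"
    by (intro sets.finite_INT sets.Int borel_closed borel_open closed_Collect_le open_Collect_less continuous_intros) simp_all
  finally show ?thesis .
qed

lemma sets_ccell [measurable]: "ccell k x \<in> sets borel"
  by (simp add: ccell_eq_cbox)

lemma AE_cell: "AE y in lborel. y \<in> cell k x \<longleftrightarrow> y \<in> ccell k x"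
proof -
  let ?b = "\<chi> i. corner k x $ i + L i / 2 ^ k"
  have "box (corner k x) ?b \<subseteq> cell k x"
  proof
    fix y assume "y \<in> box (corner k x) ?b"
    then have "\<forall>i. corner k x $ i < y $ i \<and> y $ i < corner k x $ i + L i / 2 ^ k"
      by (simp add: mem_box_cart)
    then show "y \<in> cell k x" unfolding mem_cell by (meson less_imp_le)
  qed
  moreover have "negligible (cbox (corner k x) ?b - box (corner k x) ?b)"
    by (rule negligible_frontier_interval)
  then have "cbox (corner k x) ?b - box (corner k x) ?b \<in> null_sets lebesgue"
    by (simp only: negligible_iff_null_sets)
  then have "AE y in lborel. y \<notin> cbox (corner k x) ?b - box (corner k x) ?b"
    using AE_not_in AE_completion_iff by blast
  ultimately show ?thesis
    using cell_subset_ccell[of k x] unfolding ccell_eq_cbox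
    by (elim eventually_mono) blast
qed

lemma nn_integral_cell: "(\<integral>\<^sup>+y\<in>cell k x. f y \<partial>lborel) = (\<integral>\<^sup>+y\<in>ccell k x. f y \<partial>lborel)"
proof (rule nn_integral_cong_AE)
  show "AE y in lborel. f y * indicator (cell k x) y = f y * indicator (ccell k x) y"
    using AE_cell[of k x] by eventually_elim (auto split: split_indicator)
qed

lemma ccell_rectangles: "ccell k x \<in> rectangles S"
  unfolding rectangles_def ccell_def mem_Collect_eq
  by (rule exI[of _ "corner k x"], rule exI[of _ "l1 / 2 ^ k"], rule exI[of _ "l2 / 2 ^ k"]) (simp add: l1 l2)

lemma ccell_Suc_subset: "ccell (Suc k) x \<subseteq> ccell k x"
proof
  fix y assume y: "y \<in> ccell (Suc k) x"
  show "y \<in> ccell k x" unfolding mem_ccell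
  proof
    fix i
    let ?j = "idx (Suc k) x i"
    define c where "c = L i / 2 ^ Suc k"
    have c: "0 < c" "L i / 2 ^ k = 2 * c" using L_pos[of i] by (auto simp: c_def)
    have j: "2 * (?j div 2) \<le> ?j" "?j \<le> 2 * (?j div 2) + 1" by linarith+
    have yi: "a $ i + c * ?j \<le> y $ i" "y $ i \<le> a $ i + c * ?j + c"
      using y by (auto simp: mem_ccell corner_def c_def)
    have 1: "c * real_of_int (2 * (?j div 2)) \<le> c * ?j"
      using c j by (intro mult_left_mono) linarith+
    have 2: "c * ?j \<le> c * real_of_int (2 * (?j div 2) + 1)"
      using c j by (intro mult_left_mono) linarith+
    show "corner k x $ i \<le> y $ i \<and> y $ i \<le> corner k x $ i + L i / 2 ^ k"
      using yi 1 2 by (simp only: corner_def vec_lambda_beta c(2) idx_Suc[of k]) (simp add: algebra_simps)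
  qed
qed

lemma measure_ccell: "measure lborel (ccell k x) = (1 / 2) ^ (k * CARD('n)) * (\<Prod>i\<in>UNIV. L i)"
proof -
  have "measure lborel (ccell k x) = (\<Prod>i\<in>UNIV. L i / 2 ^ k)"
  proof -
    have "cbox (corner k x) (\<chi> i. corner k x $ i + L i / 2 ^ k) \<noteq> {}"
      using L_pos by (auto simp: interval_eq_empty_cart not_less less_imp_le)
    then show ?thesis unfolding ccell_eq_cbox by (subst content_cbox_cart) auto
  qed
  also have "\<dots> = (\<Prod>i\<in>UNIV. (1 / 2) ^ k * L i)" by (simp add: power_one_over)
  also have "\<dots> = (1 / 2) ^ (k * CARD('n)) * (\<Prod>i\<in>UNIV. L i)"
    by (simp add: prod.distrib power_mult)
  finally show ?thesis .
qed

lemma root_cell: "x \<in> root \<Longrightarrow> cell 0 x = root"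
  by (auto simp: root_def cell_def)

lemma root_ccell: "x \<in> root \<Longrightarrow> ccell 0 x = rectangle S a l1 l2"
proof -
  assume "x \<in> root"
  then have "corner 0 x = a" by (auto simp: root_def corner_def vec_eq_iff)
  then show ?thesis by (simp add: ccell_def)
qed

lemma a_in_root: "a \<in> root" by (simp add: root_def idx_def)

lemma sets_root [measurable]: "root \<in> sets borel"
  using sets_cell[of 0 a] root_cell[OF a_in_root] by simp

lemma nn_integral_root: "(\<integral>\<^sup>+y\<in>root. f y \<partial>lborel) = (\<integral>\<^sup>+y\<in>rectangle S a l1 l2. f y \<partial>lborel)"
  using nn_integral_cell[where k = 0 and x = a and f = f] root_cell[OF a_in_root] root_ccell[OF a_in_root] by simp

lemma countable_cells: "countable (range (\<lambda>(k, x). cell k x))"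
proof -
  define F where "F = (\<lambda>(k, j :: int ^ 'n). {y. \<forall>i. idx k y i = j $ i})"
  have "cell k x = F (k, \<chi> i. idx k x i)" for k x
    by (simp add: cell_def F_def)
  then have "range (\<lambda>(k, x). cell k x) \<subseteq> range F" by auto
  then show ?thesis by (rule countable_subset) auto
qed

text \<open>The minimal generations \<open>k\<close> at which the hypothesis holds single out disjoint cells.\<close>

lemma dyadic_covering:
  assumes f[measurable]: "f \<in> borel_measurable lebesgue" and g[measurable]: "g \<in> borel_measurable lebesgue"
    and E: "E \<subseteq> root"
    and cov: "\<And>x. x \<in> E \<Longrightarrow> \<exists>k. (\<integral>\<^sup>+y\<in>ccell k x. f y \<partial>lborel) \<le> (\<integral>\<^sup>+y\<in>ccell k x. g y \<partial>lborel)"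
  shows "(\<integral>\<^sup>+y\<in>E. f y \<partial>lborel) \<le> (\<integral>\<^sup>+y\<in>rectangle S a l1 l2. g y \<partial>lborel)"
proof -
  define P where "P = (\<lambda>c. (\<integral>\<^sup>+y\<in>c. f y \<partial>lborel) \<le> (\<integral>\<^sup>+y\<in>c. g y \<partial>lborel))"
  have ex: "\<exists>k. P (cell k x)" if "x \<in> E" for x
    using cov[OF that] by (simp add: P_def nn_integral_cell)
  define \<kappa> where "\<kappa> = (\<lambda>x. LEAST k. P (cell k x))"
  have \<kappa>: "P (cell (\<kappa> x) x)" if "x \<in> E" for x
    unfolding \<kappa>_def using ex[OF that] by (rule LeastI_ex)
  define \<C> where "\<C> = (\<lambda>x. cell (\<kappa> x) x) ` E"
  have cnt: "countable \<C>"
    by (rule countable_subset[OF _ countable_cells]) (auto simp: \<C>_def)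
  \<comment> \<open>If two stopped cells meet, the one of smaller generation contains the other. The
    property then holds at that generation for both points, and minimality makes the generations
    equal.\<close>
  have same: "cell (\<kappa> x) x = cell (\<kappa> y) y"
    if xy: "x \<in> E" "y \<in> E" "\<kappa> x \<le> \<kappa> y" "z \<in> cell (\<kappa> x) x" "z \<in> cell (\<kappa> y) y" for x y z
  proof -
    have "y \<in> cell (\<kappa> y) z" using cell_eq[OF xy(5)] mem_cell_self by simp
    then have "y \<in> cell (\<kappa> x) z" using cell_antimono[OF xy(3)] by blast
    then have eq: "cell (\<kappa> x) y = cell (\<kappa> x) x" using cell_eq xy(4) by metis
    then have "P (cell (\<kappa> x) y)" using \<kappa>[OF xy(1)] by simp
    then have "\<kappa> y \<le> \<kappa> x" unfolding \<kappa>_def by (rule Least_le)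
    then show ?thesis using xy(3) eq by simp
  qed
  have disj: "disjoint_family_on (\<lambda>c. c) \<C>"
    unfolding disjoint_family_on_def
  proof (intro ballI impI)
    fix c c' assume c: "c \<in> \<C>" "c' \<in> \<C>" "c \<noteq> c'"
    then obtain x y where xy: "x \<in> E" "y \<in> E" "c = cell (\<kappa> x) x" "c' = cell (\<kappa> y) y"
      by (auto simp: \<C>_def)
    show "c \<inter> c' = {}"
    proof (rule ccontr)
      assume "c \<inter> c' \<noteq> {}"
      then obtain z where "z \<in> cell (\<kappa> x) x" "z \<in> cell (\<kappa> y) y" using xy by auto
      then have "c = c'" using same[of x y z] same[of y x z] xy by (metis linear)
      then show False using c by simp
    qed
  qed
  have meas: "c \<in> sets lebesgue" if "c \<in> \<C>" for c
    using that by (auto simp: \<C>_def)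
  \<comment> \<open>The integrands are only Lebesgue measurable, so additivity over cells is taken
    from \<open>lebesgue\<close>.\<close>
  have I: "(\<integral>\<^sup>+y\<in>A. h y \<partial>lborel) = emeasure (density lebesgue h) A"
    if "A \<in> sets lebesgue" "h \<in> borel_measurable lebesgue" for A h
    using that by (simp add: emeasure_density nn_integral_completion)
  have U: "\<Union>\<C> \<in> sets lebesgue" using cnt meas by (rule sets.countable_Union[OF _ subsetI]) auto
  have "(\<integral>\<^sup>+y\<in>E. f y \<partial>lborel) \<le> (\<integral>\<^sup>+y\<in>\<Union>\<C>. f y \<partial>lborel)"
    using mem_cell_self by (intro nn_integral_mono) (auto simp: \<C>_def split: split_indicator)
  also have "\<dots> = emeasure (density lebesgue f) (\<Union>c\<in>\<C>. c)" using U f by (simp add: I)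
  also have "\<dots> = (\<integral>\<^sup>+c. emeasure (density lebesgue f) c \<partial>count_space \<C>)"
    by (rule emeasure_UN_countable) (use meas cnt disj in auto)
  also have "\<dots> \<le> (\<integral>\<^sup>+c. emeasure (density lebesgue g) c \<partial>count_space \<C>)"
  proof (rule nn_integral_mono)
    fix c assume "c \<in> space (count_space \<C>)"
    then have c: "c \<in> \<C>" by simp
    then have "P c" using \<kappa> by (auto simp: \<C>_def)
    then show "emeasure (density lebesgue f) c \<le> emeasure (density lebesgue g) c"
      using meas[OF c] f g by (simp add: P_def I)
  qed
  also have "\<dots> = emeasure (density lebesgue g) (\<Union>c\<in>\<C>. c)"
    by (rule emeasure_UN_countable[symmetric]) (use meas cnt disj in auto)
  also have "\<dots> = (\<integral>\<^sup>+y\<in>\<Union>\<C>. g y \<partial>lborel)" using U g by (simp add: I)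
  also have "\<dots> \<le> (\<integral>\<^sup>+y\<in>root. g y \<partial>lborel)"
  proof -
    have "cell k x \<subseteq> root" if "x \<in> E" for k x
      using cell_antimono[of 0 k x] root_cell[of x] E that by auto
    then have "\<Union>\<C> \<subseteq> root" by (auto simp: \<C>_def)
    then show ?thesis by (intro nn_integral_mono) (auto split: split_indicator)
  qed
  finally show ?thesis by (simp add: nn_integral_root)
qed

lemma mem_ccell_dist:
  assumes "y \<in> ccell k x" shows "norm (y - x) \<le> (\<Sum>i\<in>UNIV. L i) * (1 / 2) ^ k"
proof -
  have x: "x \<in> ccell k x" using cell_subset_ccell mem_cell_self by blast
  have "\<bar>(y - x) $ i\<bar> \<le> L i * (1 / 2) ^ k" for i
    using assms[unfolded mem_ccell, rule_format, of i] x[unfolded mem_ccell, rule_format, of i]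
    by (simp add: power_one_over abs_le_iff)
  then have "(\<Sum>i\<in>UNIV. \<bar>(y - x) $ i\<bar>) \<le> (\<Sum>i\<in>UNIV. L i * (1 / 2) ^ k)" by (rule sum_mono)
  then show ?thesis using norm_le_l1_cart[of "y - x"] by (simp add: sum_distrib_right)
qed

end

section \<open>Averages over cells\<close>

text \<open>\<open>enn2real\<close> sends an infinite integral to 0, so finiteness has to be shown
  separately wherever \<open>lint\<close> is to represent the integral. Integrating a merely
  Lebesgue measurable function over \<open>lborel\<close> is sound because completion does not
  change the nonnegative integral.\<close>

definition lint :: "'a::euclidean_space set \<Rightarrow> ('a \<Rightarrow> real) \<Rightarrow> real" where
  "lint A f = enn2real (\<integral>\<^sup>+x\<in>A. ennreal (f x) \<partial>lborel)"

lemma lint_nonneg: "0 \<le> lint A f" by (simp add: lint_def)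

lemma lint_mono:
  assumes "(\<integral>\<^sup>+x\<in>B. ennreal (g x) \<partial>lborel) < \<infinity>" "\<And>x. x \<in> A \<Longrightarrow> x \<in> B \<and> f x \<le> g x"
  shows "lint A f \<le> lint B g"
  unfolding lint_def using assms
  by (intro enn2real_mono nn_integral_mono) (auto split: split_indicator intro: ennreal_leI)

lemma weighted_finite:
  assumes w: "weight w" and Q: "compact Q" "A \<subseteq> Q" and g: "\<And>x. 0 \<le> g x" "\<And>x. g x \<le> B"
  shows "(\<integral>\<^sup>+x\<in>A. ennreal (g x * w x) \<partial>lborel) < \<infinity>"
proof -
  have B: "0 \<le> B" using g order_trans by blast
  have wn: "0 \<le> w x" for x using w by (simp add: weight_def)
  have [measurable]: "w \<in> borel_measurable lebesgue" by (rule weight_measurable[OF w])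
  have [measurable]: "Q \<in> sets lebesgue" using Q(1) by (simp add: borel_compact)
  have "(\<integral>\<^sup>+x\<in>A. ennreal (g x * w x) \<partial>lborel) \<le> (\<integral>\<^sup>+x. ennreal B * (ennreal (w x) * indicator Q x) \<partial>lebesgue)"
    unfolding nn_integral_completion
    using Q(2) g(2) wn B
    by (intro nn_integral_mono) (auto split: split_indicator simp flip: ennreal_mult intro!: ennreal_leI mult_right_mono)
  also have "\<dots> = ennreal B * (\<integral>\<^sup>+x\<in>Q. ennreal (w x) \<partial>lebesgue)"
    by (rule nn_integral_cmult) measurable
  also have "\<dots> < \<infinity>" using weight_finite[OF w Q(1)] by (simp add: ennreal_mult_less_top)
  finally show ?thesis .
qed

lemma weight_finite_lborel:
  assumes "weight w" "compact Q" "A \<subseteq> Q"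
  shows "(\<integral>\<^sup>+x\<in>A. ennreal (w x) \<partial>lborel) < \<infinity>"
  using weighted_finite[OF assms, of "\<lambda>_. 1" 1] by simp

lemma bounded_finite:
  fixes Q :: "'a::euclidean_space set"
  assumes Q: "compact Q" "A \<subseteq> Q" and g: "\<And>x. g x \<le> B"
  shows "(\<integral>\<^sup>+x\<in>A. ennreal (g x) \<partial>lborel) < \<infinity>"
proof -
  have [measurable]: "Q \<in> sets lborel" using borel_closed[OF compact_imp_closed[OF Q(1)]] unfolding sets_lborel .
  have "(\<integral>\<^sup>+x\<in>A. ennreal (g x) \<partial>lborel) \<le> (\<integral>\<^sup>+x. ennreal B * indicator Q x \<partial>lborel)"
    using Q(2) g by (intro nn_integral_mono) (auto split: split_indicator intro: ennreal_leI)
  also have "\<dots> = ennreal B * emeasure lborel Q" by (rule nn_integral_cmult_indicator) measurable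
  also have "\<dots> < \<infinity>" using emeasure_compact_finite[OF Q(1)] by (simp add: ennreal_mult_less_top)
  finally show ?thesis .
qed

lemma rectangles_compact: "R \<in> rectangles S \<Longrightarrow> compact R"
  by (auto simp: rectangles_def rectangle_eq_cbox)

lemma A_Holder_real:
  fixes w :: "real ^ 'n::finite \<Rightarrow> real"
  assumes w: "weight w" and Q: "Q \<in> rectangles S" and r: "1 \<le> r"
    and K: "A_const S r w = ennreal K" "0 \<le> K" and W: "0 < lint Q w"
    and g: "g \<in> borel_measurable borel" "\<And>x. 0 \<le> g x" "\<And>x. g x \<le> B"
  shows "(lint Q g / measure lborel Q) powr r \<le> K * lint Q (\<lambda>x. g x powr r * w x) / lint Q w"
proof (rule A_const_Holder[OF w Q r K _ W g(1,2)])
  note c = rectangles_compact[OF Q]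
  show "(\<integral>\<^sup>+x\<in>Q. ennreal (w x) \<partial>lborel) = ennreal (lint Q w)"
    using weight_finite_lborel[OF w c order_refl] by (simp add: lint_def)
  show "(\<integral>\<^sup>+x\<in>Q. ennreal (g x) \<partial>lborel) = ennreal (lint Q g)"
    using bounded_finite[OF c order_refl g(3)] by (simp add: lint_def)
  have "(\<integral>\<^sup>+x\<in>Q. ennreal (g x powr r * w x) \<partial>lborel) < \<infinity>"
    by (rule weighted_finite[OF w c order_refl, of _ "B powr r"]) (use g r in \<open>auto intro!: powr_mono2\<close>)
  then show "(\<integral>\<^sup>+x\<in>Q. ennreal (g x powr r * w x) \<partial>lborel) = ennreal (lint Q (\<lambda>x. g x powr r * w x))"
    by (simp add: lint_def)
qed (auto simp: lint_nonneg)

lemma lint_weight_two_valued: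
  assumes w: "weight w" and A: "A \<subseteq> Q" "A \<in> sets borel" and Q: "compact Q" and st: "0 \<le> s" "0 \<le> t"
  shows "lint Q (\<lambda>x. (if x \<in> A then s else t) * w x) = s * lint A w + t * (lint Q w - lint A w)"
proof -
  have wn: "0 \<le> w x" for x using w by (simp add: weight_def)
  have [measurable]: "w \<in> borel_measurable lebesgue" by (rule weight_measurable[OF w])
  have [measurable]: "Q \<in> sets lebesgue" "A \<in> sets lebesgue" using Q A by (auto simp: borel_compact)
  define D where "D = Q - A"
  have [measurable]: "D \<in> sets lebesgue" unfolding D_def by measurable
  have f: "(\<integral>\<^sup>+x\<in>Q. ennreal (w x) \<partial>lborel) < \<infinity>" "(\<integral>\<^sup>+x\<in>A. ennreal (w x) \<partial>lborel) < \<infinity>"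
     "(\<integral>\<^sup>+x\<in>D. ennreal (w x) \<partial>lborel) < \<infinity>"
    using weight_finite_lborel[OF w Q, of Q] weight_finite_lborel[OF w Q A(1)] weight_finite_lborel[OF w Q, of D]
    by (auto simp: D_def)
  have split: "(\<integral>\<^sup>+x\<in>Q. ennreal ((if x \<in> A then s else t) * w x) \<partial>lborel)
    = ennreal s * (\<integral>\<^sup>+x\<in>A. ennreal (w x) \<partial>lborel) + ennreal t * (\<integral>\<^sup>+x\<in>D. ennreal (w x) \<partial>lborel)"
    if st: "0 \<le> s" "0 \<le> t" for s t
  proof -
    have "(\<integral>\<^sup>+x\<in>Q. ennreal ((if x \<in> A then s else t) * w x) \<partial>lebesgue)
      = (\<integral>\<^sup>+x. ennreal s * (ennreal (w x) * indicator A x) + ennreal t * (ennreal (w x) * indicator D x) \<partial>lebesgue)"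
      using A wn st by (intro nn_integral_cong) (auto simp: D_def ennreal_mult split: split_indicator)
    also have "\<dots> = ennreal s * (\<integral>\<^sup>+x\<in>A. ennreal (w x) \<partial>lebesgue) + ennreal t * (\<integral>\<^sup>+x\<in>D. ennreal (w x) \<partial>lebesgue)"
      by (simp add: nn_integral_add nn_integral_cmult)
    finally show ?thesis by (simp add: nn_integral_completion)
  qed
  have e: "lint Q (\<lambda>x. (if x \<in> A then s else t) * w x) = s * lint A w + t * lint D w" if "0 \<le> s" "0 \<le> t" for s t
    unfolding lint_def split[OF that] using f that
    by (simp add: enn2real_plus enn2real_mult ennreal_mult_less_top)
  from e[of 1 1] have "lint Q w = lint A w + lint D w" by simp
  then show ?thesis using e[OF st] by simp
qed

context dyadic_rectangle begin

text \<open>The right-hand side of the Poincare inequality as a single density. The side lengths are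
  those of \<open>R\<close>, so on a cell of generation \<open>k\<close> the same density serves
  with the factor \<open>(1 / 2) ^ k\<close>.\<close>

definition dsum :: "(real ^ 'n \<Rightarrow> real) \<Rightarrow> real ^ 'n \<Rightarrow> real" where
  "dsum u x = (\<Sum>i\<in>UNIV. L i * \<bar>ddir u (axis i 1) x\<bar>)"

lemma dsum_nonneg: "0 \<le> dsum u x"
  by (simp add: dsum_def sum_nonneg L_nonneg)

lemma dsum_bounded:
  assumes "C-lipschitz_on UNIV u" shows "\<exists>B. \<forall>x. dsum u x \<le> B"
proof -
  have "\<forall>i. \<exists>B. \<forall>x. \<bar>ddir u (axis i 1) x\<bar> \<le> B" using bounded_ddir[OF assms] by blast
  then obtain B where "\<bar>ddir u (axis i 1) x\<bar> \<le> B i" for i x by metis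
  then have "dsum u x \<le> (\<Sum>i\<in>UNIV. L i * B i)" for x
    unfolding dsum_def by (intro sum_mono mult_left_mono) (auto simp: L_nonneg)
  then show ?thesis by blast
qed

lemma borel_measurable_dsum:
  assumes "C-lipschitz_on UNIV u" shows "dsum u \<in> borel_measurable borel"
proof -
  have [measurable]: "ddir u e \<in> borel_measurable borel" for e
    by (rule borel_measurable_ddir[OF lipschitz_on_continuous_on[OF assms]])
  show ?thesis unfolding dsum_def by measurable
qed

definition cmean :: "(real ^ 'n \<Rightarrow> real) \<Rightarrow> nat \<Rightarrow> real ^ 'n \<Rightarrow> real" where
  "cmean u k x = (LINT y:ccell k x|lborel. u y) / measure lborel (ccell k x)"

lemma measure_ccell_pos: "0 < measure lborel (ccell k x)"
  unfolding measure_ccell using L_pos by (intro mult_pos_pos prod_pos) auto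

lemma measure_ccell_Suc: "measure lborel (ccell k x) = 2 ^ CARD('n) * measure lborel (ccell (Suc k) x)"
  by (simp add: measure_ccell power_add power_one_over)

lemma poincare_ccell:
  assumes u: "C-lipschitz_on UNIV u"
  shows "(\<integral>\<^sup>+y\<in>ccell k x. ennreal \<bar>u y - cmean u k x\<bar> \<partial>lborel) \<le> ennreal ((1 / 2) ^ k * lint (ccell k x) (dsum u))"
proof -
  let ?b = "\<chi> i. corner k x $ i + L i / 2 ^ k"
  have [measurable]: "ddir u e \<in> borel_measurable borel" for e
    by (rule borel_measurable_ddir[OF lipschitz_on_continuous_on[OF u]])
  obtain B where B: "\<And>x. dsum u x \<le> B" using dsum_bounded[OF u] by blast
  have fin: "(\<integral>\<^sup>+y\<in>ccell k x. ennreal (dsum u y) \<partial>lborel) < \<infinity>"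
    by (rule bounded_finite[OF rectangles_compact[OF ccell_rectangles] order_refl B])
  have "(\<integral>\<^sup>+y\<in>ccell k x. ennreal \<bar>u y - cmean u k x\<bar> \<partial>lborel)
    \<le> (\<Sum>e\<in>Basis. ennreal (?b \<bullet> e - corner k x \<bullet> e) * (\<integral>\<^sup>+y\<in>ccell k x. ennreal \<bar>ddir u e y\<bar> \<partial>lborel))"
    unfolding cmean_def ccell_eq_cbox
    by (rule poincare_cbox[OF u]) (use L_pos in \<open>auto simp: Basis_vec_def inner_axis\<close>)
  also have "\<dots> = (\<Sum>i\<in>UNIV. ennreal (L i / 2 ^ k) * (\<integral>\<^sup>+y\<in>ccell k x. ennreal \<bar>ddir u (axis i 1) y\<bar> \<partial>lborel))"
  proof -
    have B: "(Basis :: (real ^ 'n) set) = (\<lambda>i. axis i 1) ` UNIV" by (auto simp: Basis_vec_def)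
    have "inj (\<lambda>i::'n. axis i (1::real) :: real ^ 'n)" by (rule injI) (simp add: axis_eq_axis)
    then show ?thesis unfolding B by (subst sum.reindex) (auto simp: inner_axis intro!: sum.cong)
  qed
  also have "\<dots> = (\<integral>\<^sup>+y. (\<Sum>i\<in>UNIV. ennreal (L i / 2 ^ k) * (ennreal \<bar>ddir u (axis i 1) y\<bar> * indicator (ccell k x) y)) \<partial>lborel)"
    by (subst nn_integral_sum) (auto simp: nn_integral_cmult)
  also have "\<dots> = (\<integral>\<^sup>+y. ennreal ((1 / 2) ^ k) * (ennreal (dsum u y) * indicator (ccell k x) y) \<partial>lborel)"
  proof (rule nn_integral_cong)
    fix y
    have "(\<Sum>i\<in>UNIV. ennreal (L i / 2 ^ k) * ennreal \<bar>ddir u (axis i 1) y\<bar>) = ennreal (\<Sum>i\<in>UNIV. L i / 2 ^ k * \<bar>ddir u (axis i 1) y\<bar>)"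
    proof -
      have "(\<Sum>i\<in>UNIV. ennreal (L i / 2 ^ k) * ennreal \<bar>ddir u (axis i 1) y\<bar>) = (\<Sum>i\<in>UNIV. ennreal (L i / 2 ^ k * \<bar>ddir u (axis i 1) y\<bar>))"
        by (intro sum.cong refl ennreal_mult[symmetric]) (auto simp: L_nonneg)
      also have "\<dots> = ennreal (\<Sum>i\<in>UNIV. L i / 2 ^ k * \<bar>ddir u (axis i 1) y\<bar>)"
        by (rule sum_ennreal) (auto simp: L_nonneg)
      finally show ?thesis .
    qed
    also have "(\<Sum>i\<in>UNIV. L i / 2 ^ k * \<bar>ddir u (axis i 1) y\<bar>) = (1 / 2) ^ k * dsum u y"
      by (simp add: dsum_def sum_distrib_left power_one_over)
    finally show "(\<Sum>i\<in>UNIV. ennreal (L i / 2 ^ k) * (ennreal \<bar>ddir u (axis i 1) y\<bar> * indicator (ccell k x) y))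
      = ennreal ((1 / 2) ^ k) * (ennreal (dsum u y) * indicator (ccell k x) y)"
      by (auto simp: ennreal_mult dsum_nonneg split: split_indicator)
  qed
  also have "\<dots> = ennreal ((1 / 2) ^ k) * (\<integral>\<^sup>+y\<in>ccell k x. ennreal (dsum u y) \<partial>lborel)"
  proof (rule nn_integral_cmult)
    have [measurable]: "dsum u \<in> borel_measurable lborel" "ccell k x \<in> sets lborel"
      using borel_measurable_dsum[OF u] sets_ccell by simp_all
    show "(\<lambda>y. ennreal (dsum u y) * indicator (ccell k x) y) \<in> borel_measurable lborel" by measurable
  qed
  also have "\<dots> = ennreal ((1 / 2) ^ k * lint (ccell k x) (dsum u))"
    using fin by (simp add: lint_def ennreal_mult)
  finally show ?thesis .
qed

text \<open>Both means are compared through the oscillation over the larger cell;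
  \<open>2 ^ CARD('n)\<close> is the ratio of the volumes.\<close>

lemma cmean_Suc_diff:
  assumes u: "C-lipschitz_on UNIV u"
  shows "\<bar>cmean u (Suc k) x - cmean u k x\<bar>
    \<le> 2 ^ CARD('n) * ((1 / 2) ^ k * (lint (ccell k x) (dsum u) / measure lborel (ccell k x)))"
proof -
  let ?c = "ccell (Suc k) x"
  have "ennreal (measure lborel ?c * \<bar>cmean u k x - cmean u (Suc k) x\<bar>)
    = emeasure lborel ?c * ennreal \<bar>cmean u k x - cmean u (Suc k) x\<bar>"
    by (simp add: emeasure_rectangles[OF ccell_rectangles] ennreal_mult)
  also have "\<dots> \<le> (\<integral>\<^sup>+y\<in>?c. ennreal \<bar>u y - cmean u k x\<bar> \<partial>lborel)"
    using mean_oscillation_le[OF lipschitz_on_continuous_on[OF u] measure_ccell_pos[of "Suc k" x, unfolded ccell_eq_cbox], of "cmean u k x"]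
    unfolding cmean_def ccell_eq_cbox .
  also have "\<dots> \<le> (\<integral>\<^sup>+y\<in>ccell k x. ennreal \<bar>u y - cmean u k x\<bar> \<partial>lborel)"
    using ccell_Suc_subset[of k x] by (intro nn_integral_mono) (auto split: split_indicator)
  also have "\<dots> \<le> ennreal ((1 / 2) ^ k * lint (ccell k x) (dsum u))"
    by (rule poincare_ccell[OF u])
  finally have "measure lborel ?c * \<bar>cmean u k x - cmean u (Suc k) x\<bar> \<le> (1 / 2) ^ k * lint (ccell k x) (dsum u)"
    by (simp add: lint_nonneg)
  then have "\<bar>cmean u (Suc k) x - cmean u k x\<bar> \<le> (1 / 2) ^ k * lint (ccell k x) (dsum u) / measure lborel ?c"
    using measure_ccell_pos[of "Suc k" x] by (simp add: field_simps abs_minus_commute)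
  also have "\<dots> = 2 ^ CARD('n) * ((1 / 2) ^ k * (lint (ccell k x) (dsum u) / measure lborel (ccell k x)))"
    unfolding measure_ccell_Suc[of k x] by simp
  finally show ?thesis .
qed

text \<open>Lipschitz continuity gives convergence at every point, so the telescoping estimate has
  no exceptional set.\<close>

lemma cmean_tendsto:
  assumes u: "C-lipschitz_on UNIV u"
  shows "(\<lambda>k. cmean u k x) \<longlonglongrightarrow> u x"
proof -
  define D where "D = C * (\<Sum>i\<in>UNIV. L i)"
  have C: "0 \<le> C" by (rule lipschitz_on_nonneg[OF u])
  then have D: "0 \<le> D" unfolding D_def by (intro mult_nonneg_nonneg sum_nonneg L_nonneg)
  have bound: "\<bar>u x - cmean u k x\<bar> \<le> D * (1 / 2) ^ k" for k
  proof -
    have "ennreal (measure lborel (ccell k x) * \<bar>u x - cmean u k x\<bar>) = emeasure lborel (ccell k x) * ennreal \<bar>u x - cmean u k x\<bar>"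
      by (simp add: emeasure_rectangles[OF ccell_rectangles] ennreal_mult)
    also have "\<dots> \<le> (\<integral>\<^sup>+y\<in>ccell k x. ennreal \<bar>u y - u x\<bar> \<partial>lborel)"
      using mean_oscillation_le[OF lipschitz_on_continuous_on[OF u] measure_ccell_pos[of k x, unfolded ccell_eq_cbox], of "u x"]
      unfolding cmean_def ccell_eq_cbox .
    also have "\<dots> \<le> (\<integral>\<^sup>+y. ennreal (D * (1 / 2) ^ k) * indicator (ccell k x) y \<partial>lborel)"
    proof (rule nn_integral_mono)
      fix y
      have "\<bar>u y - u x\<bar> \<le> D * (1 / 2) ^ k" if "y \<in> ccell k x"
      proof -
        have "\<bar>u y - u x\<bar> \<le> C * norm (y - x)" using lipschitz_onD[OF u, of y x] by (simp add: dist_norm)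
        also have "\<dots> \<le> C * ((\<Sum>i\<in>UNIV. L i) * (1 / 2) ^ k)" using mem_ccell_dist[OF that] C by (intro mult_left_mono)
        finally show ?thesis by (simp add: D_def mult.assoc)
      qed
      then show "ennreal \<bar>u y - u x\<bar> * indicator (ccell k x) y \<le> ennreal (D * (1 / 2) ^ k) * indicator (ccell k x) y"
        by (auto split: split_indicator intro: ennreal_leI)
    qed
    also have "\<dots> = ennreal (D * (1 / 2) ^ k) * emeasure lborel (ccell k x)"
      by (rule nn_integral_cmult_indicator) simp
    also have "\<dots> = ennreal (measure lborel (ccell k x) * (D * (1 / 2) ^ k))"
      unfolding emeasure_rectangles[OF ccell_rectangles] by (subst ennreal_mult[symmetric]) (simp_all add: D)
    finally have "measure lborel (ccell k x) * \<bar>u x - cmean u k x\<bar> \<le> measure lborel (ccell k x) * (D * (1 / 2) ^ k)"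
      using D by (subst (asm) ennreal_le_iff) (rule mult_nonneg_nonneg, simp, rule mult_nonneg_nonneg, simp_all)
    then show ?thesis using measure_ccell_pos[of k x] by (subst (asm) mult_le_cancel_left_pos) auto
  qed
  have "(\<lambda>k. D * (1 / 2) ^ k) \<longlonglongrightarrow> 0"
    by (rule tendsto_mult_right_zero[OF LIMSEQ_realpow_zero]) simp_all
  then have "(\<lambda>k. u x - cmean u k x) \<longlonglongrightarrow> 0"
    by (rule Lim_null_comparison[rotated]) (use bound in \<open>simp add: always_eventually\<close>)
  then have "(\<lambda>k. u x - (u x - cmean u k x)) \<longlonglongrightarrow> u x - 0"
    by (intro tendsto_diff tendsto_const)
  then show ?thesis by simp
qed

lemma diff_cmean_le:
  assumes u: "C-lipschitz_on UNIV u"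
    and b: "\<And>M. (\<Sum>k<M. (1 / 2) ^ k * (lint (ccell k x) (dsum u) / measure lborel (ccell k x))) \<le> B"
  shows "\<bar>u x - cmean u 0 x\<bar> \<le> 2 ^ CARD('n) * B"
proof (rule tendsto_upperbound)
  show "(\<lambda>M. \<bar>cmean u M x - cmean u 0 x\<bar>) \<longlonglongrightarrow> \<bar>u x - cmean u 0 x\<bar>"
    by (intro tendsto_intros cmean_tendsto[OF u])
  have "\<bar>cmean u M x - cmean u 0 x\<bar> \<le> 2 ^ CARD('n) * B" for M
  proof -
    have "\<bar>cmean u M x - cmean u 0 x\<bar> = \<bar>\<Sum>k<M. cmean u (Suc k) x - cmean u k x\<bar>"
      using sum_lessThan_telescope[of "\<lambda>k. cmean u k x" M] by simp
    also have "\<dots> \<le> (\<Sum>k<M. \<bar>cmean u (Suc k) x - cmean u k x\<bar>)" by (rule sum_abs)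
    also have "\<dots> \<le> (\<Sum>k<M. 2 ^ CARD('n) * ((1 / 2) ^ k * (lint (ccell k x) (dsum u) / measure lborel (ccell k x))))"
      by (intro sum_mono cmean_Suc_diff[OF u])
    also have "\<dots> = 2 ^ CARD('n) * (\<Sum>k<M. (1 / 2) ^ k * (lint (ccell k x) (dsum u) / measure lborel (ccell k x)))"
      by (simp add: sum_distrib_left)
    also have "\<dots> \<le> 2 ^ CARD('n) * B" by (intro mult_left_mono b) simp
    finally show ?thesis .
  qed
  then show "\<forall>\<^sub>F M in sequentially. \<bar>cmean u M x - cmean u 0 x\<bar> \<le> 2 ^ CARD('n) * B" by simp
qed simp

end

section \<open>The weak type estimate\<close>

lemma weight_one: "weight (\<lambda>_ :: real ^ 'n::finite. 1)"
  unfolding weight_def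
proof (intro conjI allI impI)
  fix K :: "(real ^ 'n) set" assume "compact K"
  then show "(\<lambda>_. 1 :: real) absolutely_integrable_on K"
    by (intro absolutely_integrable_on_const lmeasurable_compact)
qed simp

lemma lint_one:
  assumes "A \<in> sets borel" shows "lint A (\<lambda>_. 1) = measure lborel A"
  using assms by (simp add: lint_def measure_def)

lemma lint_two_valued:
  fixes A Q :: "(real ^ 'n::finite) set"
  assumes A: "A \<subseteq> Q" "A \<in> sets borel" and Q: "compact Q" and st: "0 \<le> s" "0 \<le> t"
  shows "lint Q (\<lambda>x. if x \<in> A then s else t) = s * measure lborel A + t * (measure lborel Q - measure lborel A)"
  using lint_weight_two_valued[OF weight_one A Q st] A(2) borel_closed[OF compact_imp_closed[OF Q]]
  by (simp add: lint_one)

section \<open>Truncation of Lipschitz functions\<close>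

lemma lipschitz_on_trunc:
  fixes u :: "real ^ 'n::finite \<Rightarrow> real"
  assumes u: "C-lipschitz_on UNIV u"
  shows "C-lipschitz_on UNIV (\<lambda>x. min (max (\<bar>u x - c\<bar> - \<tau>) 0) \<tau>)"
proof (rule lipschitz_onI)
  fix x y
  have "\<bar>min (max (\<bar>u x - c\<bar> - \<tau>) 0) \<tau> - min (max (\<bar>u y - c\<bar> - \<tau>) 0) \<tau>\<bar> \<le> \<bar>u x - u y\<bar>"
    by (simp add: min_def max_def abs_real_def)
  also have "\<bar>u x - u y\<bar> \<le> C * dist x y"
    using lipschitz_onD[OF u, of x y] by (simp add: dist_real_def)
  finally show "dist (min (max (\<bar>u x - c\<bar> - \<tau>) 0) \<tau>) (min (max (\<bar>u y - c\<bar> - \<tau>) 0) \<tau>) \<le> C * dist x y"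
    by (simp only: dist_real_def)
qed (rule lipschitz_on_nonneg[OF u])

text \<open>At a point of differentiability where the truncation attains one of its extreme values
  its derivative vanishes, so no analysis of the level sets of \<open>u\<close> is needed.\<close>

lemma deriv_trunc_le:
  fixes g :: "real \<Rightarrow> real"
  assumes g: "(g has_real_derivative D) (at 0)" and \<tau>: "0 < \<tau>"
    and h: "((\<lambda>t. min (max (\<bar>g t - c\<bar> - \<tau>) 0) \<tau>) has_real_derivative D') (at 0)"
  shows "\<bar>D'\<bar> \<le> \<bar>D\<bar> * (if \<tau> < \<bar>g 0 - c\<bar> \<and> \<bar>g 0 - c\<bar> < 2 * \<tau> then 1 else 0)"
proof -
  define k where "k = (\<lambda>t. min (max (\<bar>g t - c\<bar> - \<tau>) 0) \<tau>)"
  have k: "(k has_real_derivative D') (at 0)" using h by (simp add: k_def)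
  have k_bound: "0 \<le> k t" "k t \<le> \<tau>" for t using \<tau> by (auto simp: k_def)
  have 1: "\<bar>D'\<bar> \<le> \<bar>D\<bar>"
  proof (rule tendsto_le)
    show "((\<lambda>t. \<bar>(g (0 + t) - g 0) / t\<bar>) \<longlongrightarrow> \<bar>D\<bar>) (at 0)" "((\<lambda>t. \<bar>(k (0 + t) - k 0) / t\<bar>) \<longlongrightarrow> \<bar>D'\<bar>) (at 0)"
      using g k unfolding DERIV_def by (simp_all only: add_0_left tendsto_rabs)
    have "\<bar>k t - k s\<bar> \<le> \<bar>g t - g s\<bar>" for s t
      unfolding k_def by (simp add: min_def max_def abs_real_def)
    then show "\<forall>\<^sub>F t in at 0. \<bar>(k (0 + t) - k 0) / t\<bar> \<le> \<bar>(g (0 + t) - g 0) / t\<bar>"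
      by (simp add: divide_right_mono)
  qed simp
  have 2: "D' = 0" if "\<not> (\<tau> < \<bar>g 0 - c\<bar> \<and> \<bar>g 0 - c\<bar> < 2 * \<tau>)"
  proof -
    have "k 0 = 0 \<or> k 0 = \<tau>" using that \<tau> by (auto simp: k_def min_def max_def)
    then show ?thesis
    proof
      assume "k 0 = 0"
      then show ?thesis using k_bound by (intro DERIV_local_min[OF k zero_less_one]) auto
    next
      assume "k 0 = \<tau>"
      then show ?thesis using k_bound by (intro DERIV_local_max[OF k zero_less_one]) auto
    qed
  qed
  from 1 2 show ?thesis by auto
qed

lemma (in dyadic_rectangle) dsum_trunc_le:
  fixes c :: real
  assumes u: "C-lipschitz_on UNIV u" and \<tau>: "0 < \<tau>"
  defines "v \<equiv> \<lambda>x. min (max (\<bar>u x - c\<bar> - \<tau>) 0) \<tau>"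
  shows "AE x in lborel. dsum v x \<le> dsum u x * indicator {x. \<tau> < \<bar>u x - c\<bar> \<and> \<bar>u x - c\<bar> < 2 * \<tau>} x"
proof -
  have v: "C-lipschitz_on UNIV v" unfolding v_def by (rule lipschitz_on_trunc[OF u])
  have "AE x in lborel. \<forall>i\<in>UNIV. \<bar>ddir v (axis i 1) x\<bar> \<le> \<bar>ddir u (axis i 1) x\<bar> *
    (if \<tau> < \<bar>u x - c\<bar> \<and> \<bar>u x - c\<bar> < 2 * \<tau> then 1 else 0)"
  proof (rule AE_finite_allI)
    fix i :: 'n
    show "AE x in lborel. \<bar>ddir v (axis i 1) x\<bar> \<le> \<bar>ddir u (axis i 1) x\<bar> *
      (if \<tau> < \<bar>u x - c\<bar> \<and> \<bar>u x - c\<bar> < 2 * \<tau> then 1 else 0)"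
      using AE_ddir_exists[OF u, of "axis i 1"] AE_ddir_exists[OF v, of "axis i 1"]
    proof eventually_elim
      case (elim x)
      from deriv_trunc_le[OF elim(1) \<tau>, of c] elim(2) show ?case by (simp add: v_def)
    qed
  qed simp
  then show ?thesis
  proof eventually_elim
    case (elim x)
    have "dsum v x \<le> (\<Sum>i\<in>UNIV. L i * (\<bar>ddir u (axis i 1) x\<bar> * (if \<tau> < \<bar>u x - c\<bar> \<and> \<bar>u x - c\<bar> < 2 * \<tau> then 1 else 0)))"
      unfolding dsum_def using elim by (intro sum_mono mult_left_mono) (auto simp: L_nonneg)
    then show ?case by (auto simp: dsum_def split: split_indicator)
  qed
qed

section \<open>Weights on dyadic cells and the stopping time argument\<close>

locale weighted_dyadic_rectangle = dyadic_rectangle +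
  fixes w :: "real ^ 'a::finite \<Rightarrow> real" and p q K Kp :: real
  assumes w: "weight w" and q: "1 \<le> q" "q \<le> p"
    and K: "A_const S q w = ennreal K" "0 \<le> K"
    and Kp: "A_const S p w = ennreal Kp" "0 \<le> Kp"
    and W: "0 < lint (rectangle S a l1 l2) w"
begin

abbreviation R :: "(real ^ 'a) set" where "R \<equiv> rectangle S a l1 l2"

lemma p: "1 \<le> p" using q by simp

lemma ccell_0: "x \<in> root \<Longrightarrow> ccell 0 x = R" by (rule root_ccell)

lemma R_rectangles: "R \<in> rectangles S"
  using ccell_rectangles[of 0 a] ccell_0[OF a_in_root] by simp

lemma compact_R: "compact R" by (rule rectangles_compact[OF R_rectangles])

lemma compact_ccell: "compact (ccell k x)" by (rule rectangles_compact[OF ccell_rectangles])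

lemma ccell_antimono: "j \<le> k \<Longrightarrow> ccell k x \<subseteq> ccell j x"
proof (induction k)
  case (Suc k)
  then show ?case using ccell_Suc_subset[of k x] by (cases "j = Suc k") auto
qed simp

lemma ccell_subset_R: "x \<in> root \<Longrightarrow> ccell k x \<subseteq> R"
  using ccell_antimono[of 0 k x] ccell_0 by auto

lemma one_le_A_const:
  assumes "1 \<le> r" "A_const S r w = ennreal k" "0 \<le> k" shows "1 \<le> k"
  using A_Holder_real[OF w R_rectangles assms W, of "\<lambda>_. 1" 1] measure_rectangle_pos[OF R_rectangles] W
    rectangles_sets[OF R_rectangles] by (simp add: lint_one)

lemma K_ge_1: "1 \<le> K" by (rule one_le_A_const[OF q(1) K])
lemma Kp_ge_1: "1 \<le> Kp" by (rule one_le_A_const[OF p Kp])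

lemma weight_ccell_lower:
  assumes x: "x \<in> root"
  shows "((1 / 2) ^ (k * CARD('a))) powr q \<le> K * (lint (ccell k x) w / lint R w)"
proof -
  let ?g = "\<lambda>y. if y \<in> ccell k x then 1 else 0 :: real"
  have "(lint R ?g / measure lborel R) powr q \<le> K * lint R (\<lambda>y. ?g y powr q * w y) / lint R w"
    by (rule A_Holder_real[OF w R_rectangles q(1) K W, where B = 1]) auto
  also have "lint R ?g = measure lborel (ccell k x)"
    by (subst lint_two_valued[OF ccell_subset_R[OF x] sets_ccell compact_R]) auto
  also have "(\<lambda>y. ?g y powr q * w y) = (\<lambda>y. ?g y * w y)" by auto
  also have "lint R (\<lambda>y. ?g y * w y) = lint (ccell k x) w"
    by (subst lint_weight_two_valued[OF w ccell_subset_R[OF x] sets_ccell compact_R]) auto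
  also have "measure lborel (ccell k x) / measure lborel R = (1 / 2) ^ (k * CARD('a))"
  proof -
    have "(\<Prod>i\<in>UNIV. L i) \<noteq> 0" using L_pos by (metis less_irrefl prod_pos)
    then show ?thesis unfolding ccell_0[OF x, symmetric] measure_ccell by simp
  qed
  finally show ?thesis by simp
qed

lemma weight_ccell_pos:
  assumes "x \<in> root" shows "0 < lint (ccell k x) w"
proof (rule ccontr)
  assume "\<not> ?thesis"
  then have "lint (ccell k x) w = 0" using lint_nonneg[of "ccell k x" w] by linarith
  moreover have "0 < ((1 / 2 :: real) ^ (k * CARD('a))) powr q" by simp
  ultimately show False using weight_ccell_lower[OF assms, of k] by simp
qed

lemma lint_weight_mono:
  assumes "A \<subseteq> B" "B \<subseteq> R" shows "lint A w \<le> lint B w"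
  using assms by (intro lint_mono weight_finite_lborel[OF w compact_R]) auto

lemma dyadic_growth_ccell:
  assumes x: "x \<in> root"
  shows "dyadic_growth CARD('a) q K (\<lambda>k. lint (ccell k x) w / lint R w)"
  unfolding dyadic_growth_def
proof (intro conjI allI impI)
  show "lint (ccell 0 x) w / lint R w = 1" using W by (simp add: ccell_0[OF x])
  fix k
  show "0 < lint (ccell k x) w / lint R w" using W weight_ccell_pos[OF x] by simp
  show "lint (ccell (Suc k) x) w / lint R w \<le> lint (ccell k x) w / lint R w"
    using W lint_weight_mono[OF ccell_Suc_subset ccell_subset_R[OF x]] by (simp add: divide_right_mono)
  show "((1 / 2) ^ (k * CARD('a))) powr q \<le> K * (lint (ccell k x) w / lint R w)"
    by (rule weight_ccell_lower[OF x])
  fix s t :: real assume st: "0 \<le> s" "0 \<le> t"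
  let ?Q = "ccell k x" and ?A = "ccell (Suc k) x"
  let ?g = "\<lambda>y. if y \<in> ?A then s else t"
  have "(lint ?Q ?g / measure lborel ?Q) powr q \<le> K * lint ?Q (\<lambda>y. ?g y powr q * w y) / lint ?Q w"
    by (rule A_Holder_real[OF w ccell_rectangles q(1) K weight_ccell_pos[OF x], where B = "max s t"]) (use st in auto)
  also have "lint ?Q ?g = s * measure lborel ?A + t * (measure lborel ?Q - measure lborel ?A)"
    by (rule lint_two_valued[OF ccell_Suc_subset sets_ccell compact_ccell st])
  also have "(\<lambda>y. ?g y powr q * w y) = (\<lambda>y. (if y \<in> ?A then s powr q else t powr q) * w y)" by auto
  also have "lint ?Q \<dots> = s powr q * lint ?A w + t powr q * (lint ?Q w - lint ?A w)"
    by (rule lint_weight_two_valued[OF w ccell_Suc_subset sets_ccell compact_ccell]) auto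
  also have "(s * measure lborel ?A + t * (measure lborel ?Q - measure lborel ?A)) / measure lborel ?Q
    = s * (1 / 2) ^ CARD('a) + t * (1 - (1 / 2) ^ CARD('a))"
    using measure_ccell_pos[of "Suc k" x] unfolding measure_ccell_Suc[of k x]
    by (simp add: field_simps power_one_over)
  finally show "(s * (1 / 2) ^ CARD('a) + t * (1 - (1 / 2) ^ CARD('a))) powr q * (lint ?Q w / lint R w)
    \<le> K * (s powr q * (lint ?A w / lint R w) + t powr q * (lint ?Q w / lint R w - lint ?A w / lint R w))"
    using W weight_ccell_pos[OF x, of k] by (simp add: field_simps)
qed

definition energy :: "(real ^ 'a \<Rightarrow> real) \<Rightarrow> (real ^ 'a) set \<Rightarrow> real" where
  "energy u A = lint A (\<lambda>x. dsum u x powr p * w x)"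

lemma energy_finite:
  assumes u: "C-lipschitz_on UNIV u" and A: "A \<subseteq> R"
  shows "(\<integral>\<^sup>+x\<in>A. ennreal (dsum u x powr p * w x) \<partial>lborel) < \<infinity>"
proof -
  obtain B where B: "\<And>x. dsum u x \<le> B" using dsum_bounded[OF u] by blast
  show ?thesis
    by (rule weighted_finite[OF w compact_R A, of _ "B powr p"]) (use B p dsum_nonneg in \<open>auto intro!: powr_mono2\<close>)
qed

lemma energy_mono:
  assumes "C-lipschitz_on UNIV u" "A \<subseteq> B" "B \<subseteq> R" shows "energy u A \<le> energy u B"
  unfolding energy_def using assms by (intro lint_mono energy_finite) auto

lemma energy_nonneg: "0 \<le> energy u A" by (simp add: energy_def lint_nonneg)

text \<open>The A_p constant enters the estimates only here; its exponent \<open>1 / p\<close> comes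
  from undoing the power \<open>p\<close> in the condition.\<close>

lemma mean_dsum_le:
  assumes u: "C-lipschitz_on UNIV u" and x: "x \<in> root"
  shows "lint (ccell k x) (dsum u) / measure lborel (ccell k x)
    \<le> Kp powr (1 / p) * (energy u (ccell k x) / lint (ccell k x) w) powr (1 / p)"
proof -
  obtain B where B: "\<And>x. dsum u x \<le> B" using dsum_bounded[OF u] by blast
  let ?Q = "ccell k x"
  have nn: "0 \<le> lint ?Q (dsum u) / measure lborel ?Q" by (simp add: lint_nonneg)
  have "(lint ?Q (dsum u) / measure lborel ?Q) powr p \<le> K' * energy u ?Q / lint ?Q w" if "K' = Kp" for K'
    unfolding energy_def that
    by (rule A_Holder_real[OF w ccell_rectangles p Kp weight_ccell_pos[OF x] borel_measurable_dsum[OF u] dsum_nonneg B])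
  then have "((lint ?Q (dsum u) / measure lborel ?Q) powr p) powr (1 / p) \<le> (Kp * energy u ?Q / lint ?Q w) powr (1 / p)"
    using p by (intro powr_mono2) auto
  moreover have "((lint ?Q (dsum u) / measure lborel ?Q) powr p) powr (1 / p) = lint ?Q (dsum u) / measure lborel ?Q"
    using p nn by (simp add: powr_powr lint_nonneg)
  ultimately show ?thesis by (simp add: powr_mult flip: times_divide_eq_right)
qed

lemma diff_mean_le_of_energy:
  assumes u: "C-lipschitz_on UNIV u" and x: "x \<in> root"
    and b: "\<And>M. (\<Sum>k<M. (1 / 2) ^ k * (energy u (ccell k x) / lint (ccell k x) w) powr (1 / p)) \<le> B"
  shows "\<bar>u x - cmean u 0 a\<bar> \<le> 2 ^ CARD('a) * Kp powr (1 / p) * B"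
proof -
  have "(\<Sum>k<M. (1 / 2) ^ k * (lint (ccell k x) (dsum u) / measure lborel (ccell k x))) \<le> Kp powr (1 / p) * B" for M
  proof -
    have "(\<Sum>k<M. (1 / 2) ^ k * (lint (ccell k x) (dsum u) / measure lborel (ccell k x)))
      \<le> (\<Sum>k<M. (1 / 2) ^ k * (Kp powr (1 / p) * (energy u (ccell k x) / lint (ccell k x) w) powr (1 / p)))"
      by (intro sum_mono mult_left_mono mean_dsum_le[OF u x]) simp
    also have "\<dots> = Kp powr (1 / p) * (\<Sum>k<M. (1 / 2) ^ k * (energy u (ccell k x) / lint (ccell k x) w) powr (1 / p))"
      unfolding sum_distrib_left by (intro sum.cong) (auto simp: mult_ac)
    also have "\<dots> \<le> Kp powr (1 / p) * B" by (intro mult_left_mono b) simp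
    finally show ?thesis .
  qed
  from diff_cmean_le[OF u this] have "\<bar>u x - cmean u 0 x\<bar> \<le> 2 ^ CARD('a) * (Kp powr (1 / p) * B)" .
  moreover have "cmean u 0 x = cmean u 0 a" unfolding cmean_def ccell_0[OF x] ccell_0[OF a_in_root] ..
  ultimately show ?thesis by (simp add: mult.assoc)
qed

text \<open>At a point where the energy stays below \<open>b\<close> times the weight in all
  generations, telescoping would give a deviation of at most \<open>t\<close>. Every point of the
  level set thus has a cell whose energy is at least \<open>b\<close> times its weight, and the
  covering argument adds such cells up.\<close>

theorem weak_estimate:
  assumes C: "dyadic_sum_bound CARD('a) q p K C" "0 < C"
    and ps: "0 < ps" "1 / p - 1 / ps = 1 / (real CARD('a) * (q + ln K))"
    and u: "D-lipschitz_on UNIV u" and t: "0 < t"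
  shows "lint {x \<in> R. t < \<bar>u x - cmean u 0 a\<bar>} w
    \<le> (2 ^ CARD('a) * Kp powr (1 / p) * C * (energy u R / lint R w) powr (1 / p) / t) powr ps * lint R w"
    (is "lint ?E w \<le> (?c * ?N powr (1 / p) / t) powr ps * _")
proof -
  define N where "N = energy u R / lint R w"
  define m where "m = real CARD('a) * (q + ln K)"
  have m: "1 / m = 1 / p - 1 / ps" "0 < m"
    using ps(2) q K_ge_1 by (auto simp: m_def intro!: mult_pos_pos add_pos_nonneg)
  then have pm: "p < m" using ps(1) p by (smt (verit) frac_less2 divide_pos_pos)
  have c: "0 < ?c" using Kp_ge_1 C by simp
  have N: "0 \<le> N" using W by (simp add: N_def energy_nonneg)
  let ?x = "\<lambda>x k. energy u (ccell k x) / lint (ccell k x) w"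
  have x0: "0 \<le> ?x x k" for x k by (simp add: energy_nonneg lint_nonneg)
  have xN: "?x x k \<le> N / (lint (ccell k x) w / lint R w)" if "x \<in> root" for x k
    using W weight_ccell_pos[OF that, of k] energy_mono[OF u ccell_subset_R[OF that] order_refl, of k]
    by (simp add: N_def divide_right_mono)
  define E where "E = {x \<in> root. t < \<bar>u x - cmean u 0 a\<bar>}"
  have uc: "continuous_on UNIV u" by (rule lipschitz_on_continuous_on[OF u])
  \<comment> \<open>The level set is moved to \<open>root\<close>, whose points have all their cells
    inside \<open>R\<close>; the upper faces that are lost are null.\<close>
  have EE: "lint ?E w = lint E w"
  proof -
    let ?T = "{x. t < \<bar>u x - cmean u 0 a\<bar>}"
    have "(\<integral>\<^sup>+x\<in>?E. ennreal (w x) \<partial>lborel) = (\<integral>\<^sup>+x\<in>R. (ennreal (w x) * indicator ?T x) \<partial>lborel)"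
      by (intro nn_integral_cong) (auto split: split_indicator)
    also have "\<dots> = (\<integral>\<^sup>+x\<in>root. (ennreal (w x) * indicator ?T x) \<partial>lborel)" by (rule nn_integral_root[symmetric])
    also have "\<dots> = (\<integral>\<^sup>+x\<in>E. ennreal (w x) \<partial>lborel)"
      by (intro nn_integral_cong) (auto simp: E_def split: split_indicator)
    finally show ?thesis by (simp add: lint_def)
  qed
  show ?thesis
  \<comment> \<open>The sum bound is available for \<open>N > 0\<close> only. Without energy all
    terms of the telescoping bound vanish and \<open>u\<close> is constant on
    \<open>root\<close>.\<close>
  proof (cases "N = 0")
    case True
    have "E = {}"
    proof (rule ccontr)
      assume "E \<noteq> {}"
      then obtain x where x: "x \<in> root" "t < \<bar>u x - cmean u 0 a\<bar>" by (auto simp: E_def)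
      have z: "?x x k = 0" for k using xN[OF x(1), of k] x0[of k x] True by simp
      have "(\<Sum>k<M. (1 / 2) ^ k * ?x x k powr (1 / p)) \<le> 0" for M unfolding z by simp
      from diff_mean_le_of_energy[OF u x(1) this] have "\<bar>u x - cmean u 0 a\<bar> \<le> 0" by simp
      then show False using x t by simp
    qed
    then show ?thesis unfolding EE N_def[symmetric] by (simp add: lint_def)
  next
    case False
    then have Npos: "0 < N" using N by simp
    \<comment> \<open>\<open>b\<close> is the level at which the bound from the telescoping sum,
      \<open>r * b powr (1 / ps)\<close>, equals \<open>t\<close>.\<close>
    define r where "r = ?c * N powr (1 / m)"
    define b where "b = (t / r) powr ps"
    have cN: "0 < r" unfolding r_def using c Npos by (intro mult_pos_pos[OF c]) simp
    have b: "0 < b" using t cN by (simp add: b_def)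
    have bps: "b powr (1 / ps) = t / r" using t cN ps by (simp add: b_def powr_powr)
    have ex: "\<exists>k. b * lint (ccell k x) w \<le> energy u (ccell k x)" if x: "x \<in> E" for x
    proof (rule ccontr)
      assume "\<not> ?thesis"
      then have "energy u (ccell k x) \<le> b * lint (ccell k x) w" for k by (meson linear)
      have xr: "x \<in> root" using x by (simp add: E_def)
      have xb: "?x x k \<le> b" for k
        using \<open>energy u (ccell k x) \<le> b * lint (ccell k x) w\<close> weight_ccell_pos[OF xr, of k] by (simp add: pos_divide_le_eq)
      have "(\<Sum>k<M. (1 / 2) ^ k * ?x x k powr (1 / p)) \<le> C * (N powr (1 / m) * b powr (1 / p - 1 / m))" for M
        by (rule dyadic_sum_boundD[OF C(1) m_def pm dyadic_growth_ccell[OF xr] b Npos x0 xb xN[OF xr]])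
      from diff_mean_le_of_energy[OF u xr this]
      have "\<bar>u x - cmean u 0 a\<bar> \<le> 2 ^ CARD('a) * Kp powr (1 / p) * (C * (N powr (1 / m) * b powr (1 / p - 1 / m)))" .
      also have "1 / p - 1 / m = 1 / ps" using m by simp
      also have "2 ^ CARD('a) * Kp powr (1 / p) * (C * (N powr (1 / m) * b powr (1 / ps))) = r * (t / r)"
        unfolding bps by (simp only: r_def mult_ac)
      also have "\<dots> = t" using cN by simp
      finally show False using x by (simp add: E_def)
    qed
    have wm: "w \<in> borel_measurable lebesgue" by (rule weight_measurable[OF w])
    have fin: "(\<integral>\<^sup>+y\<in>A. ennreal (w y) \<partial>lborel) = ennreal (lint A w)" if "A \<subseteq> R" for A
      using weight_finite_lborel[OF w compact_R that] by (simp add: lint_def)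
    have bfin: "(\<integral>\<^sup>+y\<in>A. ennreal (b * w y) \<partial>lborel) = ennreal (b * lint A w)" if A: "A \<subseteq> R" "A \<in> sets lebesgue" for A
    proof -
      have [measurable]: "w \<in> borel_measurable lebesgue" "A \<in> sets lebesgue" using wm A by auto
      have wn: "0 \<le> w y" for y using w by (simp add: weight_def)
      have "(\<integral>\<^sup>+y\<in>A. ennreal (b * w y) \<partial>lebesgue) = (\<integral>\<^sup>+y. ennreal b * (ennreal (w y) * indicator A y) \<partial>lebesgue)"
        using b wn by (intro nn_integral_cong) (auto simp: ennreal_mult split: split_indicator)
      also have "\<dots> = ennreal b * (\<integral>\<^sup>+y\<in>A. ennreal (w y) \<partial>lebesgue)" by (rule nn_integral_cmult) measurable
      finally show ?thesis using fin[OF A(1)] b by (simp add: nn_integral_completion ennreal_mult lint_nonneg)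
    qed
    have gfin: "(\<integral>\<^sup>+y\<in>A. ennreal (dsum u y powr p * w y) \<partial>lborel) = ennreal (energy u A)" if "A \<subseteq> R" for A
      using energy_finite[OF u that] by (simp add: energy_def lint_def)
    have ds: "dsum u \<in> borel_measurable lebesgue" using borel_measurable_dsum[OF u] by (simp add: measurable_completion)
    have "(\<integral>\<^sup>+y\<in>E. ennreal (b * w y) \<partial>lborel) \<le> (\<integral>\<^sup>+y\<in>R. ennreal (dsum u y powr p * w y) \<partial>lborel)"
    proof (rule dyadic_covering)
      show "(\<lambda>y. ennreal (b * w y)) \<in> borel_measurable lebesgue" using wm by measurable
      show "(\<lambda>y. ennreal (dsum u y powr p * w y)) \<in> borel_measurable lebesgue" using wm ds by measurable
      show "E \<subseteq> root" by (auto simp: E_def)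
      fix x assume x: "x \<in> E"
      then have sub: "ccell k x \<subseteq> R" for k using ccell_subset_R by (auto simp: E_def)
      show "\<exists>k. (\<integral>\<^sup>+y\<in>ccell k x. ennreal (b * w y) \<partial>lborel) \<le> (\<integral>\<^sup>+y\<in>ccell k x. ennreal (dsum u y powr p * w y) \<partial>lborel)"
        using ex[OF x] sub sets_ccell by (auto simp: bfin gfin intro!: ennreal_leI)
    qed
    moreover have "E \<subseteq> R"
      using cell_subset_ccell[of 0 a] by (auto simp: E_def ccell_0[OF a_in_root] root_cell[OF a_in_root])
    moreover have "E \<in> sets lebesgue"
    proof -
      have "open {x. t < \<bar>u x - cmean u 0 a\<bar>}" by (intro open_Collect_less continuous_intros uc)
      then have "{x. t < \<bar>u x - cmean u 0 a\<bar>} \<inter> root \<in> sets borel" by (rule sets.Int[OF borel_open sets_root])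
      moreover have "E = {x. t < \<bar>u x - cmean u 0 a\<bar>} \<inter> root" by (auto simp: E_def)
      ultimately show ?thesis by auto
    qed
    ultimately have "b * lint E w \<le> energy u R"
      by (simp add: bfin gfin energy_nonneg)
    then have "lint E w \<le> N / b * lint R w" using b W by (simp add: N_def field_simps)
    also have "N / b = (?c * N powr (1 / p) / t) powr ps"
    proof -
      have "(?c * N powr (1 / p) / t) powr ps = (N powr (1 / ps) * (r / t)) powr ps"
      proof -
        have "N powr (1 / p) = N powr (1 / ps) * N powr (1 / m)"
          unfolding powr_add[symmetric] using m by simp
        then have "?c * N powr (1 / p) = N powr (1 / ps) * r" by (simp only: r_def mult_ac)
        then show ?thesis by (simp only: times_divide_eq_right)
      qed
      also have "\<dots> = N * (r / t) powr ps"
        using Npos ps unfolding powr_mult[of "N powr (1 / ps)"] by (simp add: powr_powr)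
      also have "(r / t) powr ps = 1 / b"
        unfolding b_def powr_divide by simp
      finally show ?thesis by simp
    qed
    finally show ?thesis unfolding EE N_def .
  qed
qed

end

section \<open>The strong type estimate\<close>

lemma powr_superadditive:
  fixes x y s :: real
  assumes "0 \<le> x" "0 \<le> y" "1 \<le> s"
  shows "x powr s + y powr s \<le> (x + y) powr s"
proof -
  have e: "z powr s = z * z powr (s - 1)" if "0 \<le> z" for z :: real
    using that by (cases "z = 0") (auto simp: powr_diff)
  have "x * x powr (s - 1) \<le> x * (x + y) powr (s - 1)" "y * y powr (s - 1) \<le> y * (x + y) powr (s - 1)"
    using assms by (auto intro!: mult_left_mono powr_mono2)
  then have "x powr s + y powr s \<le> (x + y) * (x + y) powr (s - 1)"
    using assms by (simp add: e distrib_right)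
  then show ?thesis using assms by (simp add: e)
qed

lemma powr_le_mult:
  fixes x y r :: real
  assumes "0 \<le> x" "x \<le> y" "1 \<le> r"
  shows "x powr r \<le> y powr (r - 1) * x"
proof (cases "x = 0")
  case False
  then have "x powr r = x powr (r - 1) * x" using assms by (simp add: powr_diff)
  also have "\<dots> \<le> y powr (r - 1) * x" using assms by (intro mult_right_mono powr_mono2) auto
  finally show ?thesis .
qed simp

text \<open>A value above \<open>2 * T\<close> lies in a single layer, above
  \<open>2 * T * 2 ^ j\<close> and at most \<open>4 * T * 2 ^ j\<close>, and the term for this
  \<open>j\<close> already dominates its power.\<close>

lemma powr_layer_sum_le:
  fixes y s T :: real
  assumes y: "0 \<le> y" "y \<le> 2 * T * 2 ^ J" and T: "0 < T" and s: "0 < s"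
  shows "y powr s \<le> (2 * T) powr s + (\<Sum>j<J. (4 * (T * 2 ^ j)) powr s * (if 2 * (T * 2 ^ j) < y then 1 else 0))"
proof (cases "y \<le> 2 * T")
  case True
  then have "y powr s \<le> (2 * T) powr s" using y s by (intro powr_mono2) auto
  moreover have "0 \<le> (\<Sum>j<J. (4 * (T * 2 ^ j)) powr s * (if 2 * (T * 2 ^ j) < y then 1 else 0 :: real))"
    by (intro sum_nonneg) auto
  ultimately show ?thesis by linarith
next
  case False
  define k where "k = (LEAST k. y \<le> 2 * (T * 2 ^ k))"
  have ex: "y \<le> 2 * (T * 2 ^ J)" using y by simp
  have k: "y \<le> 2 * (T * 2 ^ k)" unfolding k_def using ex by (rule LeastI)
  have kJ: "k \<le> J" unfolding k_def using ex by (rule Least_le)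
  have "k \<noteq> 0" using k False by (metis mult.right_neutral power_0)
  then obtain j where j: "k = Suc j" by (cases k) auto
  have "\<not> y \<le> 2 * (T * 2 ^ j)" using not_less_Least[of j] j unfolding k_def by (metis lessI)
  then have yj: "2 * (T * 2 ^ j) < y" by simp
  have "y powr s \<le> (4 * (T * 2 ^ j)) powr s" using k j y s by (intro powr_mono2) auto
  also have "\<dots> = (4 * (T * 2 ^ j)) powr s * (if 2 * (T * 2 ^ j) < y then 1 else 0)" using yj by simp
  also have "\<dots> \<le> (\<Sum>j<J. (4 * (T * 2 ^ j)) powr s * (if 2 * (T * 2 ^ j) < y then 1 else 0))"
    using kJ j by (intro member_le_sum) auto
  finally show ?thesis by (smt (verit) powr_ge_zero)
qed

text \<open>Almost everywhere, the truncation at height \<open>T * 2 ^ j\<close> has a gradient only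
  where the deviation lies between \<open>T * 2 ^ j\<close> and twice that. These layers are
  disjoint for different \<open>j\<close>, so the truncations share the energy of \<open>u\<close>
  instead of each costing all of it.\<close>

lemma (in dyadic_rectangle) sum_dsum_trunc_le:
  fixes c T p :: real
  assumes u: "C-lipschitz_on UNIV u" and T: "0 < T" and p: "0 < p"
  shows "AE x in lborel. (\<Sum>j<J. dsum (\<lambda>x. min (max (\<bar>u x - c\<bar> - T * 2 ^ j) 0) (T * 2 ^ j)) x powr p) \<le> dsum u x powr p"
proof -
  define v where "v = (\<lambda>(j::nat) x. min (max (\<bar>u x - c\<bar> - T * 2 ^ j) 0) (T * 2 ^ j))"
  define A where "A = (\<lambda>j::nat. {x. T * 2 ^ j < \<bar>u x - c\<bar> \<and> \<bar>u x - c\<bar> < 2 * (T * 2 ^ j)})"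
  have "AE x in lborel. \<forall>j. dsum (v j) x \<le> dsum u x * indicator (A j) x"
    unfolding AE_all_countable v_def A_def
    by (intro allI dsum_trunc_le[OF u]) (use T in simp)
  then have "AE x in lborel. (\<Sum>j<J. dsum (v j) x powr p) \<le> dsum u x powr p"
  proof eventually_elim
    case (elim x)
    have disj: "j = k" if "x \<in> A j" "x \<in> A k" for j k
    proof (rule ccontr)
      have *: False if "i < l" "x \<in> A i" "x \<in> A l" for i l
      proof -
        have "(2::real) ^ Suc i \<le> 2 ^ l" using that(1) by (intro power_increasing) auto
        then have "2 * (T * 2 ^ i) \<le> T * 2 ^ l" using mult_left_mono[of "2 ^ Suc i" "2 ^ l" T] T by simp
        then show False using that by (simp add: A_def)
      qed
      assume "j \<noteq> k"
      then show False using *[of j k] *[of k j] that by (meson linorder_neqE_nat)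
    qed
    have le: "dsum (v j) x powr p \<le> dsum u x powr p * indicator (A j) x" for j
    proof (cases "x \<in> A j")
      case True
      then show ?thesis using elim[rule_format, of j] p dsum_nonneg[of "v j" x] by (simp add: powr_mono2)
    next
      case False
      then have "dsum (v j) x = 0" using elim[rule_format, of j] dsum_nonneg[of "v j" x] by simp
      then show ?thesis by simp
    qed
    show ?case
    proof (cases "\<exists>k. x \<in> A k")
      case True
      then obtain k where k: "x \<in> A k" by blast
      have "(\<Sum>j<J. dsum (v j) x powr p) \<le> (\<Sum>j<J. if j = k then dsum u x powr p else 0)"
      proof (rule sum_mono)
        fix j show "dsum (v j) x powr p \<le> (if j = k then dsum u x powr p else 0)"
          using le[of j] disj[OF _ k, of j] by (cases "x \<in> A j") auto
      qed
      also have "\<dots> \<le> dsum u x powr p" by simp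
      finally show ?thesis .
    next
      case False
      then have "dsum (v j) x powr p \<le> 0" for j using le[of j] by auto
      then have "(\<Sum>j<J. dsum (v j) x powr p) \<le> (\<Sum>j<J. 0)" by (intro sum_mono) blast
      also have "\<dots> \<le> dsum u x powr p" by simp
      finally show ?thesis .
    qed
  qed
  then show ?thesis by (simp add: v_def)
qed

context weighted_dyadic_rectangle begin

lemma ennreal_lint_weight:
  "A \<subseteq> R \<Longrightarrow> (\<integral>\<^sup>+y\<in>A. ennreal (w y) \<partial>lborel) = ennreal (lint A w)"
  using weight_finite_lborel[OF w compact_R, of A] by (simp add: lint_def)

lemma ennreal_energy:
  assumes "C-lipschitz_on UNIV u"
  shows "(\<integral>\<^sup>+y\<in>R. ennreal (dsum u y powr p * w y) \<partial>lborel) = ennreal (energy u R)"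
  using energy_finite[OF assms order_refl] by (simp add: energy_def lint_def)

lemma energy_trunc_sum_le:
  fixes c T :: real
  assumes u: "C-lipschitz_on UNIV u" and T: "0 < T"
  shows "(\<Sum>j<J. energy (\<lambda>x. min (max (\<bar>u x - c\<bar> - T * 2 ^ j) 0) (T * 2 ^ j)) R) \<le> energy u R"
proof -
  define v where "v = (\<lambda>(j::nat) x. min (max (\<bar>u x - c\<bar> - T * 2 ^ j) 0) (T * 2 ^ j))"
  have v: "C-lipschitz_on UNIV (v j)" for j unfolding v_def by (rule lipschitz_on_trunc[OF u])
  have wn: "0 \<le> w y" for y using w by (simp add: weight_def)
  have [measurable]: "w \<in> borel_measurable lebesgue" by (rule weight_measurable[OF w])
  have [measurable]: "R \<in> sets lebesgue" using rectangles_sets[OF R_rectangles] by simp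
  have [measurable]: "dsum (v j) \<in> borel_measurable lebesgue" for j
    using borel_measurable_dsum[OF v] by (simp add: measurable_completion)
  have "ennreal (\<Sum>j<J. energy (v j) R) = (\<Sum>j<J. ennreal (energy (v j) R))"
    by (simp add: energy_nonneg)
  also have "\<dots> = (\<Sum>j<J. \<integral>\<^sup>+y\<in>R. ennreal (dsum (v j) y powr p * w y) \<partial>lebesgue)"
    by (simp only: ennreal_energy[OF v] nn_integral_completion)
  also have "\<dots> = (\<integral>\<^sup>+y. (\<Sum>j<J. ennreal (dsum (v j) y powr p * w y) * indicator R y) \<partial>lebesgue)"
    by (rule nn_integral_sum[symmetric]) measurable
  also have "\<dots> \<le> (\<integral>\<^sup>+y\<in>R. ennreal (dsum u y powr p * w y) \<partial>lebesgue)"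
    unfolding nn_integral_completion
  proof (rule nn_integral_mono_AE)
    have "AE y in lborel. (\<Sum>j<J. dsum (v j) y powr p) \<le> dsum u y powr p"
      using sum_dsum_trunc_le[OF u T, where p = p and c = c and J = J] p by (simp add: v_def)
    then show "AE y in lborel. (\<Sum>j<J. ennreal (dsum (v j) y powr p * w y) * indicator R y)
        \<le> ennreal (dsum u y powr p * w y) * indicator R y"
    proof eventually_elim
      case (elim y)
      have "(\<Sum>j<J. ennreal (dsum (v j) y powr p * w y)) = ennreal ((\<Sum>j<J. dsum (v j) y powr p) * w y)"
        using wn by (simp add: sum_distrib_right)
      also have "\<dots> \<le> ennreal (dsum u y powr p * w y)"
        using wn elim by (intro ennreal_leI mult_right_mono)
      finally have "(\<Sum>j<J. ennreal (dsum (v j) y powr p * w y)) \<le> ennreal (dsum u y powr p * w y)" .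
      then show ?case by (cases "y \<in> R") simp_all
    qed
  qed
  also have "\<dots> = ennreal (energy u R)" by (simp only: nn_integral_completion ennreal_energy[OF u])
  finally show ?thesis by (simp add: energy_nonneg v_def)
qed

lemma mean_oscillation_le_energy:
  assumes u: "C-lipschitz_on UNIV u"
  shows "lint R (\<lambda>x. \<bar>u x - cmean u 0 a\<bar>) / measure lborel R \<le> Kp powr (1 / p) * (energy u R / lint R w) powr (1 / p)"
proof -
  have "(\<integral>\<^sup>+y\<in>R. ennreal \<bar>u y - cmean u 0 a\<bar> \<partial>lborel) \<le> ennreal (lint R (dsum u))"
    using poincare_ccell[OF u, of 0 a] by (simp add: ccell_0[OF a_in_root])
  then have "lint R (\<lambda>x. \<bar>u x - cmean u 0 a\<bar>) \<le> lint R (dsum u)"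
    unfolding lint_def[of R "\<lambda>x. \<bar>u x - cmean u 0 a\<bar>"]
    by (intro enn2real_leI) (auto simp: lint_nonneg)
  then have "lint R (\<lambda>x. \<bar>u x - cmean u 0 a\<bar>) / measure lborel R \<le> lint R (dsum u) / measure lborel R"
    by (rule divide_right_mono) simp
  also have "\<dots> \<le> Kp powr (1 / p) * (energy u R / lint R w) powr (1 / p)"
    using mean_dsum_le[OF u a_in_root, of 0] by (simp add: ccell_0[OF a_in_root])
  finally show ?thesis .
qed

text \<open>The weak estimate measures the deviation from the mean of the truncation itself; this
  keeps that mean small.\<close>

lemma cmean_trunc_le:
  assumes u: "C-lipschitz_on UNIV u" and \<tau>: "0 \<le> \<tau>"
  shows "cmean (\<lambda>x. min (max (\<bar>u x - c\<bar> - \<tau>) 0) \<tau>) 0 a \<le> lint R (\<lambda>x. \<bar>u x - c\<bar>) / measure lborel R"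
proof -
  define v where "v = (\<lambda>x. min (max (\<bar>u x - c\<bar> - \<tau>) 0) \<tau>)"
  have v: "continuous_on UNIV v" unfolding v_def by (rule lipschitz_on_continuous_on[OF lipschitz_on_trunc[OF u]])
  have uc: "continuous_on UNIV u" by (rule lipschitz_on_continuous_on[OF u])
  have [measurable]: "v \<in> borel_measurable borel" by (rule borel_measurable_continuous_onI[OF v])
  have [measurable]: "R \<in> sets borel" using rectangles_sets[OF R_rectangles] by simp
  have v0: "0 \<le> v x" "v x \<le> \<bar>u x - c\<bar>" for x using \<tau> by (auto simp: v_def)
  have "(LINT y:R|lborel. v y) = lint R v"
  proof -
    have "(LINT y:R|lborel. v y) = enn2real (\<integral>\<^sup>+y. ennreal (indicator R y *\<^sub>R v y) \<partial>lborel)"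
      unfolding set_lebesgue_integral_def using v0 by (intro integral_eq_nn_integral) auto
    also have "(\<integral>\<^sup>+y. ennreal (indicator R y *\<^sub>R v y) \<partial>lborel) = (\<integral>\<^sup>+y\<in>R. ennreal (v y) \<partial>lborel)"
      by (intro nn_integral_cong) (auto split: split_indicator)
    finally show ?thesis by (simp add: lint_def)
  qed
  also have "\<dots> \<le> lint R (\<lambda>x. \<bar>u x - c\<bar>)"
  proof (rule lint_mono)
    have "compact ((\<lambda>x. \<bar>u x - c\<bar>) ` R)"
      by (intro compact_continuous_image compact_R continuous_intros continuous_on_subset[OF uc]) simp
    then obtain B where B: "\<bar>u x - c\<bar> \<le> B" if "x \<in> R" for x
      by (meson bdd_above.E bounded_imp_bdd_above compact_imp_bounded imageI)
    have "(\<integral>\<^sup>+x\<in>R. ennreal \<bar>u x - c\<bar> \<partial>lborel) = (\<integral>\<^sup>+x\<in>R. ennreal (min \<bar>u x - c\<bar> B) \<partial>lborel)"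
      using B by (intro nn_integral_cong) (auto simp: min_absorb1 split: split_indicator)
    also have "\<dots> < \<infinity>" by (rule bounded_finite[OF compact_R order_refl, where B = B]) simp
    finally show "(\<integral>\<^sup>+x\<in>R. ennreal \<bar>u x - c\<bar> \<partial>lborel) < \<infinity>" .
  qed (use v0 in auto)
  finally show ?thesis unfolding cmean_def ccell_0[OF a_in_root] v_def[symmetric]
    by (rule divide_right_mono) simp
qed

text \<open>On the level set the truncation takes its maximal value \<open>\<tau>\<close>, while its
  mean is at most \<open>T \<le> \<tau> / 2\<close>. It thus deviates from its mean by more than
  \<open>\<tau> / 4\<close>, and the weak estimate applies to it.\<close>

lemma level_set_le:
  assumes C: "dyadic_sum_bound CARD('a) q p K C" "0 < C"
    and ps: "0 < ps" "1 / p - 1 / ps = 1 / (real CARD('a) * (q + ln K))"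
    and u: "D-lipschitz_on UNIV u"
    and T: "Kp powr (1 / p) * (energy u R / lint R w) powr (1 / p) \<le> T" "2 * T \<le> \<tau>" "0 < \<tau>"
  defines "v \<equiv> \<lambda>x. min (max (\<bar>u x - cmean u 0 a\<bar> - \<tau>) 0) \<tau>"
  shows "lint {x \<in> R. 2 * \<tau> < \<bar>u x - cmean u 0 a\<bar>} w
    \<le> (2 ^ CARD('a) * Kp powr (1 / p) * C * (energy v R / lint R w) powr (1 / p) / (\<tau> / 4)) powr ps * lint R w"
proof -
  have v: "D-lipschitz_on UNIV v" unfolding v_def by (rule lipschitz_on_trunc[OF u])
  have "cmean v 0 a \<le> T"
    using cmean_trunc_le[OF u, of \<tau> "cmean u 0 a"] mean_oscillation_le_energy[OF u] T unfolding v_def by linarith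
  have "lint {x \<in> R. 2 * \<tau> < \<bar>u x - cmean u 0 a\<bar>} w \<le> lint {x \<in> R. \<tau> / 4 < \<bar>v x - cmean v 0 a\<bar>} w"
  proof (rule lint_weight_mono)
    show "{x \<in> R. 2 * \<tau> < \<bar>u x - cmean u 0 a\<bar>} \<subseteq> {x \<in> R. \<tau> / 4 < \<bar>v x - cmean v 0 a\<bar>}"
    proof clarify
      fix x assume x: "2 * \<tau> < \<bar>u x - cmean u 0 a\<bar>"
      then have "v x = \<tau>" using T(3) by (simp add: v_def)
      then show "\<tau> / 4 < \<bar>v x - cmean v 0 a\<bar>" using \<open>cmean v 0 a \<le> T\<close> T by linarith
    qed
  qed auto
  also have "\<dots> \<le> (2 ^ CARD('a) * Kp powr (1 / p) * C * (energy v R / lint R w) powr (1 / p) / (\<tau> / 4)) powr ps * lint R w"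
    by (rule weak_estimate[OF C ps v]) (use T in simp)
  finally show ?thesis .
qed

text \<open>Maz'ya's truncation method: each layer of \<open>u\<close> obeys the weak estimate with
  its own energy, and these energies can be summed. \<open>\<epsilon>\<close> keeps the heights
  positive when the energy of \<open>u\<close> is zero.\<close>

lemma strong_estimate_aux:
  assumes C: "dyadic_sum_bound CARD('a) q p K C" "0 < C"
    and ps: "0 < ps" "1 / p - 1 / ps = 1 / (real CARD('a) * (q + ln K))"
    and u: "D-lipschitz_on UNIV u" and \<epsilon>: "0 < \<epsilon>"
  defines "\<Theta> \<equiv> Kp powr (1 / p) * (energy u R / lint R w) powr (1 / p)"
  shows "lint R (\<lambda>x. \<bar>u x - cmean u 0 a\<bar> powr ps * w x) \<le> ((4 + 16 * 2 ^ CARD('a) * C) * \<Theta> + 4 * \<epsilon>) powr ps * lint R w"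
proof -
  define c where "c = cmean u 0 a"
  \<comment> \<open>Twice a strict upper bound for the mean oscillation, as
    \<open>level_set_le\<close> requires at the lowest height.\<close>
  define T where "T = 2 * (\<Theta> + \<epsilon>)"
  have \<Theta>0: "0 \<le> \<Theta>" by (simp add: \<Theta>_def)
  have T0: "0 < T" using \<Theta>0 \<epsilon> by (simp add: T_def)
  define \<tau> where "\<tau> = (\<lambda>j::nat. T * 2 ^ j)"
  define v where "v = (\<lambda>j x. min (max (\<bar>u x - c\<bar> - \<tau> j) 0) (\<tau> j))"
  define N where "N = energy u R / lint R w"
  define c0 where "c0 = 2 ^ CARD('a) * Kp powr (1 / p) * C"
  have c0: "0 \<le> c0" using C by (simp add: c0_def)
  have \<tau>0: "0 < \<tau> j" for j using T0 by (simp add: \<tau>_def)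
  have uc: "continuous_on UNIV u" by (rule lipschitz_on_continuous_on[OF u])
  have wn: "0 \<le> w y" for y using w by (simp add: weight_def)
  have [measurable]: "w \<in> borel_measurable lebesgue" by (rule weight_measurable[OF w])
  have [measurable]: "R \<in> sets lebesgue" using rectangles_sets[OF R_rectangles] by simp
  define E where "E = (\<lambda>j. {x \<in> R. 2 * \<tau> j < \<bar>u x - c\<bar>})"
  have [measurable]: "E j \<in> sets lebesgue" for j
  proof -
    have "open {x. 2 * \<tau> j < \<bar>u x - c\<bar>}" by (intro open_Collect_less continuous_intros uc)
    then have "{x. 2 * \<tau> j < \<bar>u x - c\<bar>} \<inter> R \<in> sets borel"
      by (rule sets.Int[OF borel_open rectangles_sets[OF R_rectangles]])
    moreover have "E j = {x. 2 * \<tau> j < \<bar>u x - c\<bar>} \<inter> R" by (auto simp: E_def)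
    ultimately show ?thesis by auto
  qed
  have pss: "p \<le> ps" "1 \<le> ps"
  proof -
    have "0 \<le> 1 / (real CARD('a) * (q + ln K))" using q K_ge_1 by auto
    then have "1 / ps \<le> 1 / p" using ps(2) by linarith
    then show "p \<le> ps" using ps(1) p by (simp add: field_simps)
    then show "1 \<le> ps" using p by simp
  qed
  have N0: "0 \<le> N" using W by (simp add: N_def energy_nonneg)
  \<comment> \<open>The deviation is bounded on the compact set \<open>R\<close>, so finitely many
    layers suffice.\<close>
  obtain J where J: "\<bar>u x - c\<bar> \<le> 2 * T * 2 ^ J" if "x \<in> R" for x
  proof -
    have "compact ((\<lambda>x. \<bar>u x - c\<bar>) ` R)"
      by (intro compact_continuous_image compact_R continuous_intros continuous_on_subset[OF uc]) simp
    then obtain B where B: "\<bar>u x - c\<bar> \<le> B" if "x \<in> R" for x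
      by (meson bdd_above.E bounded_imp_bdd_above compact_imp_bounded imageI)
    obtain J where "B / (2 * T) < 2 ^ J" using real_arch_pow[of 2 "B / (2 * T)"] by auto
    then have "B \<le> 2 * T * 2 ^ J" using T0 by (simp add: field_simps)
    then show ?thesis using B that by (meson order_trans)
  qed
  have "(\<integral>\<^sup>+x\<in>R. ennreal (\<bar>u x - c\<bar> powr ps * w x) \<partial>lebesgue)
    \<le> (\<integral>\<^sup>+x. ennreal ((2 * T) powr ps) * (ennreal (w x) * indicator R x)
        + (\<Sum>j<J. ennreal ((4 * \<tau> j) powr ps) * (ennreal (w x) * indicator (E j) x)) \<partial>lebesgue)"
  proof (rule nn_integral_mono)
    fix x
    show "ennreal (\<bar>u x - c\<bar> powr ps * w x) * indicator R x \<le> ennreal ((2 * T) powr ps) * (ennreal (w x) * indicator R x)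
        + (\<Sum>j<J. ennreal ((4 * \<tau> j) powr ps) * (ennreal (w x) * indicator (E j) x))"
    proof (cases "x \<in> R")
      case True
      have "\<bar>u x - c\<bar> powr ps \<le> (2 * T) powr ps + (\<Sum>j<J. (4 * \<tau> j) powr ps * (if 2 * \<tau> j < \<bar>u x - c\<bar> then 1 else 0))"
        unfolding \<tau>_def by (rule powr_layer_sum_le) (use J[OF True] T0 ps in auto)
      also have "(\<Sum>j<J. (4 * \<tau> j) powr ps * (if 2 * \<tau> j < \<bar>u x - c\<bar> then 1 else 0)) = (\<Sum>j<J. (4 * \<tau> j) powr ps * indicator (E j) x)"
        using True by (intro sum.cong) (auto simp: E_def)
      finally have "\<bar>u x - c\<bar> powr ps * w x \<le> ((2 * T) powr ps + (\<Sum>j<J. (4 * \<tau> j) powr ps * indicator (E j) x)) * w x"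
        using wn by (rule mult_right_mono)
      also have "\<dots> = (2 * T) powr ps * w x + (\<Sum>j<J. (4 * \<tau> j) powr ps * (w x * indicator (E j) x))"
        unfolding distrib_right sum_distrib_right by (simp only: mult_ac)
      finally have "ennreal (\<bar>u x - c\<bar> powr ps * w x) \<le> ennreal ((2 * T) powr ps * w x + (\<Sum>j<J. (4 * \<tau> j) powr ps * (w x * indicator (E j) x)))"
        by (rule ennreal_leI)
      also have "\<dots> = ennreal ((2 * T) powr ps * w x) + (\<Sum>j<J. ennreal ((4 * \<tau> j) powr ps * (w x * indicator (E j) x)))"
        using wn by (subst ennreal_plus) (auto intro!: sum_nonneg)
      also have "\<dots> = ennreal ((2 * T) powr ps) * ennreal (w x) + (\<Sum>j<J. ennreal ((4 * \<tau> j) powr ps) * (ennreal (w x) * indicator (E j) x))"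
        using wn by (intro arg_cong2[of _ _ _ _ "(+)"] sum.cong) (auto simp: ennreal_mult split: split_indicator)
      finally show ?thesis using True by simp
    qed simp
  qed
  also have "\<dots> = ennreal ((2 * T) powr ps) * (\<integral>\<^sup>+x\<in>R. ennreal (w x) \<partial>lebesgue)
      + (\<Sum>j<J. ennreal ((4 * \<tau> j) powr ps) * (\<integral>\<^sup>+x\<in>E j. ennreal (w x) \<partial>lebesgue))"
    by (simp add: nn_integral_add nn_integral_sum nn_integral_cmult)
  also have "\<dots> = ennreal ((2 * T) powr ps * lint R w + (\<Sum>j<J. (4 * \<tau> j) powr ps * lint (E j) w))"
  proof -
    have "E j \<subseteq> R" for j by (auto simp: E_def)
    then have e: "(\<integral>\<^sup>+x\<in>E j. ennreal (w x) \<partial>lebesgue) = ennreal (lint (E j) w)" for j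
      by (simp add: nn_integral_completion ennreal_lint_weight)
    have "(\<Sum>j<J. ennreal ((4 * \<tau> j) powr ps) * ennreal (lint (E j) w)) = (\<Sum>j<J. ennreal ((4 * \<tau> j) powr ps * lint (E j) w))"
      by (intro sum.cong refl ennreal_mult[symmetric]) (auto simp: lint_nonneg)
    also have "\<dots> = ennreal (\<Sum>j<J. (4 * \<tau> j) powr ps * lint (E j) w)"
      by (rule sum_ennreal) (simp add: lint_nonneg)
    finally have s: "(\<Sum>j<J. ennreal ((4 * \<tau> j) powr ps) * ennreal (lint (E j) w)) = ennreal (\<Sum>j<J. (4 * \<tau> j) powr ps * lint (E j) w)" .
    have t: "(\<integral>\<^sup>+x\<in>R. ennreal (w x) \<partial>lebesgue) = ennreal (lint R w)"
      by (simp add: nn_integral_completion ennreal_lint_weight)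
    show ?thesis unfolding e s t
      by (subst ennreal_plus) (auto simp: ennreal_mult lint_nonneg intro!: sum_nonneg)
  qed
  finally have 1: "lint R (\<lambda>x. \<bar>u x - c\<bar> powr ps * w x) \<le> (2 * T) powr ps * lint R w + (\<Sum>j<J. (4 * \<tau> j) powr ps * lint (E j) w)"
    unfolding lint_def[of R "\<lambda>x. \<bar>u x - c\<bar> powr ps * w x"] nn_integral_completion
    by (intro enn2real_leI) (auto intro!: add_nonneg_nonneg sum_nonneg simp: lint_nonneg)
  \<comment> \<open>The constant 16 is \<open>4 * \<tau> j\<close> divided by the level
    \<open>\<tau> j / 4\<close>: the heights cancel, and what remains is a power of the energy of
    the layer.\<close>
  have 2: "(4 * \<tau> j) powr ps * lint (E j) w \<le> (16 * c0) powr ps * N powr (ps / p - 1) * energy (v j) R" if "j < J" for j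
  proof -
    let ?N = "energy (v j) R / lint R w"
    have sum: "(\<Sum>j<J. energy (v j) R) \<le> energy u R"
      using energy_trunc_sum_le[OF u T0, where J = J and c = c] by (simp add: v_def \<tau>_def)
    have "energy (v j) R \<le> (\<Sum>j<J. energy (v j) R)"
      using that by (intro member_le_sum) (auto simp: energy_nonneg)
    with sum have NN: "0 \<le> ?N" "?N \<le> N" using W by (auto simp: N_def energy_nonneg divide_right_mono)
    have "2 * (\<Theta> + \<epsilon>) \<le> \<tau> j"
      using T0 mult_left_mono[of 1 "2 ^ j" T] by (simp add: \<tau>_def T_def)
    then have "lint (E j) w \<le> (c0 * ?N powr (1 / p) / (\<tau> j / 4)) powr ps * lint R w"
      unfolding E_def c_def v_def c0_def
      by (intro level_set_le[OF C ps u, where T = "\<Theta> + \<epsilon>"]) (use \<epsilon> \<tau>0 in \<open>auto simp: \<Theta>_def\<close>)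
    then have "(4 * \<tau> j) powr ps * lint (E j) w \<le> (4 * \<tau> j) powr ps * ((c0 * ?N powr (1 / p) / (\<tau> j / 4)) powr ps * lint R w)"
      by (rule mult_left_mono) simp
    also have "\<dots> = (4 * \<tau> j * (c0 * ?N powr (1 / p) / (\<tau> j / 4))) powr ps * lint R w"
      unfolding powr_mult[of "4 * \<tau> j"] by simp
    also have "4 * \<tau> j * (c0 * ?N powr (1 / p) / (\<tau> j / 4)) = 16 * c0 * ?N powr (1 / p)"
      using \<tau>0[of j] by (simp add: field_simps)
    also have "(16 * c0 * ?N powr (1 / p)) powr ps = (16 * c0) powr ps * ?N powr (ps / p)"
      unfolding powr_mult[of "16 * c0"] powr_powr by simp
    \<comment> \<open>Because \<open>p \<le> ps\<close>, all but one power of the energy of the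
      layer can be bounded by the total energy; the remaining first power can be summed.\<close>
    also have "?N powr (ps / p) \<le> N powr (ps / p - 1) * ?N"
      using NN pss p by (intro powr_le_mult) auto
    finally show ?thesis using W by (simp add: mult_right_mono mult_left_mono)
  qed
  have "(\<Sum>j<J. (4 * \<tau> j) powr ps * lint (E j) w) \<le> (\<Sum>j<J. (16 * c0) powr ps * N powr (ps / p - 1) * energy (v j) R)"
    by (rule sum_mono) (use 2 in auto)
  also have "\<dots> = (16 * c0) powr ps * N powr (ps / p - 1) * (\<Sum>j<J. energy (v j) R)" by (simp add: sum_distrib_left)
  also have "\<dots> \<le> (16 * c0) powr ps * N powr (ps / p - 1) * energy u R"
    using energy_trunc_sum_le[OF u T0, where J = J and c = c] by (intro mult_left_mono) (auto simp: v_def \<tau>_def)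
  also have "\<dots> = (16 * c0 * N powr (1 / p)) powr ps * lint R w"
  proof (cases "N = 0")
    case True
    then show ?thesis using W by (simp add: N_def)
  next
    case False
    have "N powr (ps / p - 1) * energy u R = N powr (ps / p) * lint R w"
    proof -
      have "energy u R = N * lint R w" using W by (simp add: N_def)
      moreover have "N powr (ps / p - 1) * N = N powr (ps / p)" using False N0 by (simp add: powr_diff)
      ultimately show ?thesis by (metis mult.assoc)
    qed
    then show ?thesis unfolding powr_mult[of "16 * c0"] powr_powr by simp
  qed
  finally have "lint R (\<lambda>x. \<bar>u x - c\<bar> powr ps * w x) \<le> ((2 * T) powr ps + (16 * c0 * N powr (1 / p)) powr ps) * lint R w"
    using 1 by (simp add: distrib_right)
  also have "\<dots> \<le> (2 * T + 16 * c0 * N powr (1 / p)) powr ps * lint R w"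
    using T0 c0 pss by (intro mult_right_mono powr_superadditive) (auto simp: lint_nonneg)
  also have "2 * T + 16 * c0 * N powr (1 / p) = (4 + 16 * 2 ^ CARD('a) * C) * \<Theta> + 4 * \<epsilon>"
    by (simp add: T_def c0_def \<Theta>_def N_def algebra_simps)
  finally show ?thesis by (simp add: c_def)
qed

theorem strong_estimate:
  assumes C: "dyadic_sum_bound CARD('a) q p K C" "0 < C"
    and ps: "0 < ps" "1 / p - 1 / ps = 1 / (real CARD('a) * (q + ln K))"
    and u: "D-lipschitz_on UNIV u"
  shows "(lint R (\<lambda>x. \<bar>u x - cmean u 0 a\<bar> powr ps * w x) / lint R w) powr (1 / ps)
    \<le> (4 + 16 * 2 ^ CARD('a) * C) * (Kp powr (1 / p) * (energy u R / lint R w) powr (1 / p))" (is "?l \<le> ?r")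
proof (rule field_le_epsilon)
  fix e :: real assume e: "0 < e"
  have r: "0 \<le> ?r" using C by (intro mult_nonneg_nonneg) auto
  have "lint R (\<lambda>x. \<bar>u x - cmean u 0 a\<bar> powr ps * w x) \<le> (?r + e) powr ps * lint R w"
    using strong_estimate_aux[OF C ps u, of "e / 4"] e by simp
  then have "lint R (\<lambda>x. \<bar>u x - cmean u 0 a\<bar> powr ps * w x) / lint R w \<le> (?r + e) powr ps"
    using W by (simp add: field_simps)
  then have "?l \<le> ((?r + e) powr ps) powr (1 / ps)"
    using ps W by (intro powr_mono2) (auto simp: lint_nonneg)
  also have "\<dots> = ?r + e" using ps r e by (simp add: powr_powr)
  finally show "?l \<le> ?r + e" .
qed

end

section \<open>Weighted norms of the gradient\<close>

lemma nn_integral_density_eq_0: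
  fixes w :: "real ^ 'n::finite \<Rightarrow> real"
  assumes w: "weight w" and R: "R \<in> sets borel" and 0: "(\<integral>\<^sup>+x\<in>R. ennreal (w x) \<partial>lborel) = 0"
  shows "(\<integral>\<^sup>+x\<in>R. ennreal (g x * w x) \<partial>lborel) = 0"
proof -
  have [measurable]: "w \<in> borel_measurable lebesgue" "R \<in> sets lebesgue" using weight_measurable[OF w] R by auto
  have wn: "0 \<le> w x" for x using w by (simp add: weight_def)
  have "(\<integral>\<^sup>+x\<in>R. ennreal (w x) \<partial>lebesgue) = 0" using 0 by (simp add: nn_integral_completion)
  then have "AE x in lebesgue. ennreal (w x) * indicator R x = 0"
    by (subst nn_integral_0_iff_AE[symmetric]) auto
  then have "AE x in lebesgue. ennreal (g x * w x) * indicator R x = 0"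
  proof eventually_elim
    case (elim x)
    show ?case
    proof (cases "x \<in> R")
      case True
      then have "w x = 0" using elim wn[of x] by (simp add: ennreal_eq_0_iff)
      then show ?thesis by simp
    qed simp
  qed
  then have "(\<integral>\<^sup>+x\<in>R. ennreal (g x * w x) \<partial>lebesgue) = (\<integral>\<^sup>+x. 0 \<partial>(lebesgue :: (real ^ 'n) measure))"
    by (rule nn_integral_cong_AE)
  then show ?thesis by (simp add: nn_integral_completion)
qed

lemma wnorm_eq:
  fixes w :: "real ^ 'n::finite \<Rightarrow> real"
  assumes W: "0 < lint R w" and g: "(\<integral>\<^sup>+x\<in>R. ennreal (norm (g x) powr r * w x) \<partial>lborel) < \<infinity>" and r: "0 < r"
  shows "wnorm R w r g = ennreal ((lint R (\<lambda>x. norm (g x) powr r * w x) / lint R w) powr (1 / r))"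
proof -
  have "(\<integral>\<^sup>+x\<in>R. ennreal (w x) \<partial>lborel) \<noteq> \<infinity>" using W by (auto simp: lint_def)
  then have "(\<integral>\<^sup>+x\<in>R. ennreal (w x) \<partial>lborel) = ennreal (lint R w)" by (simp add: lint_def less_top)
  moreover have "(\<integral>\<^sup>+x\<in>R. ennreal (norm (g x) powr r * w x) \<partial>lborel) = ennreal (lint R (\<lambda>x. norm (g x) powr r * w x))"
    using g by (simp add: lint_def)
  ultimately show ?thesis
    unfolding wnorm_def nn_integral_completion using W r
    by (simp add: divide_ennreal lint_nonneg epowr_ennreal)
qed

lemma wnorm_eq_0:
  assumes "(\<integral>\<^sup>+x\<in>R. ennreal (norm (g x) powr r * w x) \<partial>lborel) = 0" "0 < r"
  shows "wnorm R w r g = 0"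
  unfolding wnorm_def nn_integral_completion using assms by (simp add: epowr_def)

lemma partial_grad_component:
  "partial_grad S f x $ i = (if i \<in> S then ddir f (axis i 1) x else 0)"
  by (simp add: partial_grad_def ddir_def)

lemma borel_measurable_partial_grad:
  fixes f :: "real ^ 'n::finite \<Rightarrow> real"
  assumes "C-lipschitz_on UNIV f" shows "(\<lambda>x. norm (partial_grad S f x)) \<in> borel_measurable borel"
proof -
  have [measurable]: "ddir f e \<in> borel_measurable borel" for e
    by (rule borel_measurable_ddir[OF lipschitz_on_continuous_on[OF assms]])
  have "(\<lambda>x. norm (partial_grad S f x)) = (\<lambda>x. sqrt (\<Sum>i\<in>UNIV. (if i \<in> S then ddir f (axis i 1) x else 0)\<^sup>2))"
    by (simp add: norm_vec_def L2_set_def partial_grad_component)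
  then show ?thesis by simp
qed

lemma partial_grad_bounded:
  fixes f :: "real ^ 'n::finite \<Rightarrow> real"
  assumes "C-lipschitz_on UNIV f" shows "\<exists>B. \<forall>x. norm (partial_grad S f x) \<le> B"
proof -
  have "\<forall>i. \<exists>B. \<forall>x. \<bar>ddir f (axis i 1) x\<bar> \<le> B" using bounded_ddir[OF assms] by blast
  then obtain B where B: "\<bar>ddir f (axis i 1) x\<bar> \<le> B i" for i x by metis
  have "norm (partial_grad S f x) \<le> (\<Sum>i\<in>UNIV. B i)" for x
  proof -
    have "norm (partial_grad S f x) \<le> (\<Sum>i\<in>UNIV. \<bar>partial_grad S f x $ i\<bar>)" by (rule norm_le_l1_cart)
    also have "\<dots> \<le> (\<Sum>i\<in>UNIV. B i)"
      using B order_trans[OF abs_ge_zero B] by (intro sum_mono) (simp add: partial_grad_component)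
    finally show ?thesis .
  qed
  then show ?thesis by blast
qed

context dyadic_rectangle begin

lemma dsum_le_partial_grad:
  "dsum f x \<le> real CARD('n) * (l1 * norm (partial_grad S f x) + l2 * norm (partial_grad (- S) f x))"
proof -
  have "L i * \<bar>ddir f (axis i 1) x\<bar> \<le> l1 * norm (partial_grad S f x) + l2 * norm (partial_grad (- S) f x)" for i
  proof (cases "i \<in> S")
    case True
    then have "L i * \<bar>ddir f (axis i 1) x\<bar> = l1 * \<bar>partial_grad S f x $ i\<bar>" by (simp add: L_def partial_grad_component)
    also have "\<dots> \<le> l1 * norm (partial_grad S f x)" using l1 by (intro mult_left_mono component_le_norm_cart) simp
    also have "\<dots> \<le> l1 * norm (partial_grad S f x) + l2 * norm (partial_grad (- S) f x)" using l2 by simp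
    finally show ?thesis .
  next
    case False
    then have "L i * \<bar>ddir f (axis i 1) x\<bar> = l2 * \<bar>partial_grad (- S) f x $ i\<bar>" by (simp add: L_def partial_grad_component)
    also have "\<dots> \<le> l2 * norm (partial_grad (- S) f x)" using l2 by (intro mult_left_mono component_le_norm_cart) simp
    also have "\<dots> \<le> l1 * norm (partial_grad S f x) + l2 * norm (partial_grad (- S) f x)" using l1 by simp
    finally show ?thesis .
  qed
  then show ?thesis unfolding dsum_def
    by (intro order_trans[OF sum_bounded_above[where K = "l1 * norm (partial_grad S f x) + l2 * norm (partial_grad (- S) f x)"]]) auto
qed

lemma dsum_powr_integral_le:
  assumes f: "C-lipschitz_on UNIV f" and w: "weight w" and p: "1 \<le> p"
  defines "R \<equiv> rectangle S a l1 l2"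
  shows "lint R (\<lambda>x. dsum f x powr p * w x) \<le> (2 * real CARD('n)) powr p *
    (l1 powr p * lint R (\<lambda>x. norm (partial_grad S f x) powr p * w x)
      + l2 powr p * lint R (\<lambda>x. norm (partial_grad (- S) f x) powr p * w x))"
proof -
  have Rr: "R \<in> rectangles S" unfolding R_def using ccell_rectangles[of 0 a] root_ccell[OF a_in_root] by simp
  note cR = rectangles_compact[OF Rr]
  have wn: "0 \<le> w y" for y using w by (simp add: weight_def)
  have [measurable]: "w \<in> borel_measurable lebesgue" by (rule weight_measurable[OF w])
  have [measurable]: "R \<in> sets lebesgue" using rectangles_sets[OF Rr] by simp
  let ?g = "\<lambda>U x. norm (partial_grad U f x)"
  have [measurable]: "?g U \<in> borel_measurable lebesgue" for U
    using borel_measurable_partial_grad[OF f] by (simp add: measurable_completion)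
  have fin: "(\<integral>\<^sup>+x\<in>R. ennreal (?g U x powr p * w x) \<partial>lebesgue) = ennreal (lint R (\<lambda>x. ?g U x powr p * w x))" for U
  proof -
    obtain B where "?g U x \<le> B" for x using partial_grad_bounded[OF f] by blast
    then have "(\<integral>\<^sup>+x\<in>R. ennreal (?g U x powr p * w x) \<partial>lborel) < \<infinity>"
      by (intro weighted_finite[OF w cR order_refl, of _ "B powr p"]) (use p in \<open>auto intro!: powr_mono2\<close>)
    then show ?thesis by (simp add: lint_def nn_integral_completion)
  qed
  let ?c = "(2 * real CARD('n)) powr p"
  \<comment> \<open>A sum is at most twice the maximum, and a power of the maximum is at most the
    sum of the powers. This avoids Minkowski's inequality at the price of the factor 2.\<close>
  have pt: "dsum f x powr p \<le> ?c * (l1 powr p * ?g S x powr p + l2 powr p * ?g (- S) x powr p)" for x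
  proof -
    define y z where "y = l1 * ?g S x" and "z = l2 * ?g (- S) x"
    have yz: "0 \<le> y" "0 \<le> z" using l1 l2 by (auto simp: y_def z_def)
    have "dsum f x powr p \<le> (2 * real CARD('n) * max y z) powr p"
    proof (intro powr_mono2)
      have "dsum f x \<le> real CARD('n) * (y + z)" using dsum_le_partial_grad[of f x] by (simp add: y_def z_def)
      also have "\<dots> \<le> real CARD('n) * (2 * max y z)" by (intro mult_left_mono) auto
      finally show "dsum f x \<le> 2 * real CARD('n) * max y z" by simp
    qed (use p dsum_nonneg in auto)
    also have "\<dots> = ?c * max y z powr p" by (rule powr_mult)
    also have "max y z powr p \<le> y powr p + z powr p" by (simp add: max_def)
    finally show ?thesis by (simp add: y_def z_def powr_mult mult_left_mono)
  qed
  have "(\<integral>\<^sup>+x\<in>R. ennreal (dsum f x powr p * w x) \<partial>lebesgue)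
    \<le> (\<integral>\<^sup>+x. ennreal (?c * l1 powr p) * (ennreal (?g S x powr p * w x) * indicator R x)
        + ennreal (?c * l2 powr p) * (ennreal (?g (- S) x powr p * w x) * indicator R x) \<partial>lebesgue)"
  proof (rule nn_integral_mono)
    fix x
    have "dsum f x powr p * w x \<le> ?c * (l1 powr p * ?g S x powr p + l2 powr p * ?g (- S) x powr p) * w x"
      using pt wn by (rule mult_right_mono)
    also have "\<dots> = (?c * l1 powr p) * (?g S x powr p * w x) + (?c * l2 powr p) * (?g (- S) x powr p * w x)"
      by (simp only: distrib_left distrib_right mult_ac)
    finally have "ennreal (dsum f x powr p * w x) \<le> ennreal ((?c * l1 powr p) * (?g S x powr p * w x) + (?c * l2 powr p) * (?g (- S) x powr p * w x))"
      by (rule ennreal_leI)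
    also have "\<dots> = ennreal (?c * l1 powr p) * ennreal (?g S x powr p * w x) + ennreal (?c * l2 powr p) * ennreal (?g (- S) x powr p * w x)"
      using wn by (subst ennreal_plus) (auto simp: ennreal_mult[symmetric] simp del: ennreal_mult')
    finally show "ennreal (dsum f x powr p * w x) * indicator R x \<le> ennreal (?c * l1 powr p) * (ennreal (?g S x powr p * w x) * indicator R x)
        + ennreal (?c * l2 powr p) * (ennreal (?g (- S) x powr p * w x) * indicator R x)"
      by (cases "x \<in> R") simp_all
  qed
  also have "\<dots> = ennreal (?c * l1 powr p) * ennreal (lint R (\<lambda>x. ?g S x powr p * w x))
      + ennreal (?c * l2 powr p) * ennreal (lint R (\<lambda>x. ?g (- S) x powr p * w x))"
    by (subst nn_integral_add; (simp add: nn_integral_cmult fin)?)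
  also have "\<dots> = ennreal (?c * (l1 powr p * lint R (\<lambda>x. ?g S x powr p * w x) + l2 powr p * lint R (\<lambda>x. ?g (- S) x powr p * w x)))"
    by (simp add: distrib_left lint_nonneg mult.assoc flip: ennreal_mult ennreal_plus)
  finally show ?thesis unfolding lint_def[of R "\<lambda>x. dsum f x powr p * w x"] nn_integral_completion
    by (intro enn2real_leI) (auto simp: lint_nonneg intro!: mult_nonneg_nonneg add_nonneg_nonneg)
qed

lemma const_of_dsum_eq_0:
  assumes f: "C-lipschitz_on UNIV f" and 0: "lint (rectangle S a l1 l2) (dsum f) = 0"
  shows "AE x in lborel. x \<in> rectangle S a l1 l2 \<longrightarrow> f x = cmean f 0 a"
proof -
  let ?R = "rectangle S a l1 l2"
  have R: "ccell 0 a = ?R" by (rule root_ccell[OF a_in_root])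
  have [measurable]: "f \<in> borel_measurable borel" by (rule borel_measurable_continuous_onI[OF lipschitz_on_continuous_on[OF f]])
  have [measurable]: "?R \<in> sets borel" using sets_ccell[of 0 a] R by simp
  have "(\<integral>\<^sup>+y\<in>?R. ennreal \<bar>f y - cmean f 0 a\<bar> \<partial>lborel) = 0"
    using poincare_ccell[OF f, of 0 a] 0 by (simp add: R)
  then have "AE y in lborel. ennreal \<bar>f y - cmean f 0 a\<bar> * indicator ?R y = 0"
    by (subst nn_integral_0_iff_AE[symmetric]) auto
  then show ?thesis by eventually_elim (auto split: split_indicator_asm)
qed

end

section \<open>Degenerate cases and the assembly of the estimate\<close>

lemma mean_lipschitz:
  fixes f :: "real ^ 'n::finite \<Rightarrow> real"
  assumes f: "C-lipschitz_on UNIV f" and R: "R \<in> sets borel"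
  shows "mean R f = (LINT x:R|lborel. f x) / measure lborel R"
proof -
  have [measurable]: "f \<in> borel_measurable borel" by (rule borel_measurable_continuous_onI[OF lipschitz_on_continuous_on[OF f]])
  show ?thesis unfolding mean_def set_lebesgue_integral_def
    using R by (subst integral_completion) auto
qed

lemma wnorm_eq_0_of_AE:
  fixes w :: "real ^ 'n::finite \<Rightarrow> real"
  assumes "AE x in lborel. x \<in> R \<longrightarrow> g x = 0" "0 < r"
  shows "wnorm R w r g = 0"
proof (rule wnorm_eq_0[OF _ assms(2)])
  have "(\<integral>\<^sup>+x\<in>R. ennreal (norm (g x) powr r * w x) \<partial>lborel) = (\<integral>\<^sup>+x. 0 \<partial>(lborel :: (real ^ 'n) measure))"
    by (rule nn_integral_cong_AE, rule eventually_mono[OF assms(1)]) (auto split: split_indicator)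
  then show "(\<integral>\<^sup>+x\<in>R. ennreal (norm (g x) powr r * w x) \<partial>lborel) = 0" by simp
qed

text \<open>At almost every point of \<open>Q\<close> either \<open>g\<close> or \<open>w\<close>
  vanishes, so the weighted integral is zero for the exponent \<open>q\<close> as well, and the
  finite A_q constant then removes the weight. This handles an infinite A_p constant.\<close>

lemma lint_eq_0_of_weighted_powr:
  fixes w :: "real ^ 'n::finite \<Rightarrow> real"
  assumes w: "weight w" and Q: "Q \<in> rectangles S" and q: "1 \<le> q"
    and K: "A_const S q w = ennreal K" "0 \<le> K" and W: "0 < lint Q w"
    and g: "g \<in> borel_measurable borel" "\<And>x. 0 \<le> g x" "\<And>x. g x \<le> B"
    and p: "0 < p" and 0: "lint Q (\<lambda>x. g x powr p * w x) = 0"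
  shows "lint Q g = 0"
proof -
  have wn: "0 \<le> w y" for y using w by (simp add: weight_def)
  note cQ = rectangles_compact[OF Q]
  have [measurable]: "w \<in> borel_measurable lebesgue" by (rule weight_measurable[OF w])
  have [measurable]: "Q \<in> sets lebesgue" using rectangles_sets[OF Q] by simp
  have [measurable]: "g \<in> borel_measurable lebesgue" using g by (simp add: measurable_completion)
  have "(\<integral>\<^sup>+x\<in>Q. ennreal (g x powr p * w x) \<partial>lborel) < \<infinity>"
    by (rule weighted_finite[OF w cQ order_refl, of _ "B powr p"]) (use g p in \<open>auto intro!: powr_mono2\<close>)
  then have "(\<integral>\<^sup>+x\<in>Q. ennreal (g x powr p * w x) \<partial>lebesgue) = 0"
    using 0 by (auto simp: lint_def nn_integral_completion enn2real_eq_0_iff)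
  then have "AE x in lebesgue. ennreal (g x powr p * w x) * indicator Q x = 0"
    by (subst nn_integral_0_iff_AE[symmetric]) auto
  then have "AE x in lebesgue. ennreal (g x powr q * w x) * indicator Q x = 0"
  proof eventually_elim
    case (elim x)
    show ?case
    proof (cases "x \<in> Q")
      case True
      then have "g x powr p * w x \<le> 0" using elim by (simp add: ennreal_eq_0_iff)
      moreover have "0 \<le> g x powr p * w x" using wn[of x] by simp
      ultimately have "g x powr p * w x = 0" by linarith
      then have "g x = 0 \<or> w x = 0" by simp
      then show ?thesis by auto
    qed simp
  qed
  then have "(\<integral>\<^sup>+x\<in>Q. ennreal (g x powr q * w x) \<partial>lebesgue) = (\<integral>\<^sup>+x. 0 \<partial>(lebesgue :: (real ^ 'n) measure))"
    by (rule nn_integral_cong_AE)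
  then have z: "lint Q (\<lambda>x. g x powr q * w x) = 0" by (simp add: lint_def nn_integral_completion)
  have "(lint Q g / measure lborel Q) powr q \<le> K * lint Q (\<lambda>x. g x powr q * w x) / lint Q w"
    by (rule A_Holder_real[OF w Q q K W g])
  then have "(lint Q g / measure lborel Q) powr q = 0" unfolding z by (intro antisym) simp_all
  then show ?thesis using measure_rectangle_pos[OF Q] by simp
qed

context dyadic_rectangle begin

text \<open>The A_p constant is kept in \<open>[0, \<infinity>]\<close> and not shown to be finite.
  If it is infinite, the right-hand side is infinite unless both gradient norms vanish, and then the
  A_q condition makes \<open>f\<close> constant almost everywhere on \<open>R\<close>.\<close>

lemma weighted_poincare_sobolev:
  fixes w :: "real ^ 'n \<Rightarrow> real"
  assumes q: "1 \<le> q" "q \<le> p" and C: "0 < C" "\<And>K. 1 \<le> K \<Longrightarrow> dyadic_sum_bound CARD('n) q p K C"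
    and w: "w \<in> A_class S q" and ps: "0 < ps"
      "1 / p - 1 / ps = 1 / real CARD('n) * (1 / (q + ln (enn2real (A_const S q w))))"
    and f: "D-lipschitz_on UNIV f"
  defines "R \<equiv> rectangle S a l1 l2"
  shows "wnorm R w ps (\<lambda>x. f x - mean R f)
    \<le> ennreal ((4 + 16 * 2 ^ CARD('n) * C) * (2 * real CARD('n))) * epowr (A_const S p w) (1 / p) *
      (ennreal l1 * wnorm R w p (partial_grad S f) + ennreal l2 * wnorm R w p (partial_grad (- S) f))"
proof -
  have w': "weight w" and Kfin: "A_const S q w < \<infinity>" using w by (auto simp: A_class_def)
  define K where "K = enn2real (A_const S q w)"
  have K: "A_const S q w = ennreal K" "0 \<le> K" using Kfin by (auto simp: K_def)
  have p: "1 \<le> p" using q by simp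
  have R0: "ccell 0 a = R" unfolding R_def by (rule root_ccell[OF a_in_root])
  have Rr: "R \<in> rectangles S" using ccell_rectangles[of 0 a] by (simp add: R0)
  note cR = rectangles_compact[OF Rr] and sR = rectangles_sets[OF Rr]
  have mean: "mean R f = cmean f 0 a" unfolding mean_lipschitz[OF f sR] cmean_def R0 ..
  show ?thesis
  \<comment> \<open>If the weight of \<open>R\<close> is zero, the quotient in \<open>wnorm\<close>
    is \<open>0 / 0\<close>, which is 0 in \<open>ennreal\<close>.\<close>
  proof (cases "lint R w = 0")
    case True
    have "(\<integral>\<^sup>+x\<in>R. ennreal (w x) \<partial>lborel) = 0"
      using True weight_finite_lborel[OF w' cR order_refl] by (auto simp: lint_def enn2real_eq_0_iff)
    then have "wnorm R w ps (\<lambda>x. f x - mean R f) = 0"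
      by (intro wnorm_eq_0 nn_integral_density_eq_0[OF w' sR] ps)
    then show ?thesis by simp
  next
    case False
    then have W: "0 < lint R w" using lint_nonneg[of R w] by linarith
    let ?Y = "\<lambda>U. lint R (\<lambda>x. norm (partial_grad U f x) powr p * w x)"
    define X where "X = (\<lambda>U. (?Y U / lint R w) powr (1 / p))"
    have X0: "0 \<le> X U" for U by (simp add: X_def)
    have Y: "?Y U = X U powr p * lint R w" for U
      using W p by (simp add: X_def powr_powr lint_nonneg)
    have wX: "wnorm R w p (partial_grad U f) = ennreal (X U)" for U
      unfolding X_def
    proof (rule wnorm_eq[OF W])
      obtain B where "norm (partial_grad U f x) \<le> B" for x using partial_grad_bounded[OF f] by blast
      then show "(\<integral>\<^sup>+x\<in>R. ennreal (norm (partial_grad U f x) powr p * w x) \<partial>lborel) < \<infinity>"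
        by (intro weighted_finite[OF w' cR order_refl, of _ "B powr p"]) (use p in \<open>auto intro!: powr_mono2\<close>)
    qed (use p in simp)
    \<comment> \<open>The sum a_1(R) + a_2(R) of the theorem, as a real number.\<close>
    define A where "A = l1 * X S + l2 * X (- S)"
    have A0: "0 \<le> A" using l1 l2 X0 by (simp add: A_def)
    have sumA: "ennreal l1 * wnorm R w p (partial_grad S f) + ennreal l2 * wnorm R w p (partial_grad (- S) f) = ennreal A"
      unfolding wX A_def using l1 l2 X0 by (simp add: ennreal_mult)
    have "lint R (\<lambda>x. dsum f x powr p * w x) \<le> (2 * real CARD('n)) powr p * (l1 powr p * ?Y S + l2 powr p * ?Y (- S))"
      unfolding R_def by (rule dsum_powr_integral_le[OF f w' p])
    also have "\<dots> = (2 * real CARD('n)) powr p * ((l1 * X S) powr p + (l2 * X (- S)) powr p) * lint R w"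
      unfolding Y powr_mult[of l1] powr_mult[of l2] by (simp add: algebra_simps)
    also have "\<dots> \<le> (2 * real CARD('n)) powr p * A powr p * lint R w"
      unfolding A_def using l1 l2 X0 p by (intro mult_right_mono mult_left_mono powr_superadditive) (auto simp: lint_nonneg)
    also have "\<dots> = (2 * real CARD('n) * A) powr p * lint R w" unfolding powr_mult ..
    finally have E: "lint R (\<lambda>x. dsum f x powr p * w x) \<le> (2 * real CARD('n) * A) powr p * lint R w" .
    show ?thesis
    proof (cases "A_const S p w = \<infinity>")
      case True
      show ?thesis
      proof (cases "A = 0")
        case False
        then have "ennreal A \<noteq> 0" using A0 by (simp add: ennreal_eq_0_iff)
        moreover have "epowr (A_const S p w) (1 / p) = \<infinity>" using True p by (simp add: epowr_def)
        moreover have "ennreal ((4 + 16 * 2 ^ CARD('n) * C) * (2 * real CARD('n))) \<noteq> 0"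
        proof -
          have "0 < (4 + 16 * 2 ^ CARD('n) * C) * (2 * real CARD('n))" using C by (intro mult_pos_pos add_pos_pos) auto
          then show ?thesis by (metis ennreal_eq_0_iff not_le)
        qed
        ultimately show ?thesis unfolding sumA by (simp add: ennreal_mult_top ennreal_top_mult)
      next
        case A: True
        obtain B where B: "\<And>x. dsum f x \<le> B" using dsum_bounded[OF f] by blast
        have "lint R (\<lambda>x. dsum f x powr p * w x) = 0"
          using E lint_nonneg[of R "\<lambda>x. dsum f x powr p * w x"] by (simp add: A)
        then have "lint R (dsum f) = 0"
          by (intro lint_eq_0_of_weighted_powr[OF w' Rr q(1) K W borel_measurable_dsum[OF f] dsum_nonneg B, of p]) (use p in auto)
        then have "AE x in lborel. x \<in> R \<longrightarrow> f x = mean R f"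
          using const_of_dsum_eq_0[OF f, folded R_def] by (simp add: mean)
        then have "wnorm R w ps (\<lambda>x. f x - mean R f) = 0"
          by (intro wnorm_eq_0_of_AE ps) simp
        then show ?thesis by simp
      qed
    next
      case False
      define Kp where "Kp = enn2real (A_const S p w)"
      have Kp: "A_const S p w = ennreal Kp" "0 \<le> Kp" using False by (auto simp: Kp_def less_top)
      interpret wd: weighted_dyadic_rectangle S a l1 l2 w p q K Kp
        by unfold_locales (use w' q K Kp W in \<open>auto simp: R_def\<close>)
      let ?h = "\<lambda>x. \<bar>f x - cmean f 0 a\<bar> powr ps"
      have fin: "(\<integral>\<^sup>+x\<in>R. ennreal (norm (f x - mean R f) powr ps * w x) \<partial>lborel) < \<infinity>"
      proof -
        have "compact ((\<lambda>x. f x - mean R f) ` R)"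
          by (intro compact_continuous_image cR continuous_intros continuous_on_subset[OF lipschitz_on_continuous_on[OF f]]) simp
        then obtain B where B: "norm (f x - mean R f) \<le> B" if "x \<in> R" for x
          by (meson bounded_iff compact_imp_bounded imageI)
        have "(\<integral>\<^sup>+x\<in>R. ennreal (norm (f x - mean R f) powr ps * w x) \<partial>lborel)
          = (\<integral>\<^sup>+x\<in>R. ennreal (min (norm (f x - mean R f) powr ps) (B powr ps) * w x) \<partial>lborel)"
          using B ps by (intro nn_integral_cong) (auto simp: min_absorb1 powr_mono2 split: split_indicator)
        also have "\<dots> < \<infinity>" by (rule weighted_finite[OF w' cR order_refl, of _ "B powr ps"]) auto
        finally show ?thesis .
      qed
      have lhs: "wnorm R w ps (\<lambda>x. f x - mean R f) = ennreal ((lint R (\<lambda>x. ?h x * w x) / lint R w) powr (1 / ps))"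
        using wnorm_eq[OF W fin ps(1)] by (simp add: mean)
      have ps': "1 / p - 1 / ps = 1 / (real CARD('n) * (q + ln K))" using ps(2) by (simp add: K_def)
      have "(lint R (\<lambda>x. ?h x * w x) / lint R w) powr (1 / ps)
        \<le> (4 + 16 * 2 ^ CARD('n) * C) * (Kp powr (1 / p) * (wd.energy f R / lint R w) powr (1 / p))"
        unfolding R_def by (rule wd.strong_estimate[OF C(2)[OF wd.K_ge_1] C(1) ps(1) ps' f])
      also have "\<dots> \<le> (4 + 16 * 2 ^ CARD('n) * C) * (Kp powr (1 / p) * (2 * real CARD('n) * A))"
      proof (intro mult_left_mono)
        have "wd.energy f R / lint R w \<le> (2 * real CARD('n) * A) powr p"
          using E W by (simp add: wd.energy_def field_simps)
        then have "(wd.energy f R / lint R w) powr (1 / p) \<le> ((2 * real CARD('n) * A) powr p) powr (1 / p)"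
          using p W by (intro powr_mono2) (auto simp: wd.energy_nonneg)
        also have "\<dots> = 2 * real CARD('n) * A" using p A0 by (simp add: powr_powr)
        finally show "(wd.energy f R / lint R w) powr (1 / p) \<le> 2 * real CARD('n) * A" .
      qed (use C in auto)
      also have "\<dots> = (4 + 16 * 2 ^ CARD('n) * C) * (2 * real CARD('n)) * Kp powr (1 / p) * A"
        by (simp only: mult_ac)
      finally have "wnorm R w ps (\<lambda>x. f x - mean R f)
        \<le> ennreal ((4 + 16 * 2 ^ CARD('n) * C) * (2 * real CARD('n)) * Kp powr (1 / p) * A)"
        unfolding lhs by (rule ennreal_leI)
      also have "\<dots> = ennreal ((4 + 16 * 2 ^ CARD('n) * C) * (2 * real CARD('n))) * epowr (A_const S p w) (1 / p) * ennreal A"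
      proof -
        have "0 \<le> (4 + 16 * 2 ^ CARD('n) * C) * (2 * real CARD('n))" using C by (intro mult_nonneg_nonneg add_nonneg_nonneg) auto
        moreover have "epowr (A_const S p w) (1 / p) = ennreal (Kp powr (1 / p))" using Kp p by (simp add: epowr_ennreal)
        ultimately show ?thesis using A0 by (simp only: ennreal_mult mult_nonneg_nonneg powr_ge_zero)
      qed
      finally show ?thesis unfolding sumA .
    qed
  qed
qed

end

theorem theorem2p16:
  fixes p q :: real
  assumes "1 \<le> q" and "q \<le> p"
    and "\<not> (q = 1 \<and> p = real CARD('n::finite))"
  shows "\<exists>c::real. c > 0 \<and>
    (\<forall>(S :: 'n set) (w :: real ^ 'n \<Rightarrow> real) (pstar :: real).
       S \<noteq> {} \<longrightarrow> - S \<noteq> {} \<longrightarrow>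
       w \<in> A_class S q \<longrightarrow>
       0 < pstar \<longrightarrow>
       1 / p - 1 / pstar = 1 / real CARD('n) * (1 / (q + ln (enn2real (A_const S q w)))) \<longrightarrow>
       (\<forall>(f :: real ^ 'n \<Rightarrow> real) a l1 l2.
          (\<exists>L. L-lipschitz_on UNIV f) \<longrightarrow> 0 < l1 \<longrightarrow> 0 < l2 \<longrightarrow>
          (let R = rectangle S a l1 l2 in
             wnorm R w pstar (\<lambda>x. f x - mean R f)
               \<le> ennreal c * epowr (A_const S p w) (1 / p) *
                 (ennreal l1 * wnorm R w p (partial_grad S f) +
                  ennreal l2 * wnorm R w p (partial_grad (- S) f)))))"
proof -
  obtain C where C: "0 < C" "\<And>K. 1 \<le> K \<Longrightarrow> dyadic_sum_bound CARD('n) q p K C"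
    using dyadic_sum_bound_uniform[OF zero_less_card_finite assms] by blast
  show ?thesis
    unfolding Let_def
  proof (intro exI[of _ "(4 + 16 * 2 ^ CARD('n) * C) * (2 * real CARD('n))"] conjI allI impI)
    show "0 < (4 + 16 * 2 ^ CARD('n) * C) * (2 * real CARD('n))"
      using C(1) by (intro mult_pos_pos add_pos_pos) auto
    fix S :: "'n set" and w :: "real ^ 'n \<Rightarrow> real" and pstar :: real
      and f :: "real ^ 'n \<Rightarrow> real" and a :: "real ^ 'n" and l1 l2 :: real
    assume w: "w \<in> A_class S q" and ps: "0 < pstar"
        "1 / p - 1 / pstar = 1 / real CARD('n) * (1 / (q + ln (enn2real (A_const S q w))))"
      and f: "\<exists>L. L-lipschitz_on UNIV f" and l: "0 < l1" "0 < l2"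
    interpret dyadic_rectangle S a l1 l2 by unfold_locales (use l in auto)
    from f obtain D where D: "D-lipschitz_on UNIV f" by blast
    show "wnorm (rectangle S a l1 l2) w pstar (\<lambda>x. f x - mean (rectangle S a l1 l2) f)
      \<le> ennreal ((4 + 16 * 2 ^ CARD('n) * C) * (2 * real CARD('n))) * epowr (A_const S p w) (1 / p) *
        (ennreal l1 * wnorm (rectangle S a l1 l2) w p (partial_grad S f) +
         ennreal l2 * wnorm (rectangle S a l1 l2) w p (partial_grad (- S) f))"
      by (rule weighted_poincare_sobolev[OF assms(1,2) C w ps D])
  qed
qed

end
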